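(* Let $\mathcal{C}$ be a finitely aligned left cancellative small category. Then the map $V\colon\mathcal{C}\to\mathcal{T}_\ell(\mathcal{C})$ sending each $\alpha$ to $V_\alpha$ is a representation of $\mathcal{C}$ in $\mathcal{T}_\ell(\mathcal{C})$, and the canonical homomorphism $\phi_V$ from the Toeplitz algebra $\mathcal{T}(\mathcal{C})$ into $\mathcal{T}_\ell(\mathcal{C})$ is onto.
   Context: Small categories: a small category $\mathcal{C}$ is identified with its set of morphisms; $\mathcal{C}^0\subseteq\mathcal{C}$ (nonempty) is the set of vertices (objects, identified with identity morphisms), $r,s\colon\mathcal{C}\to\mathcal{C}^0$ are the range and source maps, and $\alpha\beta$ is defined iff $s(\alpha)=r(\beta)$. $\mathcal{C}$ is left cancellative if $\alpha\beta=\alpha\gamma$ implies $\beta=\gamma$. Write $\alpha\mathcal{C}=\{\alpha\beta: r(\beta)=s(\alpha)\}$. $\mathcal{C}$ is finitely aligned if for all $\alpha,\beta\in\mathcal{C}$ there is a finite (possibly empty) $F\subseteq\mathcal{C}$ with $\alpha\mathcal{C}\cap\beta\mathcal{C}=\bigcup_{\gamma\in F}\gamma\mathcal{C}$; $\alpha\vee\beta$ denotes any such $F$ that is independent ($\gamma\notin\gamma'\mathcal{C}$ for distinct $\gamma,\gamma'\in F$). A representation of $\mathcal{C}$ in a $C^*$-algebra $B$ is a map $T\colon\mathcal{C}\to B$ such that for all $\alpha,\beta$: $T_\alpha^*T_\alpha=T_{s(\alpha)}$; $T_\alpha T_\beta=T_{\alpha\beta}$ if $s(\alpha)=r(\beta)$;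 $T_\alpha T_\alpha^*T_\beta T_\beta^*=\bigvee_{\gamma\in\alpha\vee\beta}T_\gamma T_\gamma^*$ (join of projections, a priori in $B^{**}$; empty join $=0$). The Toeplitz algebra $(\mathcal{T}(\mathcal{C}),t)$ is universal for representations: for every representation $T$ in $B$ there is a unique homomorphism $\phi_T\colon\mathcal{T}(\mathcal{C})\to B$ with $\phi_T(t_\alpha)=T_\alpha$ for all $\alpha$. For $\alpha\in\mathcal{C}$, $V_\alpha$ is the bounded operator on $\ell^2(\mathcal{C})$ with $V_\alpha\delta_\gamma=\delta_{\alpha\gamma}$ if $\gamma\in s(\alpha)\mathcal{C}$ and $V_\alpha\delta_\gamma=0$ otherwise ($\{\delta_\gamma\}$ the canonical orthonormal basis). The regular Toeplitz algebra $\mathcal{T}_\ell(\mathcal{C})$ is the $C^*$-subalgebra of $\mathcal{B}(\ell^2(\mathcal{C}))$ generated by $\{V_\alpha:\alpha\in\mathcal{C}\}$. *)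

theory Defs
  imports "HOL-Analysis.Analysis"
begin

section \<open>Left cancellative small categories\<close>

text \<open>A small category is identified with its set of morphisms; \<open>vert\<close> consists of the
  identity morphisms. \<open>cmp \<alpha> \<beta>\<close> is only meaningful when \<open>src \<alpha> = rng \<beta>\<close>.\<close>

record 'c small_cat =
  mor :: "'c set"
  vert :: "'c set"
  rng :: "'c \<Rightarrow> 'c"
  src :: "'c \<Rightarrow> 'c"
  cmp :: "'c \<Rightarrow> 'c \<Rightarrow> 'c"

locale small_category =
  fixes \<C> :: "'c small_cat"
  assumes vert_subset: "vert \<C> \<subseteq> mor \<C>"
    and vert_nonempty: "vert \<C> \<noteq> {}"
    and rng_vert: "\<alpha> \<in> mor \<C> \<Longrightarrow> rng \<C> \<alpha> \<in> vert \<C>"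
    and src_vert: "\<alpha> \<in> mor \<C> \<Longrightarrow> src \<C> \<alpha> \<in> vert \<C>"
    and rng_id: "v \<in> vert \<C> \<Longrightarrow> rng \<C> v = v"
    and src_id: "v \<in> vert \<C> \<Longrightarrow> src \<C> v = v"
    and cmp_closed: "\<lbrakk>\<alpha> \<in> mor \<C>; \<beta> \<in> mor \<C>; src \<C> \<alpha> = rng \<C> \<beta>\<rbrakk> \<Longrightarrow> cmp \<C> \<alpha> \<beta> \<in> mor \<C>"
    and rng_cmp: "\<lbrakk>\<alpha> \<in> mor \<C>; \<beta> \<in> mor \<C>; src \<C> \<alpha> = rng \<C> \<beta>\<rbrakk> \<Longrightarrow> rng \<C> (cmp \<C> \<alpha> \<beta>) = rng \<C> \<alpha>"
    and src_cmp: "\<lbrakk>\<alpha> \<in> mor \<C>; \<beta> \<in> mor \<C>; src \<C> \<alpha> = rng \<C> \<beta>\<rbrakk> \<Longrightarrow> src \<C> (cmp \<C> \<alpha> \<beta>) = src \<C> \<beta>"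
    and cmp_assoc: "\<lbrakk>\<alpha> \<in> mor \<C>; \<beta> \<in> mor \<C>; \<gamma> \<in> mor \<C>; src \<C> \<alpha> = rng \<C> \<beta>; src \<C> \<beta> = rng \<C> \<gamma>\<rbrakk>
      \<Longrightarrow> cmp \<C> (cmp \<C> \<alpha> \<beta>) \<gamma> = cmp \<C> \<alpha> (cmp \<C> \<beta> \<gamma>)"
    and cmp_rng: "\<alpha> \<in> mor \<C> \<Longrightarrow> cmp \<C> (rng \<C> \<alpha>) \<alpha> = \<alpha>"
    and cmp_src: "\<alpha> \<in> mor \<C> \<Longrightarrow> cmp \<C> \<alpha> (src \<C> \<alpha>) = \<alpha>"

definition left_cancellative :: "'c small_cat \<Rightarrow> bool" where
  "left_cancellative \<C> \<longleftrightarrow>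
    (\<forall>\<alpha>\<in>mor \<C>. \<forall>\<beta>\<in>mor \<C>. \<forall>\<gamma>\<in>mor \<C>.
      src \<C> \<alpha> = rng \<C> \<beta> \<and> src \<C> \<alpha> = rng \<C> \<gamma> \<and> cmp \<C> \<alpha> \<beta> = cmp \<C> \<alpha> \<gamma> \<longrightarrow> \<beta> = \<gamma>)"

definition right_ideal :: "'c small_cat \<Rightarrow> 'c \<Rightarrow> 'c set" where
  "right_ideal \<C> \<alpha> = {cmp \<C> \<alpha> \<beta> | \<beta>. \<beta> \<in> mor \<C> \<and> rng \<C> \<beta> = src \<C> \<alpha>}"

definition finitely_aligned :: "'c small_cat \<Rightarrow> bool" where
  "finitely_aligned \<C> \<longleftrightarrow>
    (\<forall>\<alpha>\<in>mor \<C>. \<forall>\<beta>\<in>mor \<C>. \<exists>F. finite F \<and> F \<subseteq> mor \<C> \<and>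
      right_ideal \<C> \<alpha> \<inter> right_ideal \<C> \<beta> = (\<Union>\<gamma>\<in>F. right_ideal \<C> \<gamma>))"

text \<open>\<open>is_vee \<C> \<alpha> \<beta> F\<close> says that \<open>F\<close> is one of the sets denoted \<open>\<alpha> \<or> \<beta>\<close>; such a set is
  not unique in general.\<close>

definition is_vee :: "'c small_cat \<Rightarrow> 'c \<Rightarrow> 'c \<Rightarrow> 'c set \<Rightarrow> bool" where
  "is_vee \<C> \<alpha> \<beta> F \<longleftrightarrow> finite F \<and> F \<subseteq> mor \<C> \<and>
    right_ideal \<C> \<alpha> \<inter> right_ideal \<C> \<beta> = (\<Union>\<gamma>\<in>F. right_ideal \<C> \<gamma>) \<and>
    (\<forall>\<gamma>\<in>F. \<forall>\<gamma>'\<in>F. \<gamma> \<noteq> \<gamma>' \<longrightarrow> \<gamma> \<notin> right_ideal \<C> \<gamma>')"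


section \<open>C*-algebras\<close>

text \<open>C*-algebras are complex and not assumed unital. They are records with an explicit
  carrier, so that one can quantify over them and pass to subalgebras.\<close>

record 'a cstar_alg =
  carr :: "'a set"
  azero :: 'a ("\<zero>\<index>")
  aadd :: "'a \<Rightarrow> 'a \<Rightarrow> 'a" (infixl "\<oplus>\<index>" 65)
  ascale :: "complex \<Rightarrow> 'a \<Rightarrow> 'a" (infixr "\<odot>\<index>" 75)
  amult :: "'a \<Rightarrow> 'a \<Rightarrow> 'a" (infixl "\<otimes>\<index>" 70)
  astar :: "'a \<Rightarrow> 'a" ("_\<^sup>\<star>\<index>" [1000] 999)
  anorm :: "'a \<Rightarrow> real"

definition adiff :: "'a cstar_alg \<Rightarrow> 'a \<Rightarrow> 'a \<Rightarrow> 'a" (infixl "\<ominus>\<index>" 65) where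
  "x \<ominus>\<^bsub>B\<^esub> y = x \<oplus>\<^bsub>B\<^esub> ((-1) \<odot>\<^bsub>B\<^esub> y)"

locale cstar_algebra =
  fixes B :: "'a cstar_alg" (structure)
  assumes zero_closed: "\<zero> \<in> carr B"
    and add_closed: "\<lbrakk>x \<in> carr B; y \<in> carr B\<rbrakk> \<Longrightarrow> x \<oplus> y \<in> carr B"
    and scale_closed: "x \<in> carr B \<Longrightarrow> c \<odot> x \<in> carr B"
    and mult_closed: "\<lbrakk>x \<in> carr B; y \<in> carr B\<rbrakk> \<Longrightarrow> x \<otimes> y \<in> carr B"
    and star_closed: "x \<in> carr B \<Longrightarrow> x\<^sup>\<star> \<in> carr B"
    and add_assoc: "\<lbrakk>x \<in> carr B; y \<in> carr B; z \<in> carr B\<rbrakk> \<Longrightarrow> (x \<oplus> y) \<oplus> z = x \<oplus> (y \<oplus> z)"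
    and add_commute: "\<lbrakk>x \<in> carr B; y \<in> carr B\<rbrakk> \<Longrightarrow> x \<oplus> y = y \<oplus> x"
    and add_zero: "x \<in> carr B \<Longrightarrow> x \<oplus> \<zero> = x"
    and add_neg: "x \<in> carr B \<Longrightarrow> x \<oplus> ((-1) \<odot> x) = \<zero>"
    and scale_add_right: "\<lbrakk>x \<in> carr B; y \<in> carr B\<rbrakk> \<Longrightarrow> c \<odot> (x \<oplus> y) = c \<odot> x \<oplus> c \<odot> y"
    and scale_add_left: "x \<in> carr B \<Longrightarrow> (c + d) \<odot> x = c \<odot> x \<oplus> d \<odot> x"
    and scale_scale: "x \<in> carr B \<Longrightarrow> c \<odot> (d \<odot> x) = (c * d) \<odot> x"
    and scale_one: "x \<in> carr B \<Longrightarrow> 1 \<odot> x = x"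
    and mult_assoc: "\<lbrakk>x \<in> carr B; y \<in> carr B; z \<in> carr B\<rbrakk> \<Longrightarrow> (x \<otimes> y) \<otimes> z = x \<otimes> (y \<otimes> z)"
    and mult_add_left: "\<lbrakk>x \<in> carr B; y \<in> carr B; z \<in> carr B\<rbrakk> \<Longrightarrow> (x \<oplus> y) \<otimes> z = x \<otimes> z \<oplus> y \<otimes> z"
    and mult_add_right: "\<lbrakk>x \<in> carr B; y \<in> carr B; z \<in> carr B\<rbrakk> \<Longrightarrow> x \<otimes> (y \<oplus> z) = x \<otimes> y \<oplus> x \<otimes> z"
    and mult_scale_left: "\<lbrakk>x \<in> carr B; y \<in> carr B\<rbrakk> \<Longrightarrow> (c \<odot> x) \<otimes> y = c \<odot> (x \<otimes> y)"
    and mult_scale_right: "\<lbrakk>x \<in> carr B; y \<in> carr B\<rbrakk> \<Longrightarrow> x \<otimes> (c \<odot> y) = c \<odot> (x \<otimes> y)"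
    and star_star: "x \<in> carr B \<Longrightarrow> (x\<^sup>\<star>)\<^sup>\<star> = x"
    and star_add: "\<lbrakk>x \<in> carr B; y \<in> carr B\<rbrakk> \<Longrightarrow> (x \<oplus> y)\<^sup>\<star> = x\<^sup>\<star> \<oplus> y\<^sup>\<star>"
    and star_scale: "x \<in> carr B \<Longrightarrow> (c \<odot> x)\<^sup>\<star> = cnj c \<odot> x\<^sup>\<star>"
    and star_mult: "\<lbrakk>x \<in> carr B; y \<in> carr B\<rbrakk> \<Longrightarrow> (x \<otimes> y)\<^sup>\<star> = y\<^sup>\<star> \<otimes> x\<^sup>\<star>"
    and norm_definite: "\<lbrakk>x \<in> carr B; anorm B x = 0\<rbrakk> \<Longrightarrow> x = \<zero>"
    and norm_triangle: "\<lbrakk>x \<in> carr B; y \<in> carr B\<rbrakk> \<Longrightarrow> anorm B (x \<oplus> y) \<le> anorm B x + anorm B y"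
    and norm_scale: "x \<in> carr B \<Longrightarrow> anorm B (c \<odot> x) = cmod c * anorm B x"
    and norm_mult_le: "\<lbrakk>x \<in> carr B; y \<in> carr B\<rbrakk> \<Longrightarrow> anorm B (x \<otimes> y) \<le> anorm B x * anorm B y"
    and cstar_identity: "x \<in> carr B \<Longrightarrow> anorm B (x\<^sup>\<star> \<otimes> x) = (anorm B x)\<^sup>2"
    and complete: "\<lbrakk>\<And>n::nat. X n \<in> carr B;
        \<And>e. e > 0 \<Longrightarrow> \<exists>N. \<forall>m\<ge>N. \<forall>n\<ge>N. anorm B (X m \<ominus> X n) < e\<rbrakk>
      \<Longrightarrow> \<exists>x\<in>carr B. (\<lambda>n. anorm B (X n \<ominus> x)) \<longlonglongrightarrow> 0"

text \<open>Homomorphisms are *-homomorphisms, made extensional so that uniqueness of a homomorphism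
  is literal uniqueness of a function.\<close>

definition star_hom :: "'a cstar_alg \<Rightarrow> 'b cstar_alg \<Rightarrow> ('a \<Rightarrow> 'b) set" where
  "star_hom A B = {\<phi> \<in> carr A \<rightarrow>\<^sub>E carr B.
    (\<forall>x\<in>carr A. \<forall>y\<in>carr A. \<phi> (x \<oplus>\<^bsub>A\<^esub> y) = \<phi> x \<oplus>\<^bsub>B\<^esub> \<phi> y) \<and>
    (\<forall>c. \<forall>x\<in>carr A. \<phi> (c \<odot>\<^bsub>A\<^esub> x) = c \<odot>\<^bsub>B\<^esub> \<phi> x) \<and>
    (\<forall>x\<in>carr A. \<forall>y\<in>carr A. \<phi> (x \<otimes>\<^bsub>A\<^esub> y) = \<phi> x \<otimes>\<^bsub>B\<^esub> \<phi> y) \<and>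
    (\<forall>x\<in>carr A. \<phi> (x\<^sup>\<star>\<^bsub>A\<^esub>) = (\<phi> x)\<^sup>\<star>\<^bsub>B\<^esub>)}"

definition cstar_subalgebra :: "'a cstar_alg \<Rightarrow> 'a set \<Rightarrow> bool" where
  "cstar_subalgebra B D \<longleftrightarrow> D \<subseteq> carr B \<and> \<zero>\<^bsub>B\<^esub> \<in> D \<and>
    (\<forall>x\<in>D. \<forall>y\<in>D. x \<oplus>\<^bsub>B\<^esub> y \<in> D) \<and>
    (\<forall>c. \<forall>x\<in>D. c \<odot>\<^bsub>B\<^esub> x \<in> D) \<and>
    (\<forall>x\<in>D. \<forall>y\<in>D. x \<otimes>\<^bsub>B\<^esub> y \<in> D) \<and>
    (\<forall>x\<in>D. x\<^sup>\<star>\<^bsub>B\<^esub> \<in> D) \<and>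
    (\<forall>X x. (\<forall>n::nat. X n \<in> D) \<and> x \<in> carr B \<and> (\<lambda>n. anorm B (X n \<ominus>\<^bsub>B\<^esub> x)) \<longlonglongrightarrow> 0 \<longrightarrow> x \<in> D)"

definition cstar_generated :: "'a cstar_alg \<Rightarrow> 'a set \<Rightarrow> 'a cstar_alg" where
  "cstar_generated B S =
    B\<lparr>carr := {x \<in> carr B. \<forall>D. cstar_subalgebra B D \<and> S \<subseteq> D \<longrightarrow> x \<in> D}\<rparr>"


section \<open>Joins of projections in the bidual\<close>

definition projection :: "'a cstar_alg \<Rightarrow> 'a \<Rightarrow> bool" where
  "projection B p \<longleftrightarrow> p \<in> carr B \<and> p \<otimes>\<^bsub>B\<^esub> p = p \<and> p\<^sup>\<star>\<^bsub>B\<^esub> = p"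

definition proj_le :: "'a cstar_alg \<Rightarrow> 'a \<Rightarrow> 'a \<Rightarrow> bool" where
  "proj_le B p q \<longleftrightarrow> p \<otimes>\<^bsub>B\<^esub> q = p"

definition is_proj_join :: "'a cstar_alg \<Rightarrow> 'a set \<Rightarrow> 'a \<Rightarrow> bool" where
  "is_proj_join B P q \<longleftrightarrow> projection B q \<and> (\<forall>p\<in>P. proj_le B p q) \<and>
    (\<forall>e. projection B e \<and> (\<forall>p\<in>P. proj_le B p e) \<longrightarrow> proj_le B q e)"

definition dual :: "'b cstar_alg \<Rightarrow> ('b \<Rightarrow> complex) set" where
  "dual B = {f \<in> extensional (carr B).
    (\<forall>x\<in>carr B. \<forall>y\<in>carr B. f (x \<oplus>\<^bsub>B\<^esub> y) = f x + f y) \<and>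
    (\<forall>c. \<forall>x\<in>carr B. f (c \<odot>\<^bsub>B\<^esub> x) = c * f x) \<and>
    (\<exists>K. \<forall>x\<in>carr B. cmod (f x) \<le> K * anorm B x)}"

definition dual_norm :: "'b cstar_alg \<Rightarrow> ('b \<Rightarrow> complex) \<Rightarrow> real" where
  "dual_norm B f = (SUP x\<in>{x \<in> carr B. anorm B x \<le> 1}. cmod (f x))"

text \<open>The bidual \<open>B\<^sup>*\<^sup>*\<close> with the (first) Arens product
  \<open>(E F)(f) = E (F \<cdot> f)\<close>, where \<open>(F \<cdot> f)(a) = F (f \<cdot> a)\<close> and \<open>(f \<cdot> a)(b) = f (a b)\<close>, and with
  involution \<open>E\<^sup>*(f) = cnj (E (f\<^sup>*))\<close>, where \<open>f\<^sup>*(a) = cnj (f (a\<^sup>*))\<close>. For a C*-algebra this is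
  the usual enveloping von Neumann algebra.\<close>

definition bidual :: "'b cstar_alg \<Rightarrow> (('b \<Rightarrow> complex) \<Rightarrow> complex) cstar_alg" where
  "bidual B = \<lparr>
    carr = {E \<in> extensional (dual B).
      (\<forall>f\<in>dual B. \<forall>g\<in>dual B. E (\<lambda>x\<in>carr B. f x + g x) = E f + E g) \<and>
      (\<forall>c. \<forall>f\<in>dual B. E (\<lambda>x\<in>carr B. c * f x) = c * E f) \<and>
      (\<exists>K. \<forall>f\<in>dual B. cmod (E f) \<le> K * dual_norm B f)},
    azero = (\<lambda>f\<in>dual B. 0),
    aadd = (\<lambda>E F. \<lambda>f\<in>dual B. E f + F f),
    ascale = (\<lambda>c E. \<lambda>f\<in>dual B. c * E f),
    amult = (\<lambda>E F. \<lambda>f\<in>dual B. E (\<lambda>a\<in>carr B. F (\<lambda>b\<in>carr B. f (a \<otimes>\<^bsub>B\<^esub> b)))),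
    astar = (\<lambda>E. \<lambda>f\<in>dual B. cnj (E (\<lambda>a\<in>carr B. cnj (f (a\<^sup>\<star>\<^bsub>B\<^esub>))))),
    anorm = (\<lambda>E. SUP f\<in>{f \<in> dual B. dual_norm B f \<le> 1}. cmod (E f))\<rparr>"

definition to_bidual :: "'b cstar_alg \<Rightarrow> 'b \<Rightarrow> ('b \<Rightarrow> complex) \<Rightarrow> complex" where
  "to_bidual B b = (\<lambda>f\<in>dual B. f b)"


section \<open>Representations and the Toeplitz algebra\<close>

definition range_proj :: "'b cstar_alg \<Rightarrow> ('c \<Rightarrow> 'b) \<Rightarrow> 'c \<Rightarrow> 'b" where
  "range_proj B T \<alpha> = T \<alpha> \<otimes>\<^bsub>B\<^esub> (T \<alpha>)\<^sup>\<star>\<^bsub>B\<^esub>"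

definition cat_representation :: "'c small_cat \<Rightarrow> 'b cstar_alg \<Rightarrow> ('c \<Rightarrow> 'b) \<Rightarrow> bool" where
  "cat_representation \<C> B T \<longleftrightarrow> cstar_algebra B \<and> T \<in> mor \<C> \<rightarrow> carr B \<and>
    (\<forall>\<alpha>\<in>mor \<C>. (T \<alpha>)\<^sup>\<star>\<^bsub>B\<^esub> \<otimes>\<^bsub>B\<^esub> T \<alpha> = T (src \<C> \<alpha>)) \<and>
    (\<forall>\<alpha>\<in>mor \<C>. \<forall>\<beta>\<in>mor \<C>. src \<C> \<alpha> = rng \<C> \<beta> \<longrightarrow> T \<alpha> \<otimes>\<^bsub>B\<^esub> T \<beta> = T (cmp \<C> \<alpha> \<beta>)) \<and>
    (\<forall>\<alpha>\<in>mor \<C>. \<forall>\<beta>\<in>mor \<C>. \<forall>F. is_vee \<C> \<alpha> \<beta> F \<longrightarrow>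
      is_proj_join (bidual B) (to_bidual B ` range_proj B T ` F)
        (to_bidual B (range_proj B T \<alpha> \<otimes>\<^bsub>B\<^esub> range_proj B T \<beta>)))"

text \<open>Universality with respect to the C*-algebras whose carrier lies in a given type.\<close>

definition universal_rep ::
    "'b itself \<Rightarrow> 'c small_cat \<Rightarrow> 'a cstar_alg \<Rightarrow> ('c \<Rightarrow> 'a) \<Rightarrow> bool" where
  "universal_rep (_ :: 'b itself) \<C> A t \<longleftrightarrow> cat_representation \<C> A t \<and>
    (\<forall>(B :: 'b cstar_alg) T. cat_representation \<C> B T \<longrightarrow>
      (\<exists>!\<phi>. \<phi> \<in> star_hom A B \<and> (\<forall>\<alpha>\<in>mor \<C>. \<phi> (t \<alpha>) = T \<alpha>)))"

text \<open>HOL cannot quantify over all types inside a formula, but testing two types is enough. Let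
  \<open>\<kappa> = max (|'c|, \<aleph>\<^sub>0)\<close>. If \<open>T\<close> is a representation in any \<open>B\<close>, then the C*-algebra generated by
  the range of \<open>T\<close> has at most \<open>\<kappa> ^ \<aleph>\<^sub>0 \<le> 2 ^ \<kappa>\<close> elements, so it has an isomorphic copy with
  carrier in the type of maps from \<open>'c \<Rightarrow> complex\<close> to itself; hence \<open>\<phi>\<^sub>T\<close> exists. Taking
  for \<open>B\<close> the algebra \<open>A\<close> itself shows that \<open>A\<close> is generated by \<open>t\<close>, hence \<open>\<phi>\<^sub>T\<close> is unique.\<close>

definition toeplitz_algebra :: "'c small_cat \<Rightarrow> 'a cstar_alg \<Rightarrow> ('c \<Rightarrow> 'a) \<Rightarrow> bool" where
  "toeplitz_algebra \<C> A t \<longleftrightarrow>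
    universal_rep TYPE('a) \<C> A t \<and>
    universal_rep TYPE(('c \<Rightarrow> complex) \<Rightarrow> ('c \<Rightarrow> complex)) \<C> A t"

definition canonical_hom ::
    "'c small_cat \<Rightarrow> 'a cstar_alg \<Rightarrow> ('c \<Rightarrow> 'a) \<Rightarrow> 'b cstar_alg \<Rightarrow> ('c \<Rightarrow> 'b) \<Rightarrow> 'a \<Rightarrow> 'b" where
  "canonical_hom \<C> A t B T =
    (THE \<phi>. \<phi> \<in> star_hom A B \<and> (\<forall>\<alpha>\<in>mor \<C>. \<phi> (t \<alpha>) = T \<alpha>))"


section \<open>Bounded operators on \<open>\<ell>\<^sup>2\<close> and the regular Toeplitz algebra\<close>

definition ell2 :: "'c set \<Rightarrow> ('c \<Rightarrow> complex) set" where
  "ell2 X = {f. (\<forall>x. x \<notin> X \<longrightarrow> f x = 0) \<and> (\<lambda>x. (cmod (f x))\<^sup>2) summable_on X}"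

definition ell2_inner :: "'c set \<Rightarrow> ('c \<Rightarrow> complex) \<Rightarrow> ('c \<Rightarrow> complex) \<Rightarrow> complex" where
  "ell2_inner X f g = (\<Sum>\<^sub>\<infinity>x\<in>X. f x * cnj (g x))"

definition ell2_norm :: "'c set \<Rightarrow> ('c \<Rightarrow> complex) \<Rightarrow> real" where
  "ell2_norm X f = sqrt (\<Sum>\<^sub>\<infinity>x\<in>X. (cmod (f x))\<^sup>2)"

definition delta :: "'c \<Rightarrow> 'c \<Rightarrow> complex" where
  "delta \<gamma> = (\<lambda>x. if x = \<gamma> then 1 else 0)"

definition bounded_ops :: "'c set \<Rightarrow> (('c \<Rightarrow> complex) \<Rightarrow> ('c \<Rightarrow> complex)) set" where
  "bounded_ops X = {S \<in> ell2 X \<rightarrow>\<^sub>E ell2 X.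
    (\<forall>f\<in>ell2 X. \<forall>g\<in>ell2 X. S (\<lambda>x. f x + g x) = (\<lambda>x. S f x + S g x)) \<and>
    (\<forall>c. \<forall>f\<in>ell2 X. S (\<lambda>x. c * f x) = (\<lambda>x. c * S f x)) \<and>
    (\<exists>K. \<forall>f\<in>ell2 X. ell2_norm X (S f) \<le> K * ell2_norm X f)}"

definition op_adjoint ::
    "'c set \<Rightarrow> (('c \<Rightarrow> complex) \<Rightarrow> ('c \<Rightarrow> complex)) \<Rightarrow> ('c \<Rightarrow> complex) \<Rightarrow> ('c \<Rightarrow> complex)" where
  "op_adjoint X S = (THE R. R \<in> bounded_ops X \<and>
    (\<forall>f\<in>ell2 X. \<forall>g\<in>ell2 X. ell2_inner X (S f) g = ell2_inner X f (R g)))"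

definition bounded_op_algebra ::
    "'c set \<Rightarrow> (('c \<Rightarrow> complex) \<Rightarrow> ('c \<Rightarrow> complex)) cstar_alg" where
  "bounded_op_algebra X = \<lparr>
    carr = bounded_ops X,
    azero = (\<lambda>f\<in>ell2 X. (\<lambda>x. 0)),
    aadd = (\<lambda>S R. \<lambda>f\<in>ell2 X. (\<lambda>x. S f x + R f x)),
    ascale = (\<lambda>c S. \<lambda>f\<in>ell2 X. (\<lambda>x. c * S f x)),
    amult = (\<lambda>S R. compose (ell2 X) S R),
    astar = op_adjoint X,
    anorm = (\<lambda>S. SUP f\<in>{f \<in> ell2 X. ell2_norm X f \<le> 1}. ell2_norm X (S f))\<rparr>"

text \<open>For left cancellative \<open>\<C>\<close> there is exactly one such bounded operator.\<close>

definition regular_op :: "'c small_cat \<Rightarrow> 'c \<Rightarrow> ('c \<Rightarrow> complex) \<Rightarrow> ('c \<Rightarrow> complex)" where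
  "regular_op \<C> \<alpha> = (THE S. S \<in> bounded_ops (mor \<C>) \<and>
    (\<forall>\<gamma>\<in>mor \<C>. S (delta \<gamma>) =
      (if \<gamma> \<in> right_ideal \<C> (src \<C> \<alpha>) then delta (cmp \<C> \<alpha> \<gamma>) else (\<lambda>x. 0))))"

definition regular_toeplitz ::
    "'c small_cat \<Rightarrow> (('c \<Rightarrow> complex) \<Rightarrow> ('c \<Rightarrow> complex)) cstar_alg" where
  "regular_toeplitz \<C> = cstar_generated (bounded_op_algebra (mor \<C>)) (regular_op \<C> ` mor \<C>)"

end

theory Submission imports Defs begin

text \<open>The operator \<open>V\<^sub>\<alpha>\<close> is the partial isometry that the injection \<open>\<beta> \<mapsto> \<alpha>\<beta>\<close> of \<open>s(\<alpha>)\<C>\<close> onto \<open>\<alpha>\<C>\<close> induces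
on \<open>\<ell>\<^sup>2(\<C>)\<close>; left cancellation is what makes this map injective, hence the operator bounded. Its
initial projection is multiplication by the indicator of \<open>s(\<alpha>)\<C>\<close> and its range projection is
multiplication by the indicator of \<open>\<alpha>\<C>\<close>. So the first two relations can be read off on basis
vectors, and the product of two range projections is the diagonal projection of
\<open>\<alpha>\<C> \<inter> \<beta>\<C> = \<Union>\<gamma>\<in>\<alpha>\<or>\<beta>. \<gamma>\<C>\<close>. Iterating \<open>p \<or> q = p + (q - q p)\<close> expresses this projection
through the \<open>V\<^sub>\<gamma> V\<^sub>\<gamma>\<^sup>*\<close>, and shows that it lies in the left ideal of the regular Toeplitz algebra that they
generate. An element of the bidual that absorbs the \<open>V\<^sub>\<gamma> V\<^sub>\<gamma>\<^sup>*\<close> on the right absorbs that whole left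
ideal, which is why the projection is the join in the bidual as well (\<open>bidual_join\<close>,
\<open>diag_union_in_left_ideal\<close>).

Universality gives the homomorphism \<open>\<phi>\<close>, and its image contains all the generators. It is
therefore onto as soon as its image is norm closed, and images of *-homomorphisms of C*-algebras
always are (\<open>image_cstar_subalgebra\<close>). The usual proof truncates with the continuous functional
calculus; here bounded trigonometric functions of self-adjoint elements do the work. In a
C*-algebra without unit, an element \<open>v\<close> such that \<open>1 + v\<close> acts isometrically has norm at most 2.
For a small self-adjoint \<open>h\<close> a fixed point argument gives \<open>r\<close>, the element \<open>1 - cos \<theta>\<close> where
\<open>h = sin \<theta>\<close>, and \<open>1 - r + \<i>h\<close> is then unitary. The equations saying so are
algebraic, so they pass through \<open>\<phi>\<close> although continuity of \<open>\<phi>\<close> is not yet known; they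
yield \<open>\<parallel>\<phi> h\<parallel> \<le> 2\<close>, that is, boundedness of \<open>\<phi>\<close> (\<open>norm_hom_le\<close>). Conversely let \<open>a\<close> be
self-adjoint, of arbitrary norm but with \<open>\<phi> a\<close> small. Take \<open>h = a / 2\<^sup>k\<close> and square the resulting
unitary \<open>k\<close> times. The outcome is \<open>1 + v\<close> with \<open>\<parallel>v\<parallel> \<le> 2\<close>, whereas \<open>\<phi> v\<close> is \<open>\<i> \<phi> a\<close> up to
an error quadratic in \<open>\<phi> a\<close> (\<open>self_adjoint_approx_lift\<close>). So every element of the
image has approximate preimages of controlled norm, and the iteration known from the open mapping
theorem shows that the image is closed.

For all this, the bounded operators on \<open>\<ell>\<^sup>2\<close> have to form a C*-algebra
(\<open>cstar_algebra_bounded_ops\<close>). Adjoints come from the explicit formula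
\<open>(S\<^sup>* g)(x) = \<langle>g, S \<delta>\<^sub>x\<rangle>\<close> instead of a Riesz representation theorem.\<close>

section \<open>Norm limits in a C*-algebra\<close>

context cstar_algebra begin

lemmas alg_closed [simp, intro] = zero_closed add_closed scale_closed mult_closed star_closed

lemma diff_closed [simp, intro]: "\<lbrakk>x \<in> carr B; y \<in> carr B\<rbrakk> \<Longrightarrow> x \<ominus> y \<in> carr B"
  by (simp add: adiff_def)

lemma zero_add [simp]: "x \<in> carr B \<Longrightarrow> \<zero> \<oplus> x = x"
  using add_commute add_zero by fastforce

lemma add_left_commute: "\<lbrakk>x \<in> carr B; y \<in> carr B; z \<in> carr B\<rbrakk> \<Longrightarrow> x \<oplus> (y \<oplus> z) = y \<oplus> (x \<oplus> z)"
  by (metis add_assoc add_commute)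

lemma neg_add_cancel: "\<lbrakk>x \<in> carr B; z \<in> carr B\<rbrakk> \<Longrightarrow> x \<oplus> ((-1) \<odot> x \<oplus> z) = z"
  by (metis add_assoc add_neg scale_closed zero_add)

lemma add_left_cancel: "\<lbrakk>x \<in> carr B; y \<in> carr B; z \<in> carr B\<rbrakk> \<Longrightarrow> x \<oplus> y = x \<oplus> z \<longleftrightarrow> y = z"
  by (metis add_assoc add_commute add_neg scale_closed zero_add)

lemma scale_zero_left [simp]: assumes "x \<in> carr B" shows "0 \<odot> x = \<zero>"
proof -
  have "x \<oplus> 0 \<odot> x = x \<oplus> \<zero>"
    using assms scale_add_left[of x 1 0] by (simp add: scale_one add_zero)
  then show ?thesis using assms by (simp add: add_left_cancel)
qed

lemma scale_zero_right [simp]: "c \<odot> \<zero> = \<zero>"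
  by (metis mult_zero_right scale_scale scale_zero_left zero_closed)

lemma diff_self [simp]: "x \<in> carr B \<Longrightarrow> x \<ominus> x = \<zero>"
  by (simp add: adiff_def add_neg)

lemma diff_add [simp]: "\<lbrakk>x \<in> carr B; y \<in> carr B\<rbrakk> \<Longrightarrow> x \<ominus> y \<oplus> y = x"
  by (metis (full_types) add_assoc add_commute add_neg adiff_def scale_closed zero_add)

lemma diff_eq_zero_iff: "\<lbrakk>x \<in> carr B; y \<in> carr B\<rbrakk> \<Longrightarrow> x \<ominus> y = \<zero> \<longleftrightarrow> x = y"
  by (metis diff_add diff_self zero_add)

lemma diff_diff_add: "\<lbrakk>x \<in> carr B; y \<in> carr B; z \<in> carr B\<rbrakk> \<Longrightarrow> (x \<ominus> y) \<oplus> (y \<ominus> z) = x \<ominus> z"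
  by (simp add: adiff_def add_assoc neg_add_cancel add_left_commute)

lemma add_diff_add: "\<lbrakk>x \<in> carr B; y \<in> carr B; x' \<in> carr B; y' \<in> carr B\<rbrakk>
    \<Longrightarrow> (x \<oplus> y) \<ominus> (x' \<oplus> y') = (x \<ominus> x') \<oplus> (y \<ominus> y')"
  by (simp add: adiff_def add_assoc scale_add_right add_left_commute)

lemma scale_diff: "\<lbrakk>x \<in> carr B; y \<in> carr B\<rbrakk> \<Longrightarrow> c \<odot> x \<ominus> c \<odot> y = c \<odot> (x \<ominus> y)"
  by (simp add: adiff_def scale_add_right scale_scale)

lemma star_diff: "\<lbrakk>x \<in> carr B; y \<in> carr B\<rbrakk> \<Longrightarrow> x\<^sup>\<star> \<ominus> y\<^sup>\<star> = (x \<ominus> y)\<^sup>\<star>"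
  by (simp add: adiff_def star_add star_scale)

lemma mult_diff_right: "\<lbrakk>x \<in> carr B; y \<in> carr B; z \<in> carr B\<rbrakk> \<Longrightarrow> x \<otimes> (y \<ominus> z) = x \<otimes> y \<ominus> x \<otimes> z"
  by (simp add: adiff_def mult_add_right mult_scale_right)

lemma mult_diff_left: "\<lbrakk>x \<in> carr B; y \<in> carr B; z \<in> carr B\<rbrakk> \<Longrightarrow> (x \<ominus> y) \<otimes> z = x \<otimes> z \<ominus> y \<otimes> z"
  by (simp add: adiff_def mult_add_left mult_scale_left)

lemma mult_diff_mult: "\<lbrakk>x \<in> carr B; y \<in> carr B; x' \<in> carr B; y' \<in> carr B\<rbrakk>
    \<Longrightarrow> x \<otimes> y \<ominus> x' \<otimes> y' = x \<otimes> (y \<ominus> y') \<oplus> (x \<ominus> x') \<otimes> y'"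
  by (simp add: mult_diff_right mult_diff_left diff_diff_add)

lemma norm_zero [simp]: "anorm B \<zero> = 0"
  using norm_scale[OF zero_closed, of 0] by simp

lemma norm_neg: "x \<in> carr B \<Longrightarrow> anorm B ((-1) \<odot> x) = anorm B x"
  by (simp add: norm_scale)

lemma norm_nonneg [simp]: assumes "x \<in> carr B" shows "0 \<le> anorm B x"
  using norm_triangle[of x "(-1) \<odot> x"] assms by (simp add: add_neg norm_neg)

lemma norm_diff_le: "\<lbrakk>x \<in> carr B; y \<in> carr B\<rbrakk> \<Longrightarrow> anorm B (x \<ominus> y) \<le> anorm B x + anorm B y"
  using norm_triangle[of x "(-1) \<odot> y"] by (simp add: adiff_def norm_neg)

lemma norm_diff_commute: assumes "x \<in> carr B" "y \<in> carr B" shows "anorm B (x \<ominus> y) = anorm B (y \<ominus> x)"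
proof -
  have "x \<ominus> y = (-1) \<odot> (y \<ominus> x)"
    using assms by (simp add: adiff_def scale_add_right scale_scale scale_one add_commute)
  then show ?thesis using assms by (simp add: norm_neg)
qed

lemma norm_diff_triangle: "\<lbrakk>x \<in> carr B; y \<in> carr B; z \<in> carr B\<rbrakk>
    \<Longrightarrow> anorm B (x \<ominus> z) \<le> anorm B (x \<ominus> y) + anorm B (y \<ominus> z)"
  using norm_triangle[of "x \<ominus> y" "y \<ominus> z"] by (simp add: diff_diff_add)

lemma norm_le_norm_diff_add: "\<lbrakk>x \<in> carr B; y \<in> carr B\<rbrakk> \<Longrightarrow> anorm B x \<le> anorm B (x \<ominus> y) + anorm B y"
  using norm_triangle[of "x \<ominus> y" y] by simp

lemma norm_star: assumes "x \<in> carr B" shows "anorm B (x\<^sup>\<star>) = anorm B x"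
proof -
  have le: "anorm B z \<le> anorm B (z\<^sup>\<star>)" if "z \<in> carr B" for z
  proof (cases "anorm B z = 0")
    case False
    have "anorm B z * anorm B z \<le> anorm B (z\<^sup>\<star>) * anorm B z"
      using that cstar_identity[OF that] norm_mult_le[of "z\<^sup>\<star>" z] by (simp add: power2_eq_square)
    with False that show ?thesis by (simp add: less_le)
  qed (use that in simp)
  from le[of x] le[of "x\<^sup>\<star>"] assms show ?thesis by (simp add: star_star)
qed

lemma norm_sq_mult_star: "x \<in> carr B \<Longrightarrow> anorm B (x \<otimes> x\<^sup>\<star>) = (anorm B x)\<^sup>2"
  using cstar_identity[of "x\<^sup>\<star>"] by (simp add: star_star norm_star)

text \<open>The calculus of limits below lets the algebraic relations of a
  sequence of iterates pass to its limit.\<close>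
definition norm_conv :: "(nat \<Rightarrow> 'a) \<Rightarrow> 'a \<Rightarrow> bool" where
  "norm_conv X x \<longleftrightarrow> (\<forall>n. X n \<in> carr B) \<and> x \<in> carr B \<and> (\<lambda>n. anorm B (X n \<ominus> x)) \<longlonglongrightarrow> 0"

lemma norm_convD: "norm_conv X x \<Longrightarrow> X n \<in> carr B" "norm_conv X x \<Longrightarrow> x \<in> carr B"
  by (auto simp: norm_conv_def)

lemma norm_conv_cong_le:
  assumes "\<And>n. X n \<in> carr B" "x \<in> carr B" "\<And>n. anorm B (X n \<ominus> x) \<le> f n" "f \<longlonglongrightarrow> 0"
  shows "norm_conv X x"
  unfolding norm_conv_def using assms tendsto_sandwich[of "\<lambda>_. 0" "\<lambda>n. anorm B (X n \<ominus> x)" sequentially f 0]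
  by auto

lemma norm_conv_const: "x \<in> carr B \<Longrightarrow> norm_conv (\<lambda>_. x) x"
  by (simp add: norm_conv_def)

lemma norm_conv_Suc: "norm_conv X x \<Longrightarrow> norm_conv (\<lambda>n. X (Suc n)) x"
  unfolding norm_conv_def using LIMSEQ_Suc by fastforce

lemma norm_conv_unique: assumes "norm_conv X x" "norm_conv X y" shows "x = y"
proof -
  have c: "x \<in> carr B" "y \<in> carr B" "\<And>n. X n \<in> carr B" using assms by (auto simp: norm_conv_def)
  have "(\<lambda>n. anorm B (X n \<ominus> x) + anorm B (X n \<ominus> y)) \<longlonglongrightarrow> 0 + 0"
    using assms by (intro tendsto_add) (auto simp: norm_conv_def)
  moreover have "anorm B (x \<ominus> y) \<le> anorm B (X n \<ominus> x) + anorm B (X n \<ominus> y)" for n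
    using norm_diff_triangle[of x "X n" y] c by (simp add: norm_diff_commute)
  ultimately have "anorm B (x \<ominus> y) \<le> 0"
    by (metis (no_types, lifting) LIMSEQ_le_const add.right_neutral)
  then have "anorm B (x \<ominus> y) = 0" using c by (intro order_antisym) auto
  then show ?thesis
    using c norm_definite[of "x \<ominus> y"] by (simp add: diff_eq_zero_iff)
qed

lemma norm_conv_add: assumes "norm_conv X x" "norm_conv Y y" shows "norm_conv (\<lambda>n. X n \<oplus> Y n) (x \<oplus> y)"
proof (rule norm_conv_cong_le)
  note c = norm_convD[OF assms(1)] norm_convD[OF assms(2)]
  show "X n \<oplus> Y n \<in> carr B" "x \<oplus> y \<in> carr B" for n using c by auto
  show "anorm B (X n \<oplus> Y n \<ominus> (x \<oplus> y)) \<le> anorm B (X n \<ominus> x) + anorm B (Y n \<ominus> y)" for n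
    using c by (simp add: add_diff_add norm_triangle)
  show "(\<lambda>n. anorm B (X n \<ominus> x) + anorm B (Y n \<ominus> y)) \<longlonglongrightarrow> 0"
    using tendsto_add_zero assms by (auto simp: norm_conv_def)
qed

lemma norm_conv_scale: assumes "norm_conv X x" shows "norm_conv (\<lambda>n. c \<odot> X n) (c \<odot> x)"
  using assms tendsto_mult_right_zero
  by (auto simp: norm_conv_def scale_diff norm_scale)

lemma norm_conv_star: assumes "norm_conv X x" shows "norm_conv (\<lambda>n. (X n)\<^sup>\<star>) (x\<^sup>\<star>)"
  using assms by (auto simp: norm_conv_def star_diff norm_star)

lemma norm_conv_norm: assumes "norm_conv X x" shows "(\<lambda>n. anorm B (X n)) \<longlonglongrightarrow> anorm B x"
proof -
  have x: "x \<in> carr B" and X: "X n \<in> carr B" for n using assms by (auto simp: norm_conv_def)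
  have "norm (anorm B (X n) - anorm B x) \<le> anorm B (X n \<ominus> x)" for n
  proof -
    have "anorm B x \<le> anorm B (X n \<ominus> x) + anorm B (X n)"
      using norm_le_norm_diff_add[OF x X, of n] unfolding norm_diff_commute[OF x X] .
    with norm_le_norm_diff_add[OF X x, of n] show ?thesis
      unfolding real_norm_def by linarith
  qed
  then have "\<forall>\<^sub>F n in sequentially. norm (anorm B (X n) - anorm B x) \<le> anorm B (X n \<ominus> x)"
    by (rule always_eventually[OF allI])
  then have "(\<lambda>n. anorm B (X n) - anorm B x) \<longlonglongrightarrow> 0"
    by (rule Lim_null_comparison) (use assms in \<open>simp add: norm_conv_def\<close>)
  then show ?thesis by (simp add: LIM_zero_cancel)
qed

lemma norm_conv_mult: assumes "norm_conv X x" "norm_conv Y y" shows "norm_conv (\<lambda>n. X n \<otimes> Y n) (x \<otimes> y)"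
proof (rule norm_conv_cong_le)
  note c = norm_convD[OF assms(1)] norm_convD[OF assms(2)]
  show "X n \<otimes> Y n \<in> carr B" "x \<otimes> y \<in> carr B" for n using c by auto
  show "anorm B (X n \<otimes> Y n \<ominus> x \<otimes> y)
      \<le> anorm B (X n) * anorm B (Y n \<ominus> y) + anorm B (X n \<ominus> x) * anorm B y" for n
    using c by (auto simp: mult_diff_mult intro!: order_trans[OF norm_triangle] add_mono norm_mult_le)
  have "(\<lambda>n. anorm B (X n) * anorm B (Y n \<ominus> y) + anorm B (X n \<ominus> x) * anorm B y)
      \<longlonglongrightarrow> anorm B x * 0 + 0 * anorm B y"
    using assms by (intro tendsto_intros norm_conv_norm) (auto simp: norm_conv_def)
  then show "(\<lambda>n. anorm B (X n) * anorm B (Y n \<ominus> y) + anorm B (X n \<ominus> x) * anorm B y) \<longlonglongrightarrow> 0"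
    by simp
qed

lemma geometric_norm_conv:
  assumes X: "\<And>n. X n \<in> carr B" and step: "\<And>n. anorm B (X (Suc n) \<ominus> X n) \<le> C * q ^ n"
    and q: "0 \<le> q" "q < 1"
  shows "\<exists>x. norm_conv X x"
proof -
  have C: "0 \<le> C"
    using order_trans[OF norm_nonneg step[of 0]] X by auto
  have tail: "anorm B (X (n + k) \<ominus> X n) \<le> C / (1 - q) * q ^ n" for n k
  proof -
    have "anorm B (X (n + k) \<ominus> X n) \<le> C * q ^ n * (\<Sum>i<k. q ^ i)"
    proof (induction k)
      case (Suc k)
      have "anorm B (X (n + Suc k) \<ominus> X n) \<le> C * q ^ (n + k) + C * q ^ n * (\<Sum>i<k. q ^ i)"
        using norm_diff_triangle[of "X (n + Suc k)" "X (n + k)" "X n", OF X X X] step[of "n + k"] Suc by simp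
      then show ?case by (simp add: algebra_simps power_add)
    qed (use X in simp)
    also have "\<dots> \<le> C * q ^ n * (1 / (1 - q))"
      using q C by (intro mult_left_mono) (auto simp: sum_gp_strict divide_right_mono)
    finally show ?thesis using C q by (simp add: mult_left_mono mult.commute)
  qed
  have "(\<lambda>n. C / (1 - q) * q ^ n) \<longlonglongrightarrow> C / (1 - q) * 0"
    using q by (intro tendsto_intros LIMSEQ_power_zero) auto
  then have lim: "(\<lambda>n. C / (1 - q) * q ^ n) \<longlonglongrightarrow> 0" by simp
  have "\<exists>N. \<forall>m\<ge>N. \<forall>n\<ge>N. anorm B (X m \<ominus> X n) < e" if "e > 0" for e
  proof -
    have "eventually (\<lambda>n. C / (1 - q) * q ^ n < e / 2) sequentially"
      using order_tendstoD(2)[OF lim, of "e/2"] that by simp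
    then obtain N where N: "C / (1 - q) * q ^ N < e / 2"
      by (auto simp: eventually_sequentially)
    have tail': "anorm B (X m \<ominus> X N) < e / 2" if "m \<ge> N" for m
      using order_le_less_trans[OF tail[of N "m - N"] N] that by simp
    have "anorm B (X m \<ominus> X n) < e" if "m \<ge> N" "n \<ge> N" for m n
      using norm_diff_triangle[of "X m" "X N" "X n", OF X X X] tail'[of m] tail'[of n] that
        norm_diff_commute[OF X X, of N n] by auto
    then show ?thesis by blast
  qed
  then obtain x where "x \<in> carr B" "(\<lambda>n. anorm B (X n \<ominus> x)) \<longlonglongrightarrow> 0"
    using complete[of X] X by blast
  then show ?thesis using X by (auto simp: norm_conv_def)
qed

section \<open>Isometries in a C*-algebra without unit\<close>

text \<open>The unit is avoided by letting the formal element \<open>1 + v\<close> act on the algebra by left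
  multiplication.\<close>
definition isometric :: "'a \<Rightarrow> bool" where
  "isometric v \<longleftrightarrow> v \<in> carr B \<and> (\<forall>x\<in>carr B. anorm B (x \<oplus> v \<otimes> x) = anorm B x)"

text \<open>Evaluating \<open>1 + v\<close> at \<open>v\<^sup>*\<close> gives \<open>\<parallel>v v\<^sup>*\<parallel> \<le> 2 \<parallel>v\<parallel>\<close>, and \<open>\<parallel>v v\<^sup>*\<parallel> = \<parallel>v\<parallel>\<^sup>2\<close>.\<close>
lemma isometric_norm_le: assumes "isometric v" shows "anorm B v \<le> 2"
proof -
  have v: "v \<in> carr B" and iso: "anorm B (v\<^sup>\<star> \<oplus> v \<otimes> v\<^sup>\<star>) = anorm B v"
    using assms by (auto simp: isometric_def norm_star)
  have "(v\<^sup>\<star> \<oplus> v \<otimes> v\<^sup>\<star>) \<ominus> v\<^sup>\<star> = v \<otimes> v\<^sup>\<star>"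
    using v by (simp add: adiff_def add_assoc add_left_commute add_commute[of "v \<otimes> v\<^sup>\<star>"] neg_add_cancel)
  then have "(anorm B v)\<^sup>2 \<le> 2 * anorm B v"
    using norm_diff_le[of "v\<^sup>\<star> \<oplus> v \<otimes> v\<^sup>\<star>" "v\<^sup>\<star>"] v iso by (simp add: norm_sq_mult_star norm_star)
  then show ?thesis
    using norm_nonneg[OF v] by (cases "anorm B v = 0") (auto simp: power2_eq_square)
qed

text \<open>\<open>(1 + v)\<^sup>2 = 1 + (2v + v\<^sup>2)\<close>, and a composition of isometries is an isometry.\<close>
lemma isometric_double: assumes "isometric v" shows "isometric (2 \<odot> v \<oplus> v \<otimes> v)"
proof -
  have v: "v \<in> carr B" using assms by (simp add: isometric_def)
  have two: "2 \<odot> z = z \<oplus> z" if "z \<in> carr B" for z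
    using scale_add_left[of z 1 1] that by (simp add: scale_one)
  have "anorm B (x \<oplus> (2 \<odot> v \<oplus> v \<otimes> v) \<otimes> x) = anorm B x" if x: "x \<in> carr B" for x
  proof -
    have "x \<oplus> (2 \<odot> v \<oplus> v \<otimes> v) \<otimes> x = (x \<oplus> v \<otimes> x) \<oplus> v \<otimes> (x \<oplus> v \<otimes> x)"
      using v x by (simp add: two mult_add_left mult_add_right mult_assoc add_assoc)
    then show ?thesis using assms v x by (simp add: isometric_def)
  qed
  then show ?thesis using v by (simp add: isometric_def)
qed

text \<open>The hypothesis is \<open>(1 + v)\<^sup>*(1 + v) = 1\<close>, expanded so that no unit occurs.\<close>
lemma isometricI: assumes v: "v \<in> carr B" and uni: "v\<^sup>\<star> \<oplus> (v \<oplus> v\<^sup>\<star> \<otimes> v) = \<zero>" shows "isometric v"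
proof -
  have mz: "z \<otimes> \<zero> = \<zero>" "\<zero> \<otimes> z = \<zero>" if "z \<in> carr B" for z
    using that mult_scale_right[of z \<zero> 0] mult_scale_left[of \<zero> z 0] by simp_all
  have "anorm B (x \<oplus> v \<otimes> x) = anorm B x" if x: "x \<in> carr B" for x
  proof -
    have "(x \<oplus> v \<otimes> x)\<^sup>\<star> \<otimes> (x \<oplus> v \<otimes> x) = x\<^sup>\<star> \<otimes> x \<oplus> x\<^sup>\<star> \<otimes> ((v\<^sup>\<star> \<oplus> (v \<oplus> v\<^sup>\<star> \<otimes> v)) \<otimes> x)"
      using v x by (simp add: star_add star_mult mult_add_left mult_add_right mult_assoc add_assoc add_left_commute)
    also have "\<dots> = x\<^sup>\<star> \<otimes> x" using x by (simp add: uni mz add_zero)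
    finally have "(anorm B (x \<oplus> v \<otimes> x))\<^sup>2 = (anorm B x)\<^sup>2"
      using cstar_identity[of "x \<oplus> v \<otimes> x"] cstar_identity[of x] v x by simp
    then show ?thesis using v x by simp
  qed
  then show ?thesis using v by (simp add: isometric_def)
qed

text \<open>The equation for \<open>r\<close> says \<open>(1 - r)\<^sup>2 + h\<^sup>2 = 1\<close>. With \<open>h\<close> as the sine of an angle and \<open>1 - r\<close> as its
  cosine, \<open>1 + (\<i>h - r)\<close> is the exponential of \<open>\<i>\<close> times that angle, hence unitary. All hypotheses are
  algebraic and therefore stable under homomorphisms.\<close>
lemma isometric_cos_sin:
  assumes c: "r \<in> carr B" "h \<in> carr B" and sa: "r\<^sup>\<star> = r" "h\<^sup>\<star> = h" and comm: "r \<otimes> h = h \<otimes> r"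
    and eq: "r = (1/2) \<odot> (h \<otimes> h \<oplus> r \<otimes> r)"
  shows "isometric (\<i> \<odot> h \<ominus> r)"
proof (rule isometricI)
  let ?v = "\<i> \<odot> h \<ominus> r"
  show "?v \<in> carr B" using c by auto
  have two: "2 \<odot> r = h \<otimes> h \<oplus> r \<otimes> r"
    using arg_cong[OF eq, of "\<lambda>z. 2 \<odot> z"] c by (simp add: scale_scale scale_one)
  have vs: "?v\<^sup>\<star> = (-\<i>) \<odot> h \<ominus> r"
    using c by (simp add: adiff_def star_add star_scale sa)
  have prod: "?v\<^sup>\<star> \<otimes> ?v = h \<otimes> h \<oplus> r \<otimes> r"
  proof -
    have "?v\<^sup>\<star> \<otimes> ?v = (h \<otimes> h \<oplus> \<i> \<odot> (h \<otimes> r)) \<oplus> ((-\<i>) \<odot> (h \<otimes> r) \<oplus> r \<otimes> r)"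
      unfolding vs using c by (simp add: adiff_def mult_add_left mult_add_right mult_scale_left mult_scale_right
          scale_scale scale_add_right comm scale_one add_assoc add_left_commute)
    also have "\<dots> = h \<otimes> h \<oplus> ((\<i> \<odot> (h \<otimes> r) \<oplus> (-\<i>) \<odot> (h \<otimes> r)) \<oplus> r \<otimes> r)"
      using c by (simp add: add_assoc)
    also have "\<i> \<odot> (h \<otimes> r) \<oplus> (-\<i>) \<odot> (h \<otimes> r) = \<zero>"
      using c scale_add_left[of "h \<otimes> r" \<i> "-\<i>"] by simp
    finally show ?thesis using c by simp
  qed
  have sum: "?v\<^sup>\<star> \<oplus> ?v = (-2) \<odot> r"
  proof -
    have "?v\<^sup>\<star> \<oplus> ?v = ((-\<i>) \<odot> h \<oplus> \<i> \<odot> h) \<oplus> ((-1) \<odot> r \<oplus> (-1) \<odot> r)"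
      unfolding vs using c by (simp add: adiff_def add_assoc add_left_commute)
    then show ?thesis
      using c scale_add_left[of h "-\<i>" \<i>, symmetric] scale_add_left[of r "-1" "-1", symmetric] by simp
  qed
  have "?v\<^sup>\<star> \<oplus> (?v \<oplus> ?v\<^sup>\<star> \<otimes> ?v) = (?v\<^sup>\<star> \<oplus> ?v) \<oplus> ?v\<^sup>\<star> \<otimes> ?v"
    using c by (simp add: add_assoc)
  also have "\<dots> = (-2) \<odot> r \<oplus> 2 \<odot> r"
    by (simp only: prod sum two)
  also have "\<dots> = \<zero>" using c scale_add_left[of r "-2" 2] by simp
  finally show "?v\<^sup>\<star> \<oplus> (?v \<oplus> ?v\<^sup>\<star> \<otimes> ?v) = \<zero>" .
qed

text \<open>For \<open>\<parallel>h\<parallel> \<le> 1/2\<close> the map \<open>x \<mapsto> (h\<^sup>2 + x\<^sup>2) / 2\<close> preserves the ball of radius \<open>1/4\<close> and contracts it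
  by the factor \<open>1/4\<close>. Its fixed point replaces the power series of \<open>1 - sqrt (1 - h\<^sup>2)\<close>; since the
  iteration starts at zero, all iterates are self-adjoint and commute with \<open>h\<close>.\<close>
lemma versine_exists:
  assumes h: "h \<in> carr B" "h\<^sup>\<star> = h" "anorm B h \<le> 1/2"
  obtains r where "r \<in> carr B" "r\<^sup>\<star> = r" "r \<otimes> h = h \<otimes> r" "r = (1/2) \<odot> (h \<otimes> h \<oplus> r \<otimes> r)"
    "anorm B r \<le> 1/4"
proof -
  define X where "X = rec_nat \<zero> (\<lambda>_ x. (1/2) \<odot> (h \<otimes> h \<oplus> x \<otimes> x))"
  have X0: "X 0 = \<zero>" and XS: "X (Suc n) = (1/2) \<odot> (h \<otimes> h \<oplus> X n \<otimes> X n)" for n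
    by (simp_all add: X_def)
  have Xc [simp]: "X n \<in> carr B" for n by (induction n) (use h in \<open>auto simp: X0 XS\<close>)
  have hh: "anorm B (h \<otimes> h) \<le> 1/4"
    using cstar_identity[of h] h power_mono[of "anorm B h" "1/2" 2] by (simp add: power_divide)
  have Xn: "anorm B (X n) \<le> 1/4" for n
  proof (induction n)
    case (Suc n)
    have "anorm B (X n \<otimes> X n) \<le> 1/4 * (1/4)"
      using Suc norm_mult_le[of "X n" "X n"] mult_mono[of "anorm B (X n)" "1/4" "anorm B (X n)" "1/4"]
      by auto
    then show ?case
      using norm_triangle[of "h \<otimes> h" "X n \<otimes> X n"] hh h by (simp add: XS norm_scale)
  qed (simp add: X0)
  have step: "anorm B (X (Suc n) \<ominus> X n) \<le> 1 * (1/4) ^ n" for n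
  proof (induction n)
    case 0
    show ?case using Xn[of 1] norm_diff_le[of "X (Suc 0)" "X 0"] by (simp add: X0)
  next
    case (Suc n)
    let ?d = "X (Suc n) \<ominus> X n"
    have "X (Suc (Suc n)) \<ominus> X (Suc n) = (1/2) \<odot> (X (Suc n) \<otimes> ?d \<oplus> ?d \<otimes> X n)"
      unfolding XS[of "Suc n"] XS[of n, THEN arg_cong, of "\<lambda>z. _ \<ominus> z"]
      using h by (simp add: scale_diff add_diff_add mult_diff_mult)
    then have "anorm B (X (Suc (Suc n)) \<ominus> X (Suc n))
        \<le> 1/2 * (anorm B (X (Suc n)) * anorm B ?d + anorm B ?d * anorm B (X n))"
      using norm_triangle[of "X (Suc n) \<otimes> ?d" "?d \<otimes> X n"] norm_mult_le[of "X (Suc n)" ?d]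
        norm_mult_le[of ?d "X n"] by (simp add: norm_scale)
    also have "\<dots> \<le> 1/2 * (1/4 * anorm B ?d + anorm B ?d * (1/4))"
      using Xn[of n] Xn[of "Suc n"] by (intro mult_left_mono add_mono mult_right_mono) auto
    finally show ?case using Suc by simp
  qed
  obtain r where lim: "norm_conv X r"
    using geometric_norm_conv[of X 1 "1/4"] step by auto
  show ?thesis
  proof
    show r: "r \<in> carr B" using lim by (simp add: norm_conv_def)
    have sa: "(X n)\<^sup>\<star> = X n" for n
    proof (induction n)
      case 0 show ?case using star_scale[of \<zero> 0] by (simp add: X0)
    next
      case (Suc n) then show ?case using h by (simp add: XS star_scale star_add star_mult)
    qed
    show "r\<^sup>\<star> = r" using norm_conv_unique[OF norm_conv_star[OF lim] ] lim by (simp add: sa)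
    have comm: "X n \<otimes> h = h \<otimes> X n" for n
    proof (induction n)
      case 0 show ?case using h mult_scale_left[of \<zero> h 0] mult_scale_right[of h \<zero> 0] by (simp add: X0)
    next
      case (Suc n)
      have "X n \<otimes> X n \<otimes> h = h \<otimes> (X n \<otimes> X n)"
        using h Xc by (metis Suc mult_assoc)
      then show ?case using h
        by (simp add: XS mult_scale_left mult_scale_right mult_add_left mult_add_right mult_assoc)
    qed
    show "r \<otimes> h = h \<otimes> r"
      using norm_conv_unique[OF norm_conv_mult[OF lim norm_conv_const[OF h(1)]]] norm_conv_mult[OF norm_conv_const[OF h(1)] lim]
      unfolding comm by blast
    have "norm_conv (\<lambda>n. X (Suc n)) ((1/2) \<odot> (h \<otimes> h \<oplus> r \<otimes> r))"
      unfolding XS using h lim by (intro norm_conv_scale norm_conv_add norm_conv_const norm_conv_mult) auto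
    then show "r = (1/2) \<odot> (h \<otimes> h \<oplus> r \<otimes> r)"
      using norm_conv_unique[OF norm_conv_Suc[OF lim]] by blast
    show "anorm B r \<le> 1/4"
      using LIMSEQ_le_const2[OF norm_conv_norm[OF lim]] Xn by blast
  qed
qed

section \<open>Images of *-homomorphisms are closed\<close>
definition real_part :: "'a \<Rightarrow> 'a" where
  "real_part x = (1/2) \<odot> (x \<oplus> x\<^sup>\<star>)"

definition imag_part :: "'a \<Rightarrow> 'a" where
  "imag_part x = (-\<i>/2) \<odot> (x \<ominus> x\<^sup>\<star>)"

lemma real_part_closed [simp]: "x \<in> carr B \<Longrightarrow> real_part x \<in> carr B"
  and imag_part_closed [simp]: "x \<in> carr B \<Longrightarrow> imag_part x \<in> carr B"
  by (simp_all add: real_part_def imag_part_def)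

lemma star_real_part: "x \<in> carr B \<Longrightarrow> (real_part x)\<^sup>\<star> = real_part x"
  by (simp add: real_part_def star_scale star_add star_star add_commute)

lemma star_imag_part: "x \<in> carr B \<Longrightarrow> (imag_part x)\<^sup>\<star> = imag_part x"
  by (simp add: imag_part_def adiff_def star_scale star_add star_star scale_add_right scale_scale add_commute)

lemma real_imag_decomp: assumes "x \<in> carr B" shows "x = real_part x \<oplus> \<i> \<odot> imag_part x"
proof -
  have "real_part x \<oplus> \<i> \<odot> imag_part x = ((1/2) \<odot> x \<oplus> (1/2) \<odot> x) \<oplus> ((1/2) \<odot> x\<^sup>\<star> \<oplus> (-1/2) \<odot> x\<^sup>\<star>)"
    using assms by (simp add: real_part_def imag_part_def adiff_def scale_add_right scale_scale
        add_assoc add_left_commute)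
  then show ?thesis
    using assms scale_add_left[of x "1/2" "1/2", symmetric]
      scale_add_left[of "x\<^sup>\<star>" "1/2" "-1/2", symmetric]
    by (simp add: scale_one add_zero)
qed

lemma norm_real_part_le: "x \<in> carr B \<Longrightarrow> anorm B (real_part x) \<le> anorm B x"
  using norm_triangle[of x "x\<^sup>\<star>"] by (simp add: real_part_def norm_scale norm_star)

lemma norm_imag_part_le: "x \<in> carr B \<Longrightarrow> anorm B (imag_part x) \<le> anorm B x"
  using norm_diff_le[of x "x\<^sup>\<star>"] by (simp add: imag_part_def norm_scale norm_star norm_divide)

lemma norm_diff_diff_self: assumes "x \<in> carr B" "y \<in> carr B" shows "anorm B (x \<ominus> y \<ominus> x) = anorm B y"
proof -
  have "x \<ominus> y \<ominus> x = (-1) \<odot> y"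
    using assms by (simp add: adiff_def add_assoc add_commute[of "(-1) \<odot> y" "(-1) \<odot> x"] neg_add_cancel)
  then show ?thesis using assms by (simp add: norm_neg)
qed

end

locale cstar_hom = A: cstar_algebra A + B: cstar_algebra B
  for A :: "'a cstar_alg" and B :: "'b cstar_alg" +
  fixes \<phi> :: "'a \<Rightarrow> 'b"
  assumes hom: "\<phi> \<in> star_hom A B"
begin

lemma hom_closed [simp]: "x \<in> carr A \<Longrightarrow> \<phi> x \<in> carr B"
  and hom_add: "\<lbrakk>x \<in> carr A; y \<in> carr A\<rbrakk> \<Longrightarrow> \<phi> (x \<oplus>\<^bsub>A\<^esub> y) = \<phi> x \<oplus>\<^bsub>B\<^esub> \<phi> y"
  and hom_scale: "x \<in> carr A \<Longrightarrow> \<phi> (c \<odot>\<^bsub>A\<^esub> x) = c \<odot>\<^bsub>B\<^esub> \<phi> x"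
  and hom_mult: "\<lbrakk>x \<in> carr A; y \<in> carr A\<rbrakk> \<Longrightarrow> \<phi> (x \<otimes>\<^bsub>A\<^esub> y) = \<phi> x \<otimes>\<^bsub>B\<^esub> \<phi> y"
  and hom_star: "x \<in> carr A \<Longrightarrow> \<phi> (x\<^sup>\<star>\<^bsub>A\<^esub>) = (\<phi> x)\<^sup>\<star>\<^bsub>B\<^esub>"
  using hom by (auto simp: star_hom_def)

lemma hom_diff: "\<lbrakk>x \<in> carr A; y \<in> carr A\<rbrakk> \<Longrightarrow> \<phi> (x \<ominus>\<^bsub>A\<^esub> y) = \<phi> x \<ominus>\<^bsub>B\<^esub> \<phi> y"
  by (simp add: adiff_def hom_add hom_scale)

lemma hom_zero [simp]: "\<phi> \<zero>\<^bsub>A\<^esub> = \<zero>\<^bsub>B\<^esub>"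
  using hom_scale[OF A.zero_closed, of 0] by simp

lemma hom_real_part: "x \<in> carr A \<Longrightarrow> \<phi> (A.real_part x) = B.real_part (\<phi> x)"
  by (simp add: A.real_part_def B.real_part_def hom_scale hom_add hom_star)

lemma hom_imag_part: "x \<in> carr A \<Longrightarrow> \<phi> (A.imag_part x) = B.imag_part (\<phi> x)"
  by (simp add: A.imag_part_def B.imag_part_def hom_scale hom_diff hom_star)

text \<open>Continuity of \<open>\<phi>\<close> is derived from algebra alone: after scaling to \<open>\<parallel>h\<parallel> \<le> 1/2\<close>, the images of
  \<open>h\<close> and its companion \<open>r\<close> still satisfy the equations of \<open>isometric_cos_sin\<close>, so \<open>\<phi> h\<close> is the
  imaginary part of an element of norm at most 2.\<close>
lemma norm_hom_self_adjoint:
  assumes a: "a \<in> carr A" "a\<^sup>\<star>\<^bsub>A\<^esub> = a"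
  shows "anorm B (\<phi> a) \<le> 4 * anorm A a"
proof (cases "anorm A a = 0")
  case True
  then show ?thesis using A.norm_definite[OF a(1)] by simp
next
  case False
  with a have pos: "0 < anorm A a" by (simp add: less_le)
  define h where "h = complex_of_real (1 / (2 * anorm A a)) \<odot>\<^bsub>A\<^esub> a"
  have h: "h \<in> carr A" "h\<^sup>\<star>\<^bsub>A\<^esub> = h" "anorm A h \<le> 1/2"
    using a pos by (auto simp: h_def A.star_scale A.norm_scale norm_divide norm_mult)
  obtain r where r: "r \<in> carr A" "r\<^sup>\<star>\<^bsub>A\<^esub> = r" "r \<otimes>\<^bsub>A\<^esub> h = h \<otimes>\<^bsub>A\<^esub> r"
    "r = (1/2) \<odot>\<^bsub>A\<^esub> (h \<otimes>\<^bsub>A\<^esub> h \<oplus>\<^bsub>A\<^esub> r \<otimes>\<^bsub>A\<^esub> r)"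
    using A.versine_exists[OF h] by metis
  let ?V = "\<i> \<odot>\<^bsub>B\<^esub> \<phi> h \<ominus>\<^bsub>B\<^esub> \<phi> r"
  have "B.isometric ?V"
  proof (rule B.isometric_cos_sin)
    show "\<phi> r = (1/2) \<odot>\<^bsub>B\<^esub> (\<phi> h \<otimes>\<^bsub>B\<^esub> \<phi> h \<oplus>\<^bsub>B\<^esub> \<phi> r \<otimes>\<^bsub>B\<^esub> \<phi> r)"
      using arg_cong[OF r(4), of \<phi>] h r(1) by (simp add: hom_scale hom_add hom_mult)
  qed (use h r(1-3) in \<open>simp_all flip: hom_star hom_mult\<close>)
  then have V2: "anorm B ?V \<le> 2" by (rule B.isometric_norm_le)
  have "?V \<ominus>\<^bsub>B\<^esub> ?V\<^sup>\<star>\<^bsub>B\<^esub> = (2 * \<i>) \<odot>\<^bsub>B\<^esub> \<phi> h"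
  proof -
    have "?V\<^sup>\<star>\<^bsub>B\<^esub> = (-\<i>) \<odot>\<^bsub>B\<^esub> \<phi> h \<ominus>\<^bsub>B\<^esub> \<phi> r"
      using h r(1,2) by (simp add: adiff_def B.star_add B.star_scale flip: hom_star)
    moreover have "?V \<ominus>\<^bsub>B\<^esub> \<dots> = (\<i> \<odot>\<^bsub>B\<^esub> \<phi> h \<oplus>\<^bsub>B\<^esub> \<i> \<odot>\<^bsub>B\<^esub> \<phi> h) \<oplus>\<^bsub>B\<^esub> (\<phi> r \<oplus>\<^bsub>B\<^esub> (-1) \<odot>\<^bsub>B\<^esub> \<phi> r)"
      using h(1) r(1) by (simp add: adiff_def B.scale_add_right B.scale_scale B.scale_one B.add_assoc
          B.add_left_commute B.add_commute)
    ultimately show ?thesis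
      using h(1) r(1) B.scale_add_left[of "\<phi> h" \<i> \<i>] by (simp add: B.add_neg B.add_zero)
  qed
  then have "2 * anorm B (\<phi> h) \<le> anorm B ?V + anorm B (?V\<^sup>\<star>\<^bsub>B\<^esub>)"
    using B.norm_diff_le[of ?V "?V\<^sup>\<star>\<^bsub>B\<^esub>"] h(1) r(1) by (simp add: B.norm_scale norm_mult)
  also have "\<dots> \<le> 2 + 2"
    using V2 h(1) r(1) by (simp add: B.norm_star)
  finally have "anorm B (\<phi> h) \<le> 2" by simp
  then show ?thesis
    using a pos by (simp add: h_def hom_scale B.norm_scale norm_divide norm_mult field_simps)
qed

lemma norm_hom_le: assumes x: "x \<in> carr A" shows "anorm B (\<phi> x) \<le> 8 * anorm A x"
proof -
  have "\<phi> x = \<phi> (A.real_part x) \<oplus>\<^bsub>B\<^esub> \<i> \<odot>\<^bsub>B\<^esub> \<phi> (A.imag_part x)"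
    using arg_cong[OF A.real_imag_decomp[OF x], of \<phi>] x by (simp add: hom_add hom_scale)
  then have "anorm B (\<phi> x) \<le> anorm B (\<phi> (A.real_part x)) + anorm B (\<phi> (A.imag_part x))"
    using B.norm_triangle[of "\<phi> (A.real_part x)" "\<i> \<odot>\<^bsub>B\<^esub> \<phi> (A.imag_part x)"] x by (simp add: B.norm_scale)
  also have "\<dots> \<le> 4 * anorm A x + 4 * anorm A x"
    using norm_hom_self_adjoint[of "A.real_part x"] norm_hom_self_adjoint[of "A.imag_part x"] x
      A.norm_real_part_le[OF x] A.norm_imag_part_le[OF x]
    by (simp add: A.star_real_part A.star_imag_part)
  finally show ?thesis by simp
qed

lemma hom_norm_conv: assumes "A.norm_conv X x" shows "B.norm_conv (\<lambda>n. \<phi> (X n)) (\<phi> x)"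
proof (rule B.norm_conv_cong_le)
  have c: "X n \<in> carr A" "x \<in> carr A" for n using assms by (auto simp: A.norm_conv_def)
  then show "\<phi> (X n) \<in> carr B" "\<phi> x \<in> carr B" for n by auto
  show "anorm B (\<phi> (X n) \<ominus>\<^bsub>B\<^esub> \<phi> x) \<le> 8 * anorm A (X n \<ominus>\<^bsub>A\<^esub> x)" for n
    using norm_hom_le[of "X n \<ominus>\<^bsub>A\<^esub> x"] c by (simp add: hom_diff)
  show "(\<lambda>n. 8 * anorm A (X n \<ominus>\<^bsub>A\<^esub> x)) \<longlonglongrightarrow> 0"
    using assms by (intro tendsto_mult_right_zero) (simp add: A.norm_conv_def)
qed

text \<open>The point is that the bound 2 does not depend on the norm of \<open>a\<close>. Write \<open>\<phi> a = 2\<^sup>k H\<close>. The element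
  \<open>v = \<i>h - r\<close> for \<open>h = a / 2\<^sup>k\<close> plays the role of \<open>exp (\<i>h) - 1\<close>, and \<open>k\<close> squarings turn it into an
  analogue of \<open>exp (\<i>a) - 1\<close>. On the side of \<open>B\<close> only the small norm of \<open>\<phi> a\<close> matters, and there the
  result agrees with \<open>\<i> \<phi> a\<close> to first order.\<close>
lemma self_adjoint_approx_lift:
  assumes a: "a \<in> carr A" "a\<^sup>\<star>\<^bsub>A\<^esub> = a" and le: "anorm B (\<phi> a) \<le> 1/4"
  shows "\<exists>a'\<in>carr A. anorm A a' \<le> 2 \<and> anorm B (\<phi> a' \<ominus>\<^bsub>B\<^esub> \<i> \<odot>\<^bsub>B\<^esub> \<phi> a) \<le> (anorm B (\<phi> a))\<^sup>2"
proof -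
  obtain k where k: "2 * anorm A a < 2 ^ k"
    using real_arch_pow[of 2 "2 * anorm A a"] by auto
  define h where "h = complex_of_real (1 / 2 ^ k) \<odot>\<^bsub>A\<^esub> a"
  have h: "h \<in> carr A" "h\<^sup>\<star>\<^bsub>A\<^esub> = h" "anorm A h \<le> 1/2"
    using a k by (auto simp: h_def A.star_scale A.norm_scale norm_divide norm_power field_simps)
  obtain r where r: "r \<in> carr A" "r\<^sup>\<star>\<^bsub>A\<^esub> = r" "r \<otimes>\<^bsub>A\<^esub> h = h \<otimes>\<^bsub>A\<^esub> r"
    "r = (1/2) \<odot>\<^bsub>A\<^esub> (h \<otimes>\<^bsub>A\<^esub> h \<oplus>\<^bsub>A\<^esub> r \<otimes>\<^bsub>A\<^esub> r)" "anorm A r \<le> 1/4"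
    using A.versine_exists[OF h] by metis
  define y where "y = rec_nat (\<i> \<odot>\<^bsub>A\<^esub> h \<ominus>\<^bsub>A\<^esub> r) (\<lambda>_ v. 2 \<odot>\<^bsub>A\<^esub> v \<oplus>\<^bsub>A\<^esub> v \<otimes>\<^bsub>A\<^esub> v)"
  have y0: "y 0 = \<i> \<odot>\<^bsub>A\<^esub> h \<ominus>\<^bsub>A\<^esub> r"
    and yS: "y (Suc j) = 2 \<odot>\<^bsub>A\<^esub> y j \<oplus>\<^bsub>A\<^esub> y j \<otimes>\<^bsub>A\<^esub> y j" for j
    by (simp_all add: y_def)
  have iso: "A.isometric (y j)" for j
  proof (induction j)
    case 0 show ?case using A.isometric_cos_sin[OF r(1) h(1) r(2) h(2) r(3,4)] by (simp add: y0)
  next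
    case (Suc j) then show ?case by (simp add: yS A.isometric_double)
  qed
  then have yc [simp]: "y j \<in> carr A" for j by (simp add: A.isometric_def)
  define H where "H = \<phi> h"
  define \<eta> where "\<eta> = anorm B H"
  have Hc [simp]: "H \<in> carr B" using h by (simp add: H_def)
  have \<eta>0: "0 \<le> \<eta>" by (simp add: \<eta>_def)
  have \<phi>a: "\<phi> a = complex_of_real (2 ^ k) \<odot>\<^bsub>B\<^esub> H"
    using a by (simp add: H_def h_def hom_scale B.scale_scale B.scale_one)
  then have \<eta>k: "anorm B (\<phi> a) = 2 ^ k * \<eta>"
    by (simp add: B.norm_scale \<eta>_def norm_power)
  \<comment> \<open>\<open>2R = H\<^sup>2 + R\<^sup>2\<close> with \<open>\<parallel>R\<parallel> \<le> 1\<close>, so the quadratic term in \<open>R\<close> can be absorbed.\<close>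
  have R: "anorm B (\<phi> r) \<le> \<eta>\<^sup>2"
  proof -
    have R1: "anorm B (\<phi> r) \<le> 1"
      using norm_hom_self_adjoint[OF r(1,2)] r(5) by simp
    have "\<phi> r = (1/2) \<odot>\<^bsub>B\<^esub> (H \<otimes>\<^bsub>B\<^esub> H \<oplus>\<^bsub>B\<^esub> \<phi> r \<otimes>\<^bsub>B\<^esub> \<phi> r)"
      using arg_cong[OF r(4), of \<phi>] h(1) r(1) by (simp add: H_def hom_scale hom_add hom_mult)
    then have "anorm B (\<phi> r) = 1/2 * anorm B (H \<otimes>\<^bsub>B\<^esub> H \<oplus>\<^bsub>B\<^esub> \<phi> r \<otimes>\<^bsub>B\<^esub> \<phi> r)"
      using r(1) B.norm_scale[of "H \<otimes>\<^bsub>B\<^esub> H \<oplus>\<^bsub>B\<^esub> \<phi> r \<otimes>\<^bsub>B\<^esub> \<phi> r" "1/2"] by simp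
    also have "\<dots> \<le> 1/2 * (\<eta> * \<eta> + anorm B (\<phi> r) * anorm B (\<phi> r))"
      using B.norm_triangle[of "H \<otimes>\<^bsub>B\<^esub> H" "\<phi> r \<otimes>\<^bsub>B\<^esub> \<phi> r"] B.norm_mult_le[of H H]
        B.norm_mult_le[of "\<phi> r" "\<phi> r"] r(1) by (simp add: \<eta>_def)
    also have "\<dots> \<le> 1/2 * (\<eta> * \<eta> + anorm B (\<phi> r) * 1)"
      using R1 r(1) by (intro mult_left_mono add_left_mono) auto
    finally show ?thesis by (simp add: power2_eq_square)
  qed
  \<comment> \<open>Doubling \<open>Y \<mapsto> 2Y + Y\<^sup>2\<close> sends an error \<open>t\<^sup>2\<close> to at most \<open>2t\<^sup>2 + (t + t\<^sup>2)\<^sup>2\<close>, which stays below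
      \<open>(2t)\<^sup>2\<close> because \<open>t \<le> 1/8\<close> before the last step.\<close>
  have err: "anorm B (\<phi> (y j) \<ominus>\<^bsub>B\<^esub> (2 ^ j * \<i>) \<odot>\<^bsub>B\<^esub> H) \<le> (2 ^ j * \<eta>)\<^sup>2" if "j \<le> k" for j
    using that
  proof (induction j)
    case 0
    show ?case using R h(1) r(1) B.norm_diff_diff_self[of "\<i> \<odot>\<^bsub>B\<^esub> H" "\<phi> r"]
      by (simp add: y0 hom_diff hom_scale H_def)
  next
    case (Suc j)
    let ?Y = "\<phi> (y j)" and ?L = "(2 ^ j * \<i>) \<odot>\<^bsub>B\<^esub> H" and ?t = "2 ^ j * \<eta>"
    have IH: "anorm B (?Y \<ominus>\<^bsub>B\<^esub> ?L) \<le> ?t\<^sup>2" using Suc by simp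
    have t: "0 \<le> ?t" "?t \<le> 1/8"
    proof -
      have "(2::real) ^ Suc j \<le> 2 ^ k" using Suc.prems by (intro power_increasing) auto
      then have "2 ^ Suc j * \<eta> \<le> 2 ^ k * \<eta>" using \<eta>0 by (rule mult_right_mono)
      then show "?t \<le> 1/8" using le \<eta>k by simp
    qed (use \<eta>0 in simp)
    have "anorm B ?L = ?t" by (simp add: B.norm_scale \<eta>_def norm_mult norm_power)
    then have Y: "anorm B ?Y \<le> ?t\<^sup>2 + ?t"
      using B.norm_le_norm_diff_add[of ?Y ?L] IH by simp
    have "?t\<^sup>2 + ?t = ?t * (1 + ?t)" by (simp add: power2_eq_square algebra_simps)
    also have "\<dots> \<le> ?t * (9/8)" using t by (intro mult_left_mono) auto
    finally have Y': "anorm B ?Y \<le> ?t * (9/8)" using Y by linarith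
    have "\<phi> (y (Suc j)) \<ominus>\<^bsub>B\<^esub> (2 ^ Suc j * \<i>) \<odot>\<^bsub>B\<^esub> H = 2 \<odot>\<^bsub>B\<^esub> (?Y \<ominus>\<^bsub>B\<^esub> ?L) \<oplus>\<^bsub>B\<^esub> ?Y \<otimes>\<^bsub>B\<^esub> ?Y"
      by (simp add: yS hom_add hom_scale hom_mult adiff_def B.scale_add_right B.scale_scale
          B.add_assoc B.add_commute B.add_left_commute algebra_simps)
    then have "anorm B (\<phi> (y (Suc j)) \<ominus>\<^bsub>B\<^esub> (2 ^ Suc j * \<i>) \<odot>\<^bsub>B\<^esub> H)
        \<le> 2 * anorm B (?Y \<ominus>\<^bsub>B\<^esub> ?L) + anorm B ?Y * anorm B ?Y"
      using B.norm_triangle[of "2 \<odot>\<^bsub>B\<^esub> (?Y \<ominus>\<^bsub>B\<^esub> ?L)" "?Y \<otimes>\<^bsub>B\<^esub> ?Y"] B.norm_mult_le[of ?Y ?Y]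
      by (simp add: B.norm_scale)
    also have "\<dots> \<le> 2 * ?t\<^sup>2 + (?t * (9/8)) * (?t * (9/8))"
      using IH Y' t by (intro add_mono mult_mono) auto
    also have "\<dots> \<le> (2 * ?t)\<^sup>2"
      using \<eta>0 by (simp add: power2_eq_square algebra_simps)
    finally show ?case by (simp add: mult.assoc)
  qed
  have "anorm A (y k) \<le> 2" using A.isometric_norm_le[OF iso] .
  moreover have "\<i> \<odot>\<^bsub>B\<^esub> \<phi> a = (2 ^ k * \<i>) \<odot>\<^bsub>B\<^esub> H"
    by (simp add: \<phi>a B.scale_scale mult.commute)
  ultimately show ?thesis
    using err[OF order_refl] by (intro bexI[of _ "y k"]) (auto simp: \<eta>k)
qed

text \<open>Scaling to \<open>\<parallel>\<phi> x\<parallel> = 1/4\<close> makes the two quadratic errors, from the real and the imaginary part, at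
  most \<open>2 / 16\<close> together, which is half of that norm.\<close>
lemma approx_lift:
  assumes x: "x \<in> carr A"
  shows "\<exists>x'\<in>carr A. anorm A x' \<le> 16 * anorm B (\<phi> x) \<and>
    anorm B (\<phi> x' \<ominus>\<^bsub>B\<^esub> \<phi> x) \<le> anorm B (\<phi> x) / 2"
proof (cases "anorm B (\<phi> x) = 0")
  case True
  then have "\<phi> x = \<zero>\<^bsub>B\<^esub>" using B.norm_definite x by simp
  then show ?thesis by (intro bexI[of _ "\<zero>\<^bsub>A\<^esub>"]) auto
next
  case False
  define b where "b = anorm B (\<phi> x)"
  have b: "0 < b" using False x by (simp add: b_def less_le)
  define z where "z = complex_of_real (1 / (4 * b)) \<odot>\<^bsub>A\<^esub> x"
  have z: "z \<in> carr A" using x by (simp add: z_def)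
  have \<phi>z: "anorm B (\<phi> z) = 1/4"
    using b x by (simp add: z_def hom_scale B.norm_scale norm_divide norm_mult flip: b_def)
  have small: "anorm B (\<phi> (A.real_part z)) \<le> 1/4" "anorm B (\<phi> (A.imag_part z)) \<le> 1/4"
    using B.norm_real_part_le[of "\<phi> z"] B.norm_imag_part_le[of "\<phi> z"] z \<phi>z
    by (simp_all add: hom_real_part hom_imag_part)
  obtain p where p: "p \<in> carr A" "anorm A p \<le> 2"
      "anorm B (\<phi> p \<ominus>\<^bsub>B\<^esub> \<i> \<odot>\<^bsub>B\<^esub> \<phi> (A.real_part z)) \<le> (anorm B (\<phi> (A.real_part z)))\<^sup>2"
    using self_adjoint_approx_lift[OF _ _ small(1)] z by (auto simp: A.star_real_part)
  obtain q where q: "q \<in> carr A" "anorm A q \<le> 2"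
      "anorm B (\<phi> q \<ominus>\<^bsub>B\<^esub> \<i> \<odot>\<^bsub>B\<^esub> \<phi> (A.imag_part z)) \<le> (anorm B (\<phi> (A.imag_part z)))\<^sup>2"
    using self_adjoint_approx_lift[OF _ _ small(2)] z by (auto simp: A.star_imag_part)
  have sq: "(anorm B (\<phi> w))\<^sup>2 \<le> 1/16" if "anorm B (\<phi> w) \<le> 1/4" "w \<in> carr A" for w
    using power_mono[OF that(1), of 2] that(2) by (simp add: power_divide)
  let ?z' = "(-\<i>) \<odot>\<^bsub>A\<^esub> p \<oplus>\<^bsub>A\<^esub> q"
  have z': "?z' \<in> carr A" using p q by simp
  have nz': "anorm A ?z' \<le> 4"
    using A.norm_triangle[of "(-\<i>) \<odot>\<^bsub>A\<^esub> p" q] p q by (simp add: A.norm_scale)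
  have "\<phi> z = (-\<i>) \<odot>\<^bsub>B\<^esub> (\<i> \<odot>\<^bsub>B\<^esub> \<phi> (A.real_part z)) \<oplus>\<^bsub>B\<^esub> \<i> \<odot>\<^bsub>B\<^esub> \<phi> (A.imag_part z)"
    using arg_cong[OF A.real_imag_decomp[OF z], of \<phi>] z
    by (simp add: hom_add hom_scale B.scale_scale B.scale_one)
  then have "\<phi> ?z' \<ominus>\<^bsub>B\<^esub> \<phi> z = (-\<i>) \<odot>\<^bsub>B\<^esub> (\<phi> p \<ominus>\<^bsub>B\<^esub> \<i> \<odot>\<^bsub>B\<^esub> \<phi> (A.real_part z))
      \<oplus>\<^bsub>B\<^esub> (\<phi> q \<ominus>\<^bsub>B\<^esub> \<i> \<odot>\<^bsub>B\<^esub> \<phi> (A.imag_part z))"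
    using p(1) q(1) z by (simp add: hom_add hom_scale B.add_diff_add B.scale_diff)
  then have "anorm B (\<phi> ?z' \<ominus>\<^bsub>B\<^esub> \<phi> z) \<le> 1/16 + 1/16"
    using B.norm_triangle[of "(-\<i>) \<odot>\<^bsub>B\<^esub> (\<phi> p \<ominus>\<^bsub>B\<^esub> \<i> \<odot>\<^bsub>B\<^esub> \<phi> (A.real_part z))"
        "\<phi> q \<ominus>\<^bsub>B\<^esub> \<i> \<odot>\<^bsub>B\<^esub> \<phi> (A.imag_part z)"]
      p q z sq[OF small(1)] sq[OF small(2)] by (simp add: B.norm_scale)
  then have ez': "anorm B (\<phi> ?z' \<ominus>\<^bsub>B\<^esub> \<phi> z) \<le> 1/8" by simp
  let ?c = "complex_of_real (4 * b)"
  have "\<phi> x = ?c \<odot>\<^bsub>B\<^esub> \<phi> z"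
    using b x by (simp add: z_def hom_scale B.scale_scale B.scale_one)
  then have "anorm B (\<phi> (?c \<odot>\<^bsub>A\<^esub> ?z') \<ominus>\<^bsub>B\<^esub> \<phi> x) = 4 * b * anorm B (\<phi> ?z' \<ominus>\<^bsub>B\<^esub> \<phi> z)"
    using z z' b by (simp add: hom_scale[OF z'] B.scale_diff B.norm_scale norm_mult)
  moreover have "anorm A (?c \<odot>\<^bsub>A\<^esub> ?z') \<le> 16 * b"
    using nz' z' b by (simp add: A.norm_scale norm_mult)
  ultimately show ?thesis
    using z' ez' b by (intro bexI[of _ "?c \<odot>\<^bsub>A\<^esub> ?z'"]) (auto simp flip: b_def)
qed

text \<open>As in the proof of the open mapping theorem: each approximate preimage of \<open>d\<close> is corrected by a lift of the
  remaining error, whose norm is controlled by that error. The corrections are summable, and the sum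
  is an exact preimage.\<close>
lemma image_closed:
  assumes X: "\<And>n. X n \<in> \<phi> ` carr A" and lim: "B.norm_conv X d"
  shows "d \<in> \<phi> ` carr A"
proof -
  have d: "d \<in> carr B" using lim by (simp add: B.norm_conv_def)
  \<comment> \<open>The constants: the element to be lifted has norm at most \<open>(1 + 1/8) e\<close>, so its lift has norm at most
      \<open>16 (1 + 1/8) e = 18 e\<close>, and the new error is at most \<open>(1 + 1/8) e / 2 + e / 8 < 3 e / 4\<close>.\<close>
  have step: "\<exists>w'. w' \<in> carr A \<and> anorm A (w' \<ominus>\<^bsub>A\<^esub> w) \<le> 18 * e \<and> anorm B (\<phi> w' \<ominus>\<^bsub>B\<^esub> d) \<le> 3/4 * e"
    if w: "w \<in> carr A" "anorm B (\<phi> w \<ominus>\<^bsub>B\<^esub> d) \<le> e" and e: "0 < e" for w e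
  proof -
    have "\<forall>\<^sub>F n in sequentially. anorm B (X n \<ominus>\<^bsub>B\<^esub> d) < e / 8"
      using lim e by (intro order_tendstoD(2)[of _ 0]) (simp_all add: B.norm_conv_def)
    then obtain n where n: "anorm B (X n \<ominus>\<^bsub>B\<^esub> d) < e / 8"
      using eventually_happens by force
    from X[of n] obtain x where "x \<in> carr A" "X n = \<phi> x" by blast
    with n have x: "x \<in> carr A" "anorm B (\<phi> x \<ominus>\<^bsub>B\<^esub> d) < e / 8" by auto
    \<comment> \<open>The error \<open>d - \<phi> w\<close> need not lie in the image, so it is first replaced by the nearby
        \<open>\<phi> (x - w)\<close>.\<close>
    obtain u where u: "u \<in> carr A" "anorm A u \<le> 16 * anorm B (\<phi> (x \<ominus>\<^bsub>A\<^esub> w))"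
      "anorm B (\<phi> u \<ominus>\<^bsub>B\<^esub> \<phi> (x \<ominus>\<^bsub>A\<^esub> w)) \<le> anorm B (\<phi> (x \<ominus>\<^bsub>A\<^esub> w)) / 2"
      using approx_lift[of "x \<ominus>\<^bsub>A\<^esub> w"] x w by auto
    have b: "anorm B (\<phi> (x \<ominus>\<^bsub>A\<^esub> w)) \<le> e / 8 + e"
      using B.norm_diff_triangle[of "\<phi> x" d "\<phi> w"] x w d B.norm_diff_commute[of d "\<phi> w"]
      by (simp add: hom_diff)
    have "w \<oplus>\<^bsub>A\<^esub> u \<ominus>\<^bsub>A\<^esub> w = u"
      using w u(1) A.add_commute[of w u] by (simp add: adiff_def A.add_assoc A.add_neg A.add_zero)
    then have "anorm A (w \<oplus>\<^bsub>A\<^esub> u \<ominus>\<^bsub>A\<^esub> w) \<le> 18 * e" using u(2) b by simp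
    moreover have "\<phi> (w \<oplus>\<^bsub>A\<^esub> u) \<ominus>\<^bsub>B\<^esub> \<phi> x = \<phi> u \<ominus>\<^bsub>B\<^esub> \<phi> (x \<ominus>\<^bsub>A\<^esub> w)"
      using w(1) u(1) x(1)
      by (simp add: hom_add hom_scale hom_diff adiff_def B.scale_add_right B.scale_scale B.scale_one B.add_assoc
          B.add_left_commute B.add_commute)
    then have "anorm B (\<phi> (w \<oplus>\<^bsub>A\<^esub> u) \<ominus>\<^bsub>B\<^esub> d) \<le> (e / 8 + e) / 2 + e / 8"
      using B.norm_diff_triangle[of "\<phi> (w \<oplus>\<^bsub>A\<^esub> u)" "\<phi> x" d] w u x d b by simp
    ultimately show ?thesis using w u(1) e by (intro exI[of _ "w \<oplus>\<^bsub>A\<^esub> u"]) auto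
  qed
  define C where "C = anorm B d + 1"
  have C: "0 < C" using B.norm_nonneg[OF d] by (simp add: C_def)
  have "\<exists>w. \<forall>n. (w n \<in> carr A \<and> anorm B (\<phi> (w n) \<ominus>\<^bsub>B\<^esub> d) \<le> C * (3/4) ^ n) \<and>
      anorm A (w (Suc n) \<ominus>\<^bsub>A\<^esub> w n) \<le> 18 * (C * (3/4) ^ n)"
  proof (rule dependent_nat_choice)
    have "anorm B (\<phi> \<zero>\<^bsub>A\<^esub> \<ominus>\<^bsub>B\<^esub> d) \<le> C"
      using d B.norm_diff_le[of "\<zero>\<^bsub>B\<^esub>" d] by (simp add: C_def)
    then show "\<exists>w. w \<in> carr A \<and> anorm B (\<phi> w \<ominus>\<^bsub>B\<^esub> d) \<le> C * (3/4) ^ 0"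
      by (intro exI[of _ "\<zero>\<^bsub>A\<^esub>"]) simp
  next
    fix w n assume "w \<in> carr A \<and> anorm B (\<phi> w \<ominus>\<^bsub>B\<^esub> d) \<le> C * (3/4) ^ n"
    then show "\<exists>w'. (w' \<in> carr A \<and> anorm B (\<phi> w' \<ominus>\<^bsub>B\<^esub> d) \<le> C * (3/4) ^ Suc n) \<and>
        anorm A (w' \<ominus>\<^bsub>A\<^esub> w) \<le> 18 * (C * (3/4) ^ n)"
      using step[of w "C * (3/4) ^ n"] C by (auto simp: mult.left_commute)
  qed
  then obtain w where w: "\<And>n. w n \<in> carr A" "\<And>n. anorm B (\<phi> (w n) \<ominus>\<^bsub>B\<^esub> d) \<le> C * (3/4) ^ n"
    "\<And>n. anorm A (w (Suc n) \<ominus>\<^bsub>A\<^esub> w n) \<le> 18 * C * (3/4) ^ n"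
    by (auto simp: mult.assoc)
  obtain v where v: "A.norm_conv w v"
    using A.geometric_norm_conv[of w "18 * C" "3/4"] w by auto
  have "B.norm_conv (\<lambda>n. \<phi> (w n)) d"
  proof (rule B.norm_conv_cong_le)
    show "(\<lambda>n. C * (3/4) ^ n) \<longlonglongrightarrow> 0"
      by (intro tendsto_mult_right_zero LIMSEQ_power_zero) auto
  qed (use w d in auto)
  then have "d = \<phi> v" using B.norm_conv_unique hom_norm_conv[OF v] by blast
  then show ?thesis using v by (auto simp: A.norm_conv_def)
qed

theorem image_cstar_subalgebra: "cstar_subalgebra B (\<phi> ` carr A)"
proof -
  have lim: "x \<in> \<phi> ` carr A"
    if X: "\<forall>n. X n \<in> \<phi> ` carr A" and x: "x \<in> carr B"
      and conv: "(\<lambda>n. anorm B (X n \<ominus>\<^bsub>B\<^esub> x)) \<longlonglongrightarrow> 0" for X x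
  proof (rule image_closed)
    show "X n \<in> \<phi> ` carr A" for n using X by blast
    moreover have "\<phi> ` carr A \<subseteq> carr B" by auto
    ultimately show "B.norm_conv X x" unfolding B.norm_conv_def using x conv by blast
  qed
  have ops: "x \<oplus>\<^bsub>B\<^esub> y \<in> \<phi> ` carr A" "x \<otimes>\<^bsub>B\<^esub> y \<in> \<phi> ` carr A" "c \<odot>\<^bsub>B\<^esub> x \<in> \<phi> ` carr A"
      "x\<^sup>\<star>\<^bsub>B\<^esub> \<in> \<phi> ` carr A"
    if xy: "x \<in> \<phi> ` carr A" "y \<in> \<phi> ` carr A" for x y c
  proof -
    obtain a b where ab: "a \<in> carr A" "b \<in> carr A" and [simp]: "x = \<phi> a" "y = \<phi> b"
      using xy by blast
    show "x \<oplus>\<^bsub>B\<^esub> y \<in> \<phi> ` carr A"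
      using ab by (intro image_eqI[of _ _ "a \<oplus>\<^bsub>A\<^esub> b"]) (simp_all add: hom_add)
    show "x \<otimes>\<^bsub>B\<^esub> y \<in> \<phi> ` carr A"
      using ab by (intro image_eqI[of _ _ "a \<otimes>\<^bsub>A\<^esub> b"]) (simp_all add: hom_mult)
    show "c \<odot>\<^bsub>B\<^esub> x \<in> \<phi> ` carr A"
      using ab by (intro image_eqI[of _ _ "c \<odot>\<^bsub>A\<^esub> a"]) (simp_all add: hom_scale)
    show "x\<^sup>\<star>\<^bsub>B\<^esub> \<in> \<phi> ` carr A"
      using ab by (intro image_eqI[of _ _ "a\<^sup>\<star>\<^bsub>A\<^esub>"]) (simp_all add: hom_star)
  qed
  show ?thesis
    unfolding cstar_subalgebra_def
  proof (intro conjI allI impI ballI)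
    show "\<phi> ` carr A \<subseteq> carr B" by auto
    show "\<zero>\<^bsub>B\<^esub> \<in> \<phi> ` carr A" using hom_zero A.zero_closed by (metis image_eqI)
  next
    fix X x
    assume "(\<forall>n. X n \<in> \<phi> ` carr A) \<and> x \<in> carr B \<and> (\<lambda>n. anorm B (X n \<ominus>\<^bsub>B\<^esub> x)) \<longlonglongrightarrow> 0"
    then show "x \<in> \<phi> ` carr A" by (elim conjE) (rule lim)
  qed (rule ops; assumption)+
qed

end

section \<open>C*-subalgebras\<close>
lemma cstar_subalgebraD:
  assumes "cstar_subalgebra B D"
  shows "x \<in> D \<Longrightarrow> x \<in> carr B" "\<zero>\<^bsub>B\<^esub> \<in> D" "\<lbrakk>x \<in> D; y \<in> D\<rbrakk> \<Longrightarrow> x \<oplus>\<^bsub>B\<^esub> y \<in> D"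
    "x \<in> D \<Longrightarrow> c \<odot>\<^bsub>B\<^esub> x \<in> D" "\<lbrakk>x \<in> D; y \<in> D\<rbrakk> \<Longrightarrow> x \<otimes>\<^bsub>B\<^esub> y \<in> D" "x \<in> D \<Longrightarrow> x\<^sup>\<star>\<^bsub>B\<^esub> \<in> D"
    "\<lbrakk>\<And>n::nat. X n \<in> D; x \<in> carr B; (\<lambda>n. anorm B (X n \<ominus>\<^bsub>B\<^esub> x)) \<longlonglongrightarrow> 0\<rbrakk> \<Longrightarrow> x \<in> D"
  using assms unfolding cstar_subalgebra_def by blast+

lemma cstar_algebra_subalgebra:
  assumes "cstar_algebra B" and D: "cstar_subalgebra B D"
  shows "cstar_algebra (B\<lparr>carr := D\<rparr>)"
proof -
  interpret cstar_algebra B by fact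
  note sub = cstar_subalgebraD(1)[OF D]
  have diff: "x \<ominus>\<^bsub>B\<lparr>carr := D\<rparr>\<^esub> y = x \<ominus>\<^bsub>B\<^esub> y" for x y by (simp add: adiff_def)
  show ?thesis
    \<comment> \<open>Cases 23 and 28 are definiteness and completeness of the norm.\<close>
  proof (unfold_locales, goal_cases)
    case (28 X)
    then obtain x where x: "x \<in> carr B" "(\<lambda>n. anorm B (X n \<ominus>\<^bsub>B\<^esub> x)) \<longlonglongrightarrow> 0"
      using complete[of X] by (auto simp: diff sub)
    moreover have "x \<in> D" using cstar_subalgebraD(7)[OF D _ x] 28(1) by simp
    ultimately show ?case by (auto simp: diff)
  next
    case (23 x) then show ?case using norm_definite sub by simp
  qed (simp_all add: cstar_subalgebraD(2-6)[OF D] sub scale_add_left scale_scale scale_one mult_scale_left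
      mult_scale_right scale_add_right star_star star_scale star_add star_mult add_neg add_zero
      mult_add_left mult_add_right mult_assoc add_assoc norm_scale cstar_identity norm_triangle
      norm_mult_le add_commute add_left_commute)
qed

lemma cstar_subalgebra_generated:
  assumes "cstar_algebra B"
  shows "cstar_subalgebra B (carr (cstar_generated B S))"
proof -
  interpret cstar_algebra B by fact
  show ?thesis
    unfolding cstar_subalgebra_def
  proof (intro conjI allI impI ballI)
    fix X x assume X: "(\<forall>n::nat. X n \<in> carr (cstar_generated B S)) \<and> x \<in> carr B \<and>
      (\<lambda>n. anorm B (X n \<ominus>\<^bsub>B\<^esub> x)) \<longlonglongrightarrow> 0"
    have "x \<in> D" if "cstar_subalgebra B D" "S \<subseteq> D" for D
    proof -
      have "\<forall>n. X n \<in> D" using X that by (simp add: cstar_generated_def)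
      then show ?thesis using X that(1) unfolding cstar_subalgebra_def by blast
    qed
    then show "x \<in> carr (cstar_generated B S)" using X by (simp add: cstar_generated_def)
  qed (simp_all add: cstar_generated_def cstar_subalgebraD subset_iff)
qed

lemma cstar_algebra_generated: "cstar_algebra B \<Longrightarrow> cstar_algebra (cstar_generated B S)"
  using cstar_algebra_subalgebra[OF _ cstar_subalgebra_generated]
  by (simp add: cstar_generated_def)

lemma generated_subset: "S \<subseteq> carr B \<Longrightarrow> S \<subseteq> carr (cstar_generated B S)"
  by (auto simp: cstar_generated_def)

lemma generated_minimal: "cstar_subalgebra B D \<Longrightarrow> S \<subseteq> D \<Longrightarrow> carr (cstar_generated B S) \<subseteq> D"
  by (auto simp: cstar_generated_def)

section \<open>Joins of projections in the bidual\<close>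
inductive_set left_ideal :: "'a cstar_alg \<Rightarrow> 'a set \<Rightarrow> 'a set" for B P where
  left_ideal_zero: "\<zero>\<^bsub>B\<^esub> \<in> left_ideal B P"
| left_ideal_base: "p \<in> P \<Longrightarrow> p \<in> left_ideal B P"
| left_ideal_add: "\<lbrakk>x \<in> left_ideal B P; y \<in> left_ideal B P\<rbrakk> \<Longrightarrow> x \<oplus>\<^bsub>B\<^esub> y \<in> left_ideal B P"
| left_ideal_scale: "x \<in> left_ideal B P \<Longrightarrow> c \<odot>\<^bsub>B\<^esub> x \<in> left_ideal B P"
| left_ideal_mult: "\<lbrakk>a \<in> carr B; x \<in> left_ideal B P\<rbrakk> \<Longrightarrow> a \<otimes>\<^bsub>B\<^esub> x \<in> left_ideal B P"

context cstar_algebra begin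

lemma dual_add: "\<lbrakk>f \<in> dual B; x \<in> carr B; y \<in> carr B\<rbrakk> \<Longrightarrow> f (x \<oplus> y) = f x + f y"
  and dual_scale: "\<lbrakk>f \<in> dual B; x \<in> carr B\<rbrakk> \<Longrightarrow> f (c \<odot> x) = c * f x"
  by (auto simp: dual_def)

lemma dual_zero: "f \<in> dual B \<Longrightarrow> f \<zero> = 0"
  using dual_scale[of f \<zero> 0] by simp

lemma dual_norm_bdd:
  assumes "f \<in> dual B" shows "bdd_above ((\<lambda>x. cmod (f x)) ` {x \<in> carr B. anorm B x \<le> 1})"
proof -
  obtain K where K: "\<And>x. x \<in> carr B \<Longrightarrow> cmod (f x) \<le> K * anorm B x"
    using assms unfolding dual_def by blast
  have "cmod (f x) \<le> \<bar>K\<bar>" if "x \<in> carr B" "anorm B x \<le> 1" for x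
  proof -
    have "K * anorm B x \<le> \<bar>K\<bar> * 1"
      using that by (intro mult_mono) auto
    then show ?thesis using K[OF that(1)] by simp
  qed
  then show ?thesis by (intro bdd_aboveI2) auto
qed

lemma dual_norm_nonneg: assumes "f \<in> dual B" shows "0 \<le> dual_norm B f"
  unfolding dual_norm_def
  using cSUP_upper2[OF dual_norm_bdd[OF assms], of \<zero> 0] by simp

lemma dual_norm_bound:
  assumes f: "f \<in> dual B" and x: "x \<in> carr B"
  shows "cmod (f x) \<le> dual_norm B f * anorm B x"
proof (cases "anorm B x = 0")
  case True
  then show ?thesis using norm_definite[OF x] dual_zero[OF f] by simp
next
  case False
  with x have pos: "0 < anorm B x" by (simp add: less_le)
  let ?z = "complex_of_real (1 / anorm B x) \<odot> x"
  have "cmod (f ?z) \<le> dual_norm B f"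
    unfolding dual_norm_def using x pos
    by (intro cSUP_upper dual_norm_bdd f) (simp add: norm_scale norm_divide)
  then show ?thesis using f x pos by (simp add: dual_scale norm_mult norm_divide field_simps)
qed

lemma dual_normI:
  assumes "\<And>x. x \<in> carr B \<Longrightarrow> cmod (f x) \<le> K * anorm B x" "0 \<le> K"
  shows "dual_norm B f \<le> K"
  unfolding dual_norm_def
proof (rule cSUP_least)
  show "{x \<in> carr B. anorm B x \<le> 1} \<noteq> {}" using zero_closed by force
  fix x assume x: "x \<in> {x \<in> carr B. anorm B x \<le> 1}"
  then have "K * anorm B x \<le> K * 1" using assms(2) by (intro mult_left_mono) auto
  then show "cmod (f x) \<le> K" using assms(1)[of x] x by auto
qed

lemma dualI:
  assumes "\<And>x y. \<lbrakk>x \<in> carr B; y \<in> carr B\<rbrakk> \<Longrightarrow> f (x \<oplus> y) = f x + f y"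
    "\<And>c x. x \<in> carr B \<Longrightarrow> f (c \<odot> x) = c * f x"
    "\<And>x. x \<in> carr B \<Longrightarrow> cmod (f x) \<le> K * anorm B x"
  shows "restrict f (carr B) \<in> dual B"
proof -
  have "\<exists>K. \<forall>x\<in>carr B. cmod (f x) \<le> K * anorm B x" using assms(3) by blast
  with assms(1,2) show ?thesis by (simp add: dual_def)
qed

text \<open>The functional \<open>f \<cdot> a\<close> from which the Arens product is built.\<close>
definition shift :: "('a \<Rightarrow> complex) \<Rightarrow> 'a \<Rightarrow> 'a \<Rightarrow> complex" where
  "shift f a = (\<lambda>b\<in>carr B. f (a \<otimes> b))"

lemma shift_bound:
  assumes "f \<in> dual B" "a \<in> carr B" "b \<in> carr B"
  shows "cmod (f (a \<otimes> b)) \<le> dual_norm B f * anorm B a * anorm B b"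
proof -
  have "dual_norm B f * anorm B (a \<otimes> b) \<le> dual_norm B f * (anorm B a * anorm B b)"
    using assms by (intro mult_left_mono norm_mult_le dual_norm_nonneg)
  then show ?thesis using dual_norm_bound[OF assms(1), of "a \<otimes> b"] assms by (simp add: mult.assoc)
qed

lemma shift_dual: assumes "f \<in> dual B" "a \<in> carr B" shows "shift f a \<in> dual B"
  unfolding shift_def using assms shift_bound[OF assms]
  by (intro dualI) (auto simp: mult_add_right mult_scale_right dual_add dual_scale)

lemma shift_norm: assumes "f \<in> dual B" "a \<in> carr B"
  shows "dual_norm B (shift f a) \<le> dual_norm B f * anorm B a"
  using assms shift_bound[OF assms]
  by (intro dual_normI) (auto simp: shift_def dual_norm_nonneg)

lemma bidualD:
  assumes "E \<in> carr (bidual B)"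
  shows "\<lbrakk>f \<in> dual B; g \<in> dual B\<rbrakk> \<Longrightarrow> E (\<lambda>x\<in>carr B. f x + g x) = E f + E g"
    and "f \<in> dual B \<Longrightarrow> E (\<lambda>x\<in>carr B. c * f x) = c * E f"
    and "\<exists>K. \<forall>f\<in>dual B. cmod (E f) \<le> K * dual_norm B f"
  using assms by (auto simp: bidual_def)

lemma bidual_shift_add:
  assumes "E \<in> carr (bidual B)" "f \<in> dual B" "a \<in> carr B" "a' \<in> carr B"
  shows "E (shift f (a \<oplus> a')) = E (shift f a) + E (shift f a')"
proof -
  have "shift f (a \<oplus> a') = (\<lambda>x\<in>carr B. shift f a x + shift f a' x)"
    using assms by (auto simp: shift_def mult_add_left dual_add fun_eq_iff)
  then show ?thesis using bidualD(1)[OF assms(1) shift_dual shift_dual] assms by simp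
qed

lemma bidual_shift_scale:
  assumes "E \<in> carr (bidual B)" "f \<in> dual B" "a \<in> carr B"
  shows "E (shift f (c \<odot> a)) = c * E (shift f a)"
proof -
  have "shift f (c \<odot> a) = (\<lambda>x\<in>carr B. c * shift f a x)"
    using assms by (auto simp: shift_def mult_scale_left dual_scale fun_eq_iff)
  then show ?thesis using bidualD(2)[OF assms(1) shift_dual] assms by simp
qed

lemma bidual_shift_dual:
  assumes E: "E \<in> carr (bidual B)" and f: "f \<in> dual B"
  shows "(\<lambda>a\<in>carr B. E (shift f a)) \<in> dual B"
proof -
  obtain K where K: "\<And>g. g \<in> dual B \<Longrightarrow> cmod (E g) \<le> K * dual_norm B g"
    using bidualD(3)[OF E] by auto
  have "cmod (E (shift f a)) \<le> (\<bar>K\<bar> * dual_norm B f) * anorm B a" if a: "a \<in> carr B" for a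
  proof -
    have "cmod (E (shift f a)) \<le> K * dual_norm B (shift f a)" using K shift_dual f a by blast
    also have "\<dots> \<le> \<bar>K\<bar> * (dual_norm B f * anorm B a)"
      using shift_norm[OF f a] dual_norm_nonneg[OF shift_dual[OF f a]] by (intro mult_mono) auto
    finally show ?thesis by (simp add: mult.assoc)
  qed
  then show ?thesis
    using assms by (intro dualI) (auto simp: bidual_shift_add bidual_shift_scale)
qed

lemma to_bidual_closed: assumes x: "x \<in> carr B" shows "to_bidual B x \<in> carr (bidual B)"
proof -
  have "(\<lambda>x\<in>carr B. f x + g x) \<in> dual B" if "f \<in> dual B" "g \<in> dual B" for f g
  proof (rule dualI)
    show "cmod (f y + g y) \<le> (dual_norm B f + dual_norm B g) * anorm B y" if "y \<in> carr B" for y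
      using dual_norm_bound[OF \<open>f \<in> dual B\<close> that] dual_norm_bound[OF \<open>g \<in> dual B\<close> that]
      by (intro order_trans[OF norm_triangle_ineq]) (simp add: distrib_right)
  qed (use that in \<open>auto simp: dual_add dual_scale algebra_simps\<close>)
  moreover have "(\<lambda>x\<in>carr B. c * f x) \<in> dual B" if "f \<in> dual B" for f c
  proof (rule dualI)
    show "cmod (c * f y) \<le> (cmod c * dual_norm B f) * anorm B y" if "y \<in> carr B" for y
      using dual_norm_bound[OF \<open>f \<in> dual B\<close> that] by (simp add: norm_mult mult_left_mono mult.assoc)
  qed (use that in \<open>auto simp: dual_add dual_scale algebra_simps\<close>)
  moreover
  have "cmod (f x) \<le> anorm B x * dual_norm B f" if "f \<in> dual B" for f
    using dual_norm_bound[OF that x] by (simp add: mult.commute)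
  then have "\<exists>K. \<forall>f\<in>dual B. cmod (f x) \<le> K * dual_norm B f" by blast
  ultimately show ?thesis using x by (simp add: bidual_def to_bidual_def)
qed

text \<open>When the left factor comes from the algebra, the Arens product involves a single shift.\<close>
lemma to_bidual_mult:
  assumes x: "x \<in> carr B" and E: "E \<in> carr (bidual B)"
  shows "to_bidual B x \<otimes>\<^bsub>bidual B\<^esub> E = (\<lambda>f\<in>dual B. E (shift f x))"
proof -
  have "to_bidual B x \<otimes>\<^bsub>bidual B\<^esub> E = (\<lambda>f\<in>dual B. to_bidual B x (\<lambda>a\<in>carr B. E (shift f a)))"
    by (simp add: bidual_def shift_def)
  also have "\<dots> = (\<lambda>f\<in>dual B. E (shift f x))"
    using bidual_shift_dual[OF E] x by (auto simp: to_bidual_def fun_eq_iff)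
  finally show ?thesis .
qed

lemma to_bidual_mult_to_bidual:
  assumes "x \<in> carr B" "y \<in> carr B"
  shows "to_bidual B x \<otimes>\<^bsub>bidual B\<^esub> to_bidual B y = to_bidual B (x \<otimes> y)"
proof -
  have "to_bidual B x \<otimes>\<^bsub>bidual B\<^esub> to_bidual B y = (\<lambda>f\<in>dual B. to_bidual B y (shift f x))"
    using assms by (simp add: to_bidual_mult to_bidual_closed)
  also have "\<dots> = to_bidual B (x \<otimes> y)"
    using assms shift_dual by (auto simp: to_bidual_def shift_def fun_eq_iff)
  finally show ?thesis .
qed

lemma to_bidual_star:
  assumes x: "x \<in> carr B"
  shows "(to_bidual B x)\<^sup>\<star>\<^bsub>bidual B\<^esub> = to_bidual B (x\<^sup>\<star>)"
proof -
  have "(\<lambda>a\<in>carr B. cnj (f (a\<^sup>\<star>))) \<in> dual B" if f: "f \<in> dual B" for f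
  proof (rule dualI)
    show "cmod (cnj (f (y\<^sup>\<star>))) \<le> dual_norm B f * anorm B y" if "y \<in> carr B" for y
      using dual_norm_bound[OF f, of "y\<^sup>\<star>"] that by (simp add: norm_star)
  qed (use f in \<open>auto simp: dual_add dual_scale star_add star_scale\<close>)
  then show ?thesis using x by (auto simp: bidual_def to_bidual_def fun_eq_iff)
qed

text \<open>\<open>x e = x\<close> means \<open>e (f \<cdot> x) = f x\<close> for all functionals \<open>f\<close>. This condition is linear in \<open>x\<close>, and
  replacing \<open>f\<close> by \<open>f \<cdot> a\<close> gives it for \<open>a x\<close>.\<close>
lemma left_ideal_absorbed:
  assumes e: "e \<in> carr (bidual B)" and P: "P \<subseteq> carr B"
    and absorb: "\<And>p. p \<in> P \<Longrightarrow> to_bidual B p \<otimes>\<^bsub>bidual B\<^esub> e = to_bidual B p"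
    and x: "x \<in> left_ideal B P"
  shows "to_bidual B x \<otimes>\<^bsub>bidual B\<^esub> e = to_bidual B x"
proof -
  have iff: "to_bidual B y \<otimes>\<^bsub>bidual B\<^esub> e = to_bidual B y \<longleftrightarrow> (\<forall>f\<in>dual B. e (shift f y) = f y)"
    if "y \<in> carr B" for y
    unfolding to_bidual_mult[OF that e] unfolding to_bidual_def
    by (metis (no_types, lifting) restrict_apply' restrict_ext)
  from x have "x \<in> carr B \<and> (\<forall>f\<in>dual B. e (shift f x) = f x)"
  proof induction
    case left_ideal_zero
    have "e (shift f \<zero>) = f \<zero>" if f: "f \<in> dual B" for f
      using bidual_shift_scale[OF e f zero_closed, of 0] dual_zero[OF f] by simp
    then show ?case by simp
  next
    case (left_ideal_base p)
    then have p: "p \<in> carr B" using P by auto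
    with iff[OF p, THEN iffD1, OF absorb[OF left_ideal_base]] show ?case by (rule conjI[rotated])
  next
    case (left_ideal_mult a x)
    have "e (shift f (a \<otimes> x)) = f (a \<otimes> x)" if f: "f \<in> dual B" for f
    proof -
      have "shift f (a \<otimes> x) = shift (shift f a) x"
        using left_ideal_mult by (auto simp: shift_def mult_assoc fun_eq_iff)
      then have "e (shift f (a \<otimes> x)) = shift f a x"
        using left_ideal_mult shift_dual[OF f, of a] by simp
      then show ?thesis using left_ideal_mult by (simp add: shift_def)
    qed
    then show ?case using left_ideal_mult by simp
  qed (simp_all add: bidual_shift_add[OF e] bidual_shift_scale[OF e] dual_add dual_scale)
  then show ?thesis using iff[of x, THEN iffD2] by (elim conjE)
qed

text \<open>An upper bound of \<open>P\<close> in the bidual absorbs \<open>P\<close> on the right, hence the left ideal generated by \<open>P\<close>,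
  hence \<open>q\<close>. So \<open>q\<close> is least among all upper bounds in the bidual, not only among those in \<open>B\<close>.\<close>
lemma bidual_join:
  assumes q: "projection B q" and P: "P \<subseteq> carr B" and le: "\<And>p. p \<in> P \<Longrightarrow> p \<otimes> q = p"
    and ideal: "q \<in> left_ideal B P"
  shows "is_proj_join (bidual B) (to_bidual B ` P) (to_bidual B q)"
  unfolding is_proj_join_def
proof (intro conjI ballI allI impI)
  have qc: "q \<in> carr B" using q by (simp add: projection_def)
  show "projection (bidual B) (to_bidual B q)"
    using q by (simp add: projection_def to_bidual_closed to_bidual_mult_to_bidual to_bidual_star)
  show "proj_le (bidual B) p (to_bidual B q)" if "p \<in> to_bidual B ` P" for p
    using that P qc le by (auto simp: proj_le_def to_bidual_mult_to_bidual subset_iff)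
  show "proj_le (bidual B) (to_bidual B q) e"
    if "projection (bidual B) e \<and> (\<forall>p\<in>to_bidual B ` P. proj_le (bidual B) p e)" for e
    unfolding proj_le_def
  proof (rule left_ideal_absorbed[OF _ P _ ideal])
    show "e \<in> carr (bidual B)" using that by (simp add: projection_def)
    show "to_bidual B p \<otimes>\<^bsub>bidual B\<^esub> e = to_bidual B p" if "p \<in> P" for p
      using that \<open>projection (bidual B) e \<and> _\<close> by (auto simp: proj_le_def)
  qed
qed

end

section \<open>The Hilbert space of square summable families\<close>
lemma ell2_outside: "f \<in> ell2 X \<Longrightarrow> x \<notin> X \<Longrightarrow> f x = 0"
  by (simp add: ell2_def)

lemma ell2_norm_nonneg [simp]: "0 \<le> ell2_norm X f"
  by (simp add: ell2_norm_def infsum_nonneg)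

lemma L2_set_le_ell2_norm:
  assumes f: "f \<in> ell2 X" and F: "finite F" "F \<subseteq> X"
  shows "L2_set (\<lambda>x. cmod (f x)) F \<le> ell2_norm X f"
  unfolding L2_set_def ell2_norm_def using assms
  by (intro real_sqrt_le_mono finite_sum_le_infsum) (auto simp: ell2_def)

text \<open>Together with the preceding lemma, this reduces inequalities between norms to finite sums.\<close>
lemma ell2I:
  assumes out: "\<And>x. x \<notin> X \<Longrightarrow> f x = 0"
    and le: "\<And>F. finite F \<Longrightarrow> F \<subseteq> X \<Longrightarrow> L2_set (\<lambda>x. cmod (f x)) F \<le> K"
  shows "f \<in> ell2 X" "ell2_norm X f \<le> K"
proof -
  have K: "0 \<le> K" using le[of "{}"] by simp
  have sum: "(\<Sum>x\<in>F. (cmod (f x))\<^sup>2) \<le> K\<^sup>2" if "finite F" "F \<subseteq> X" for F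
    using le[OF that] by (simp add: L2_set_def sqrt_le_D)
  have summ: "(\<lambda>x. (cmod (f x))\<^sup>2) summable_on X"
    using sum by (intro nonneg_bdd_above_summable_on bdd_aboveI2[of _ _ "K\<^sup>2"]) auto
  then show "f \<in> ell2 X" using out by (simp add: ell2_def)
  have "(\<Sum>\<^sub>\<infinity>x\<in>X. (cmod (f x))\<^sup>2) \<le> K\<^sup>2"
    by (rule infsum_le_finite_sums[OF summ sum])
  then show "ell2_norm X f \<le> K"
    unfolding ell2_norm_def using K by (simp add: real_le_lsqrt)
qed

lemma ell2_norm_sq: "(ell2_norm X f)\<^sup>2 = (\<Sum>\<^sub>\<infinity>x\<in>X. (cmod (f x))\<^sup>2)"
  by (simp add: ell2_norm_def infsum_nonneg)

lemma cmod_le_ell2_norm: assumes "f \<in> ell2 X" shows "cmod (f x) \<le> ell2_norm X f"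
proof (cases "x \<in> X")
  case True then show ?thesis using L2_set_le_ell2_norm[OF assms, of "{x}"] by simp
qed (use ell2_outside[OF assms] in simp)

lemma ell2_norm_eq_0: assumes "f \<in> ell2 X" "ell2_norm X f = 0" shows "f = (\<lambda>x. 0)"
  using cmod_le_ell2_norm[OF assms(1)] assms(2) by (auto simp: fun_eq_iff)

lemma ell2_zero [simp]: "(\<lambda>x. 0) \<in> ell2 X" and ell2_norm_zero [simp]: "ell2_norm X (\<lambda>x. 0) = 0"
  by (simp_all add: ell2_def ell2_norm_def)

lemma ell2_add:
  assumes "f \<in> ell2 X" "g \<in> ell2 X"
  shows "(\<lambda>x. f x + g x) \<in> ell2 X" "ell2_norm X (\<lambda>x. f x + g x) \<le> ell2_norm X f + ell2_norm X g"
proof -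
  have le: "L2_set (\<lambda>x. cmod (f x + g x)) F \<le> ell2_norm X f + ell2_norm X g" if "finite F" "F \<subseteq> X" for F
  proof -
    have "L2_set (\<lambda>x. cmod (f x + g x)) F \<le> L2_set (\<lambda>x. cmod (f x) + cmod (g x)) F"
      by (intro L2_set_mono norm_triangle_ineq) auto
    also have "\<dots> \<le> L2_set (\<lambda>x. cmod (f x)) F + L2_set (\<lambda>x. cmod (g x)) F"
      by (rule L2_set_triangle_ineq)
    finally show ?thesis
      using L2_set_le_ell2_norm[OF assms(1) that] L2_set_le_ell2_norm[OF assms(2) that] by linarith
  qed
  have out: "f x + g x = 0" if "x \<notin> X" for x using assms that by (simp add: ell2_outside)
  show "(\<lambda>x. f x + g x) \<in> ell2 X" using out le by (rule ell2I(1))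
  show "ell2_norm X (\<lambda>x. f x + g x) \<le> ell2_norm X f + ell2_norm X g"
    using out le by (rule ell2I(2))
qed

lemma ell2_norm_scale: "ell2_norm X (\<lambda>x. c * f x) = cmod c * ell2_norm X f"
  by (simp add: ell2_norm_def norm_mult power_mult_distrib infsum_cmult_right' real_sqrt_mult)

lemma ell2_scale: "f \<in> ell2 X \<Longrightarrow> (\<lambda>x. c * f x) \<in> ell2 X"
  by (auto simp: ell2_def norm_mult power_mult_distrib intro: summable_on_cmult_right)

lemma ell2_diff:
  assumes "f \<in> ell2 X" "g \<in> ell2 X"
  shows "(\<lambda>x. f x - g x) \<in> ell2 X" "ell2_norm X (\<lambda>x. f x - g x) \<le> ell2_norm X f + ell2_norm X g"
  using ell2_add[OF assms(1) ell2_scale[OF assms(2), of "-1"]] ell2_norm_scale[of X "-1" g] by simp_all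

lemma inner_bound:
  assumes f: "f \<in> ell2 X" and g: "g \<in> ell2 X"
  shows inner_summable: "(\<lambda>x. f x * cnj (g x)) summable_on X"
    and "cmod (ell2_inner X f g) \<le> ell2_norm X f * ell2_norm X g"
proof -
  have le: "(\<Sum>x\<in>F. cmod (f x * cnj (g x))) \<le> ell2_norm X f * ell2_norm X g"
    if F: "finite F" "F \<subseteq> X" for F
  proof -
    have "(\<Sum>x\<in>F. cmod (f x * cnj (g x))) \<le> L2_set (\<lambda>x. cmod (f x)) F * L2_set (\<lambda>x. cmod (g x)) F"
      using L2_set_mult_ineq[of "\<lambda>x. cmod (f x)" "\<lambda>x. cmod (g x)" F] by (simp add: norm_mult)
    also have "\<dots> \<le> ell2_norm X f * ell2_norm X g"
      by (intro mult_mono L2_set_le_ell2_norm f g F) auto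
    finally show ?thesis .
  qed
  have abs: "(\<lambda>x. norm (f x * cnj (g x))) summable_on X"
    using le by (intro nonneg_bdd_above_summable_on bdd_aboveI2) auto
  then show "(\<lambda>x. f x * cnj (g x)) summable_on X" by (rule abs_summable_summable)
  show "cmod (ell2_inner X f g) \<le> ell2_norm X f * ell2_norm X g"
    unfolding ell2_inner_def
    using norm_infsum_bound[OF abs] infsum_le_finite_sums[OF abs le] by linarith
qed

lemma inner_add_left:
  "\<lbrakk>f \<in> ell2 X; f' \<in> ell2 X; g \<in> ell2 X\<rbrakk>
    \<Longrightarrow> ell2_inner X (\<lambda>x. f x + f' x) g = ell2_inner X f g + ell2_inner X f' g"
  unfolding ell2_inner_def distrib_right by (intro infsum_add inner_summable)

lemma inner_scale_left: "ell2_inner X (\<lambda>x. c * f x) g = c * ell2_inner X f g"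
  by (simp add: ell2_inner_def mult.assoc infsum_cmult_right')

lemma inner_commute: "ell2_inner X g f = cnj (ell2_inner X f g)"
  by (simp add: ell2_inner_def mult.commute flip: infsum_cnj)

lemma inner_diff_left:
  "\<lbrakk>f \<in> ell2 X; f' \<in> ell2 X; g \<in> ell2 X\<rbrakk>
    \<Longrightarrow> ell2_inner X (\<lambda>x. f x - f' x) g = ell2_inner X f g - ell2_inner X f' g"
  using inner_add_left[of f X "\<lambda>x. (-1) * f' x" g] inner_scale_left[of X "-1" f' g]
  by (simp add: ell2_scale[of f' X "-1", simplified])

lemma inner_self: assumes "f \<in> ell2 X" shows "ell2_inner X f f = of_real ((ell2_norm X f)\<^sup>2)"
proof -
  have "((\<lambda>x. (cmod (f x))\<^sup>2) has_sum (ell2_norm X f)\<^sup>2) X"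
    using assms by (simp add: ell2_norm_sq ell2_def)
  then have "((\<lambda>x. complex_of_real ((cmod (f x))\<^sup>2)) has_sum of_real ((ell2_norm X f)\<^sup>2)) X"
    by (simp only: has_sum_of_real_iff)
  then show ?thesis
    by (simp only: ell2_inner_def complex_norm_square infsumI)
qed

lemma delta_ell2: assumes "y \<in> X" shows "delta y \<in> ell2 X" "ell2_norm X (delta y) \<le> 1"
proof -
  have le: "L2_set (\<lambda>x. cmod (delta y x)) F \<le> 1" if "finite F" for F
  proof -
    have "(\<Sum>x\<in>F. (cmod (delta y x))\<^sup>2) = (\<Sum>x\<in>F. if x = y then 1 else 0)"
      by (intro sum.cong) (auto simp: delta_def)
    also have "\<dots> \<le> 1" using that by simp
    finally show ?thesis by (simp add: L2_set_def)
  qed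
  have out: "delta y x = 0" if "x \<notin> X" for x using assms that by (auto simp: delta_def)
  show "delta y \<in> ell2 X" using out le by (rule ell2I(1))
  show "ell2_norm X (delta y) \<le> 1" using out le by (rule ell2I(2))
qed

lemma infsum_single:
  fixes h :: "'c \<Rightarrow> complex"
  assumes "y \<in> X" "\<And>x. x \<in> X \<Longrightarrow> x \<noteq> y \<Longrightarrow> h x = 0" shows "infsum h X = h y"
  using infsum_cong_neutral[of "{y}" X h h] assms by auto

lemma inner_delta: "y \<in> X \<Longrightarrow> ell2_inner X f (delta y) = f y"
  unfolding ell2_inner_def by (subst infsum_single[of y]) (auto simp: delta_def)

definition cutoff :: "'c set \<Rightarrow> ('c \<Rightarrow> complex) \<Rightarrow> 'c \<Rightarrow> complex" where
  "cutoff F f = (\<lambda>x. if x \<in> F then f x else 0)"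

lemma cutoff_empty: "cutoff {} f = (\<lambda>x. 0)"
  by (simp add: cutoff_def)

lemma cutoff_insert: "x \<notin> F \<Longrightarrow> cutoff (insert x F) f = (\<lambda>y. f x * delta x y + cutoff F f y)"
  by (auto simp: cutoff_def delta_def fun_eq_iff)

lemma cutoff_ell2:
  assumes F: "finite F" "F \<subseteq> X"
  shows "cutoff F f \<in> ell2 X" "ell2_norm X (cutoff F f) = L2_set (\<lambda>x. cmod (f x)) F"
proof -
  show "cutoff F f \<in> ell2 X"
    using F by (induction F) (auto simp: cutoff_empty cutoff_insert intro!: ell2_add ell2_scale delta_ell2)
  have "(\<Sum>\<^sub>\<infinity>x\<in>X. (cmod (cutoff F f x))\<^sup>2) = (\<Sum>\<^sub>\<infinity>x\<in>F. (cmod (f x))\<^sup>2)"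
    using F by (intro infsum_cong_neutral) (auto simp: cutoff_def)
  then show "ell2_norm X (cutoff F f) = L2_set (\<lambda>x. cmod (f x)) F"
    using F by (simp add: ell2_norm_def L2_set_def)
qed

lemma inner_cutoff:
  assumes "finite F" "F \<subseteq> X" shows "ell2_inner X (cutoff F f) g = (\<Sum>x\<in>F. f x * cnj (g x))"
proof -
  have "ell2_inner X (cutoff F f) g = (\<Sum>\<^sub>\<infinity>x\<in>F. f x * cnj (g x))"
    unfolding ell2_inner_def using assms by (intro infsum_cong_neutral) (auto simp: cutoff_def)
  then show ?thesis using assms by simp
qed

lemma cutoff_dense:
  assumes f: "f \<in> ell2 X" and e: "0 < e"
  shows "\<exists>F. finite F \<and> F \<subseteq> X \<and> ell2_norm X (\<lambda>x. f x - cutoff F f x) \<le> e"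
proof -
  let ?h = "\<lambda>x. (cmod (f x))\<^sup>2"
  have summ: "?h summable_on X" using f by (simp add: ell2_def)
  obtain F where F: "finite F" "F \<subseteq> X" "dist (sum ?h F) (infsum ?h X) \<le> e\<^sup>2"
    using infsum_finite_approximation[OF summ, of "e\<^sup>2"] e by auto
  have "(ell2_norm X (\<lambda>x. f x - cutoff F f x))\<^sup>2 = (\<Sum>\<^sub>\<infinity>x\<in>X - F. ?h x)"
    unfolding ell2_norm_sq by (intro infsum_cong_neutral) (auto simp: cutoff_def)
  also have "\<dots> = infsum ?h X - sum ?h F"
  proof -
    have "infsum ?h (F \<union> (X - F)) = infsum ?h F + infsum ?h (X - F)"
    proof (rule infsum_Un_disjoint)
      show "?h summable_on F" using F by simp
      show "?h summable_on (X - F)" using summ F(1) by (rule summable_on_cofin_subset)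
    qed auto
    moreover have "F \<union> (X - F) = X" using F by auto
    ultimately show ?thesis using F by simp
  qed
  also have "\<dots> \<le> e\<^sup>2" using F(3) by (simp add: dist_real_def)
  finally have "ell2_norm X (\<lambda>x. f x - cutoff F f x) \<le> e"
    by (rule power2_le_imp_le[OF _ less_imp_le[OF e]])
  with F show ?thesis by blast
qed

section \<open>Bounded operators and their adjoints\<close>
lemma bounded_opsD:
  assumes "S \<in> bounded_ops X"
  shows "f \<in> ell2 X \<Longrightarrow> S f \<in> ell2 X"
    and "\<lbrakk>f \<in> ell2 X; g \<in> ell2 X\<rbrakk> \<Longrightarrow> S (\<lambda>x. f x + g x) = (\<lambda>x. S f x + S g x)"
    and "f \<in> ell2 X \<Longrightarrow> S (\<lambda>x. c * f x) = (\<lambda>x. c * S f x)"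
    and "f \<notin> ell2 X \<Longrightarrow> S f = undefined"
proof -
  have ops: "S \<in> ell2 X \<rightarrow>\<^sub>E ell2 X"
    "\<forall>f\<in>ell2 X. \<forall>g\<in>ell2 X. S (\<lambda>x. f x + g x) = (\<lambda>x. S f x + S g x)"
    "\<forall>c. \<forall>f\<in>ell2 X. S (\<lambda>x. c * f x) = (\<lambda>x. c * S f x)"
    using assms unfolding bounded_ops_def by blast+
  show "f \<in> ell2 X \<Longrightarrow> S f \<in> ell2 X" using ops(1) by (rule PiE_mem)
  show "f \<notin> ell2 X \<Longrightarrow> S f = undefined" using ops(1) by (rule PiE_arb)
  show "\<lbrakk>f \<in> ell2 X; g \<in> ell2 X\<rbrakk> \<Longrightarrow> S (\<lambda>x. f x + g x) = (\<lambda>x. S f x + S g x)"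
    using ops(2) by (elim ballE) auto
  show "f \<in> ell2 X \<Longrightarrow> S (\<lambda>x. c * f x) = (\<lambda>x. c * S f x)"
    using ops(3) by (elim allE ballE) auto
qed

lemma bounded_ops_bound:
  assumes "S \<in> bounded_ops X"
  obtains K where "0 \<le> K" "\<And>f. f \<in> ell2 X \<Longrightarrow> ell2_norm X (S f) \<le> K * ell2_norm X f"
proof -
  obtain K where K: "\<And>f. f \<in> ell2 X \<Longrightarrow> ell2_norm X (S f) \<le> K * ell2_norm X f"
    using assms unfolding bounded_ops_def by blast
  show ?thesis
  proof (rule that)
    show "0 \<le> \<bar>K\<bar>" by simp
    show "ell2_norm X (S f) \<le> \<bar>K\<bar> * ell2_norm X f" if "f \<in> ell2 X" for f
      by (rule order_trans[OF K[OF that]]) (intro mult_right_mono abs_ge_self ell2_norm_nonneg)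
  qed
qed

lemma bounded_opsI:
  assumes "\<And>f. f \<in> ell2 X \<Longrightarrow> S f \<in> ell2 X"
    and "\<And>f g. \<lbrakk>f \<in> ell2 X; g \<in> ell2 X\<rbrakk> \<Longrightarrow> S (\<lambda>x. f x + g x) = (\<lambda>x. S f x + S g x)"
    and "\<And>c f. f \<in> ell2 X \<Longrightarrow> S (\<lambda>x. c * f x) = (\<lambda>x. c * S f x)"
    and K: "\<And>f. f \<in> ell2 X \<Longrightarrow> ell2_norm X (S f) \<le> K * ell2_norm X f"
  shows "restrict S (ell2 X) \<in> bounded_ops X"
proof -
  have "\<exists>K. \<forall>f\<in>ell2 X. ell2_norm X (restrict S (ell2 X) f) \<le> K * ell2_norm X f"
    by (rule exI[of _ K]) (simp add: K)
  with assms(1-3) show ?thesis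
    by (simp add: bounded_ops_def ell2_add ell2_scale)
qed

lemma bounded_ops_ext:
  assumes "S \<in> bounded_ops X" "R \<in> bounded_ops X" "\<And>f. f \<in> ell2 X \<Longrightarrow> S f = R f"
  shows "S = R"
proof (rule ext)
  fix f show "S f = R f"
    using assms bounded_opsD(4)[of _ X f] by (cases "f \<in> ell2 X") auto
qed

lemma bounded_ops_diff:
  assumes S: "S \<in> bounded_ops X" and "f \<in> ell2 X" "g \<in> ell2 X"
  shows "S (\<lambda>x. f x - g x) = (\<lambda>x. S f x - S g x)"
  using bounded_opsD(2)[OF S assms(2) ell2_scale[OF assms(3), of "-1"]] bounded_opsD(3)[OF S assms(3), of "-1"]
  by simp

lemma bounded_ops_zero: "S \<in> bounded_ops X \<Longrightarrow> S (\<lambda>x. 0) = (\<lambda>x. 0)"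
  using bounded_opsD(3)[of S X "\<lambda>x. 0" 0] by simp

definition op_norm :: "'c set \<Rightarrow> (('c \<Rightarrow> complex) \<Rightarrow> ('c \<Rightarrow> complex)) \<Rightarrow> real" where
  "op_norm X S = (SUP f\<in>{f \<in> ell2 X. ell2_norm X f \<le> 1}. ell2_norm X (S f))"

lemma op_norm_bdd:
  assumes "S \<in> bounded_ops X"
  shows "bdd_above ((\<lambda>f. ell2_norm X (S f)) ` {f \<in> ell2 X. ell2_norm X f \<le> 1})"
proof -
  obtain K where K: "0 \<le> K" "\<And>f. f \<in> ell2 X \<Longrightarrow> ell2_norm X (S f) \<le> K * ell2_norm X f"
    using bounded_ops_bound[OF assms] by metis
  have "ell2_norm X (S f) \<le> K" if "f \<in> ell2 X" "ell2_norm X f \<le> 1" for f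
    using K(2)[OF that(1)] mult_left_mono[OF that(2) K(1)] by simp
  then show ?thesis by (intro bdd_aboveI2) auto
qed

lemma op_norm_nonneg: assumes "S \<in> bounded_ops X" shows "0 \<le> op_norm X S"
  unfolding op_norm_def by (rule cSUP_upper2[OF op_norm_bdd[OF assms], of "\<lambda>x. 0"]) auto

lemma op_norm_bound:
  assumes S: "S \<in> bounded_ops X" and f: "f \<in> ell2 X"
  shows "ell2_norm X (S f) \<le> op_norm X S * ell2_norm X f"
proof (cases "ell2_norm X f = 0")
  case True
  then have "S f = (\<lambda>x. 0)" using ell2_norm_eq_0[OF f] bounded_ops_zero[OF S] by simp
  then show ?thesis using True by simp
next
  case False
  then have pos: "0 < ell2_norm X f" by (simp add: less_le)
  let ?c = "complex_of_real (1 / ell2_norm X f)"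
  have "ell2_norm X (S (\<lambda>x. ?c * f x)) \<le> op_norm X S"
    unfolding op_norm_def using f pos
    by (intro cSUP_upper op_norm_bdd S CollectI conjI ell2_scale)
      (simp_all only: ell2_norm_scale, simp_all add: norm_divide)
  then show ?thesis
    using pos unfolding bounded_opsD(3)[OF S f] ell2_norm_scale by (simp add: norm_divide field_simps)
qed

lemma op_normI:
  assumes "\<And>f. f \<in> ell2 X \<Longrightarrow> ell2_norm X (S f) \<le> K * ell2_norm X f" "0 \<le> K"
  shows "op_norm X S \<le> K"
  unfolding op_norm_def
proof (rule cSUP_least)
  show "{f \<in> ell2 X. ell2_norm X f \<le> 1} \<noteq> {}" using ell2_norm_zero[of X] ell2_zero[of X] zero_le_one by (metis (mono_tags, lifting) empty_iff mem_Collect_eq)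
  fix f assume f: "f \<in> {f \<in> ell2 X. ell2_norm X f \<le> 1}"
  then have "K * ell2_norm X f \<le> K * 1" using assms(2) by (intro mult_left_mono) auto
  then show "ell2_norm X (S f) \<le> K" using assms(1)[of f] f by auto
qed

lemma adjoint_on_cutoff:
  assumes S: "S \<in> bounded_ops X" and g: "g \<in> ell2 X" and F: "finite F" "F \<subseteq> X"
  shows "ell2_inner X (S (cutoff F f)) g = (\<Sum>x\<in>F. f x * ell2_inner X (S (delta x)) g)"
  using F
proof (induction F)
  case empty
  then show ?case using bounded_ops_zero[OF S] by (simp add: cutoff_empty ell2_inner_def)
next
  case (insert x F)
  then have d: "delta x \<in> ell2 X" and c: "cutoff F f \<in> ell2 X" by (auto intro: delta_ell2 cutoff_ell2)
  have "S (cutoff (insert x F) f) = (\<lambda>y. f x * S (delta x) y + S (cutoff F f) y)"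
    unfolding cutoff_insert[OF insert(2)]
    using bounded_opsD(2)[OF S ell2_scale[OF d] c] bounded_opsD(3)[OF S d] by simp
  then show ?case
    using insert inner_add_left[OF ell2_scale[OF bounded_opsD(1)[OF S d]] bounded_opsD(1)[OF S c] g]
    by (simp add: inner_scale_left)
qed

text \<open>The coordinates that any adjoint of \<open>S\<close> must have.\<close>
definition adjoint_op :: "'c set \<Rightarrow> (('c \<Rightarrow> complex) \<Rightarrow> ('c \<Rightarrow> complex)) \<Rightarrow> ('c \<Rightarrow> complex) \<Rightarrow> ('c \<Rightarrow> complex)" where
  "adjoint_op X S = (\<lambda>g\<in>ell2 X. \<lambda>x. if x \<in> X then ell2_inner X g (S (delta x)) else 0)"

text \<open>Testing \<open>S\<close> on the finite truncation \<open>f\<close> of \<open>S\<^sup>* g\<close> gives \<open>\<parallel>f\<parallel>\<^sup>2 = \<langle>S f, g\<rangle> \<le> \<parallel>S\<parallel> \<parallel>f\<parallel> \<parallel>g\<parallel>\<close>, so that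
  all truncations have norm at most \<open>\<parallel>S\<parallel> \<parallel>g\<parallel>\<close>.\<close>
lemma adjoint_op_in_ell2:
  assumes S: "S \<in> bounded_ops X" and g: "g \<in> ell2 X"
  shows "adjoint_op X S g \<in> ell2 X" "ell2_norm X (adjoint_op X S g) \<le> op_norm X S * ell2_norm X g"
proof -
  let ?a = "adjoint_op X S g" and ?M = "op_norm X S * ell2_norm X g"
  have le: "L2_set (\<lambda>x. cmod (?a x)) F \<le> ?M" if F: "finite F" "F \<subseteq> X" for F
  proof -
    let ?L = "L2_set (\<lambda>x. cmod (?a x)) F"
    have c: "cutoff F ?a \<in> ell2 X" "ell2_norm X (cutoff F ?a) = ?L"
      by (rule cutoff_ell2[OF F])+
    have "ell2_inner X (S (cutoff F ?a)) g = (\<Sum>x\<in>F. ?a x * cnj (?a x))"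
      unfolding adjoint_on_cutoff[OF S g F]
      using F g inner_commute[of X _ g] by (intro sum.cong) (auto simp: adjoint_op_def)
    also have "\<dots> = of_real (?L\<^sup>2)"
      by (simp add: L2_set_def sum_nonneg flip: complex_norm_square)
    finally have "?L\<^sup>2 = cmod (ell2_inner X (S (cutoff F ?a)) g)"
      by (simp only: norm_of_real) simp
    also have "\<dots> \<le> ell2_norm X (S (cutoff F ?a)) * ell2_norm X g"
      by (rule inner_bound(2)[OF bounded_opsD(1)[OF S c(1)] g])
    also have "\<dots> \<le> (op_norm X S * ?L) * ell2_norm X g"
      using op_norm_bound[OF S c(1)] c(2) by (intro mult_right_mono) auto
    finally have "?L * ?L \<le> ?M * ?L" by (simp add: power2_eq_square mult_ac)
    moreover have "0 \<le> ?M" using op_norm_nonneg[OF S] by simp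
    ultimately show ?thesis
      using L2_set_nonneg[of "\<lambda>x. cmod (?a x)" F] by (cases "?L = 0") auto
  qed
  have out: "?a x = 0" if "x \<notin> X" for x using g that by (simp add: adjoint_op_def)
  show "?a \<in> ell2 X" using out le by (rule ell2I(1))
  show "ell2_norm X ?a \<le> ?M" using out le by (rule ell2I(2))
qed

lemma adjoint_op_bounded: assumes S: "S \<in> bounded_ops X" shows "adjoint_op X S \<in> bounded_ops X"
proof -
  let ?A = "\<lambda>g x. if x \<in> X then ell2_inner X g (S (delta x)) else 0"
  have A: "adjoint_op X S g = ?A g" if "g \<in> ell2 X" for g using that by (simp add: adjoint_op_def)
  have d: "S (delta x) \<in> ell2 X" if "x \<in> X" for x
    using bounded_opsD(1)[OF S delta_ell2(1)[OF that]] .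
  have "restrict ?A (ell2 X) \<in> bounded_ops X"
  proof (rule bounded_opsI)
    show "?A g \<in> ell2 X" "ell2_norm X (?A g) \<le> op_norm X S * ell2_norm X g" if "g \<in> ell2 X" for g
      using adjoint_op_in_ell2[OF S that] by (simp_all only: A[OF that])
    show "?A (\<lambda>x. f x + g x) = (\<lambda>x. ?A f x + ?A g x)" if "f \<in> ell2 X" "g \<in> ell2 X" for f g
      using that d by (auto simp: fun_eq_iff inner_add_left)
    show "?A (\<lambda>x. c * f x) = (\<lambda>x. c * ?A f x)" for c f
      by (auto simp: fun_eq_iff inner_scale_left)
  qed
  then show ?thesis by (simp add: adjoint_op_def)
qed

text \<open>The identity holds for finitely supported \<open>f\<close>. These are dense and both sides are continuous in \<open>f\<close>.\<close>
lemma adjoint_op_inner: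
  assumes S: "S \<in> bounded_ops X" and f: "f \<in> ell2 X" and g: "g \<in> ell2 X"
  shows "ell2_inner X (S f) g = ell2_inner X f (adjoint_op X S g)"
proof -
  let ?a = "adjoint_op X S g" and ?M = "op_norm X S * ell2_norm X g"
  note a = adjoint_op_in_ell2[OF S g]
  have M: "0 \<le> ?M" using op_norm_nonneg[OF S] by simp
  have "cmod (ell2_inner X (S f) g - ell2_inner X f ?a) \<le> e" if "0 < e" for e
  proof -
    define e' where "e' = e / (2 * (?M + 1))"
    have e': "0 < e'" using M that by (simp add: e'_def add_nonneg_pos)
    obtain F where F: "finite F" "F \<subseteq> X" "ell2_norm X (\<lambda>x. f x - cutoff F f x) \<le> e'"
      using cutoff_dense[OF f e'] by blast
    let ?f = "cutoff F f" and ?d = "\<lambda>x. f x - cutoff F f x"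
    have c: "?f \<in> ell2 X" using F by (intro cutoff_ell2)
    have d: "?d \<in> ell2 X" using ell2_diff(1)[OF f c] .
    have "ell2_inner X (S ?f) g = ell2_inner X ?f ?a"
      unfolding adjoint_on_cutoff[OF S g F(1,2)] inner_cutoff[OF F(1,2)]
      using F g inner_commute[of X _ g] by (intro sum.cong) (auto simp: adjoint_op_def)
    then have eq: "ell2_inner X (S f) g - ell2_inner X f ?a = ell2_inner X (S ?d) g - ell2_inner X ?d ?a"
      using bounded_ops_diff[OF S f c] inner_diff_left[OF bounded_opsD(1)[OF S f] bounded_opsD(1)[OF S c] g]
        inner_diff_left[OF f c a(1)] by simp
    have "cmod (ell2_inner X (S f) g - ell2_inner X f ?a)
        \<le> cmod (ell2_inner X (S ?d) g) + cmod (ell2_inner X ?d ?a)"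
      unfolding eq by (rule norm_triangle_ineq4)
    also have "\<dots> \<le> (op_norm X S * ell2_norm X ?d) * ell2_norm X g + ell2_norm X ?d * ?M"
    proof (rule add_mono)
      show "cmod (ell2_inner X (S ?d) g) \<le> (op_norm X S * ell2_norm X ?d) * ell2_norm X g"
        using inner_bound(2)[OF bounded_opsD(1)[OF S d] g]
          mult_right_mono[OF op_norm_bound[OF S d] ell2_norm_nonneg[of X g]] by linarith
      show "cmod (ell2_inner X ?d ?a) \<le> ell2_norm X ?d * ?M"
        using inner_bound(2)[OF d a(1)] mult_left_mono[OF a(2) ell2_norm_nonneg[of X ?d]] by linarith
    qed
    also have "\<dots> = 2 * ?M * ell2_norm X ?d" by simp
    also have "\<dots> \<le> 2 * ?M * e'" using F(3) M by (intro mult_left_mono) auto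
    also have "\<dots> \<le> 2 * (?M + 1) * e'" using e' by (intro mult_right_mono) auto
    also have "\<dots> = e" using M by (simp add: e'_def add_nonneg_eq_0_iff)
    finally show ?thesis .
  qed
  then have "cmod (ell2_inner X (S f) g - ell2_inner X f ?a) \<le> 0"
    by (rule field_le_epsilon) simp
  then show ?thesis by simp
qed

lemma op_adjointI:
  assumes R: "R \<in> bounded_ops X"
    and adj: "\<And>f g. \<lbrakk>f \<in> ell2 X; g \<in> ell2 X\<rbrakk> \<Longrightarrow> ell2_inner X (S f) g = ell2_inner X f (R g)"
  shows "op_adjoint X S = R"
  unfolding op_adjoint_def
proof (rule the_equality)
  show "R \<in> bounded_ops X \<and> (\<forall>f\<in>ell2 X. \<forall>g\<in>ell2 X. ell2_inner X (S f) g = ell2_inner X f (R g))"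
    using R adj by simp
  fix R' assume R': "R' \<in> bounded_ops X \<and>
    (\<forall>f\<in>ell2 X. \<forall>g\<in>ell2 X. ell2_inner X (S f) g = ell2_inner X f (R' g))"
  show "R' = R"
  proof (rule bounded_ops_ext)
    fix g assume g: "g \<in> ell2 X"
    show "R' g = R g"
    proof (rule ext)
      fix x
      show "R' g x = R g x"
      proof (cases "x \<in> X")
        case True
        note d = delta_ell2(1)[OF True]
        have "ell2_inner X (delta x) (R' g) = ell2_inner X (delta x) (R g)"
          using R' adj[OF d g] d g by simp
        then have "ell2_inner X (R' g) (delta x) = ell2_inner X (R g) (delta x)"
          by (simp add: inner_commute[of X "_ g" "delta x"])
        then show ?thesis using True by (simp add: inner_delta)
      next
        case False
        then show ?thesis
          using R R' g bounded_opsD(1) ell2_outside by metis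
      qed
    qed
  qed (use R R' in auto)
qed

lemma op_adjoint_eq_adjoint_op: "S \<in> bounded_ops X \<Longrightarrow> op_adjoint X S = adjoint_op X S"
  by (intro op_adjointI adjoint_op_bounded adjoint_op_inner)

lemma op_adjoint_adjoint:
  assumes "S \<in> bounded_ops X" shows "op_adjoint X (op_adjoint X S) = S"
proof (rule op_adjointI[OF assms])
  fix f g assume fg: "f \<in> ell2 X" "g \<in> ell2 X"
  have "ell2_inner X (S g) f = ell2_inner X g (op_adjoint X S f)"
    using adjoint_op_inner[OF assms fg(2,1)] assms by (simp add: op_adjoint_eq_adjoint_op)
  then show "ell2_inner X (op_adjoint X S f) g = ell2_inner X f (S g)"
    by (metis inner_commute)
qed

text \<open>The explicit formula for the adjoint uses only the values of \<open>S\<close> on basis vectors, and \<open>S\<^sup>*\<^sup>* = S\<close>.\<close>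
lemma bounded_ops_eq_on_delta:
  assumes S: "S \<in> bounded_ops X" and R: "R \<in> bounded_ops X"
    and eq: "\<And>x. x \<in> X \<Longrightarrow> S (delta x) = R (delta x)"
  shows "S = R"
proof -
  have "(\<lambda>x. if x \<in> X then ell2_inner X g (S (delta x)) else 0)
      = (\<lambda>x. if x \<in> X then ell2_inner X g (R (delta x)) else 0)" for g
  proof (rule ext)
    fix x
    show "(if x \<in> X then ell2_inner X g (S (delta x)) else 0)
        = (if x \<in> X then ell2_inner X g (R (delta x)) else 0)"
      by (cases "x \<in> X") (simp_all only: eq if_True if_False)
  qed
  then have "adjoint_op X S = adjoint_op X R" unfolding adjoint_op_def by (simp only:)
  then have "op_adjoint X S = op_adjoint X R"
    by (simp only: op_adjoint_eq_adjoint_op[OF S] op_adjoint_eq_adjoint_op[OF R])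
  then show ?thesis using op_adjoint_adjoint[OF S] op_adjoint_adjoint[OF R] by metis
qed

section \<open>The C*-algebra of bounded operators\<close>
lemma inner_add_right:
  "\<lbrakk>f \<in> ell2 X; g \<in> ell2 X; g' \<in> ell2 X\<rbrakk>
    \<Longrightarrow> ell2_inner X f (\<lambda>x. g x + g' x) = ell2_inner X f g + ell2_inner X f g'"
  by (subst (1 2 3) inner_commute) (simp add: inner_add_left)

lemma inner_scale_right: "ell2_inner X f (\<lambda>x. c * g x) = cnj c * ell2_inner X f g"
  by (subst (1 2) inner_commute) (simp add: inner_scale_left)

lemma bounded_op_algebra_simps:
  "carr (bounded_op_algebra X) = bounded_ops X"
  "(S\<^sup>\<star>\<^bsub>bounded_op_algebra X\<^esub>) = op_adjoint X S"
  "anorm (bounded_op_algebra X) S = op_norm X S"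
  by (simp_all add: bounded_op_algebra_def op_norm_def)

lemma bounded_op_algebra_apply:
  assumes "f \<in> ell2 X"
  shows "\<zero>\<^bsub>bounded_op_algebra X\<^esub> f = (\<lambda>x. 0)"
    "(S \<oplus>\<^bsub>bounded_op_algebra X\<^esub> R) f = (\<lambda>x. S f x + R f x)"
    "(c \<odot>\<^bsub>bounded_op_algebra X\<^esub> S) f = (\<lambda>x. c * S f x)"
    "(S \<ominus>\<^bsub>bounded_op_algebra X\<^esub> R) f = (\<lambda>x. S f x - R f x)"
    "(S \<otimes>\<^bsub>bounded_op_algebra X\<^esub> R) f = S (R f)"
  using assms by (simp_all add: bounded_op_algebra_def adiff_def compose_def)

lemma bounded_ops_zero_op: "\<zero>\<^bsub>bounded_op_algebra X\<^esub> \<in> bounded_ops X"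
proof -
  have "restrict (\<lambda>f x. 0) (ell2 X) \<in> bounded_ops X"
    by (rule bounded_opsI[where K = 0]) auto
  then show ?thesis by (simp add: bounded_op_algebra_def)
qed

lemma bounded_ops_add:
  assumes S: "S \<in> bounded_ops X" and R: "R \<in> bounded_ops X"
  shows "S \<oplus>\<^bsub>bounded_op_algebra X\<^esub> R \<in> bounded_ops X"
proof -
  note SD = bounded_opsD(1-3)[OF S] and RD = bounded_opsD(1-3)[OF R]
  have "restrict (\<lambda>f x. S f x + R f x) (ell2 X) \<in> bounded_ops X"
  proof (rule bounded_opsI)
    show "ell2_norm X (\<lambda>x. S f x + R f x) \<le> (op_norm X S + op_norm X R) * ell2_norm X f"
      if f: "f \<in> ell2 X" for f
      using ell2_add(2)[OF SD(1)[OF f] RD(1)[OF f]] op_norm_bound[OF S f] op_norm_bound[OF R f]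
      by (simp add: distrib_right)
  qed (simp_all add: SD RD ell2_add ring_distribs add_ac)
  then show ?thesis by (simp add: bounded_op_algebra_def)
qed

lemma bounded_ops_scale:
  assumes S: "S \<in> bounded_ops X" shows "c \<odot>\<^bsub>bounded_op_algebra X\<^esub> S \<in> bounded_ops X"
proof -
  have "restrict (\<lambda>f x. c * S f x) (ell2 X) \<in> bounded_ops X"
  proof (rule bounded_opsI)
    show "ell2_norm X (\<lambda>x. c * S f x) \<le> (cmod c * op_norm X S) * ell2_norm X f"
      if f: "f \<in> ell2 X" for f
      using mult_left_mono[OF op_norm_bound[OF S f], of "cmod c"] by (simp add: ell2_norm_scale mult.assoc)
  qed (simp_all add: bounded_opsD(1-3)[OF S] ell2_scale ring_distribs mult_ac)
  then show ?thesis by (simp add: bounded_op_algebra_def)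
qed

lemma bounded_ops_mult:
  assumes S: "S \<in> bounded_ops X" and R: "R \<in> bounded_ops X"
  shows "S \<otimes>\<^bsub>bounded_op_algebra X\<^esub> R \<in> bounded_ops X"
proof -
  have "restrict (\<lambda>f. S (R f)) (ell2 X) \<in> bounded_ops X"
  proof (rule bounded_opsI)
    show "ell2_norm X (S (R f)) \<le> (op_norm X S * op_norm X R) * ell2_norm X f"
      if f: "f \<in> ell2 X" for f
      using op_norm_bound[OF S bounded_opsD(1)[OF R f]]
        mult_left_mono[OF op_norm_bound[OF R f] op_norm_nonneg[OF S]]
      by (simp add: mult.assoc)
  qed (simp_all add: bounded_opsD(1-3)[OF S] bounded_opsD(1-3)[OF R])
  then show ?thesis by (simp add: bounded_op_algebra_def compose_def)
qed

lemma bounded_ops_adjoint: "S \<in> bounded_ops X \<Longrightarrow> op_adjoint X S \<in> bounded_ops X"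
  by (simp add: op_adjoint_eq_adjoint_op adjoint_op_bounded)

lemmas bounded_ops_closed = bounded_ops_zero_op bounded_ops_add bounded_ops_scale bounded_ops_mult
  bounded_ops_adjoint

lemma inner_op_adjoint:
  assumes "S \<in> bounded_ops X" "f \<in> ell2 X" "g \<in> ell2 X"
  shows "ell2_inner X (S f) g = ell2_inner X f (op_adjoint X S g)"
  using adjoint_op_inner[OF assms] by (simp add: op_adjoint_eq_adjoint_op[OF assms(1)])

lemma op_norm_adjoint_le: assumes S: "S \<in> bounded_ops X" shows "op_norm X (op_adjoint X S) \<le> op_norm X S"
  unfolding op_adjoint_eq_adjoint_op[OF S] by (intro op_normI adjoint_op_in_ell2(2) op_norm_nonneg S)

lemma op_norm_mult_le:
  assumes S: "S \<in> bounded_ops X" and R: "R \<in> bounded_ops X"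
  shows "op_norm X (S \<otimes>\<^bsub>bounded_op_algebra X\<^esub> R) \<le> op_norm X S * op_norm X R"
proof (rule op_normI)
  fix f assume f: "f \<in> ell2 X"
  show "ell2_norm X ((S \<otimes>\<^bsub>bounded_op_algebra X\<^esub> R) f) \<le> op_norm X S * op_norm X R * ell2_norm X f"
    using op_norm_bound[OF S bounded_opsD(1)[OF R f]]
      mult_left_mono[OF op_norm_bound[OF R f] op_norm_nonneg[OF S]]
    by (simp add: bounded_op_algebra_apply[OF f] mult.assoc)
qed (simp add: S R op_norm_nonneg)

lemma op_norm_scale_le:
  assumes S: "S \<in> bounded_ops X"
  shows "op_norm X (c \<odot>\<^bsub>bounded_op_algebra X\<^esub> S) \<le> cmod c * op_norm X S"
proof (rule op_normI)
  fix f assume f: "f \<in> ell2 X"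
  show "ell2_norm X ((c \<odot>\<^bsub>bounded_op_algebra X\<^esub> S) f) \<le> cmod c * op_norm X S * ell2_norm X f"
    using mult_left_mono[OF op_norm_bound[OF S f], of "cmod c"]
    by (simp add: bounded_op_algebra_apply[OF f] ell2_norm_scale mult.assoc)
qed (simp add: S op_norm_nonneg)

lemma op_norm_scale:
  assumes S: "S \<in> bounded_ops X"
  shows "op_norm X (c \<odot>\<^bsub>bounded_op_algebra X\<^esub> S) = cmod c * op_norm X S"
proof (rule antisym[OF op_norm_scale_le[OF S]])
  let ?L = "bounded_op_algebra X"
  have cS: "c \<odot>\<^bsub>?L\<^esub> S \<in> bounded_ops X" using bounded_ops_scale[OF S] .
  show "cmod c * op_norm X S \<le> op_norm X (c \<odot>\<^bsub>?L\<^esub> S)"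
  proof (cases "c = 0")
    case False
    have "(1/c) \<odot>\<^bsub>?L\<^esub> (c \<odot>\<^bsub>?L\<^esub> S) = S"
      by (rule bounded_ops_ext[OF bounded_ops_scale[OF cS] S])
        (simp add: bounded_op_algebra_apply False)
    then have "op_norm X S \<le> cmod (1/c) * op_norm X (c \<odot>\<^bsub>?L\<^esub> S)"
      using op_norm_scale_le[OF cS, of "1/c"] by (simp only:)
    then show ?thesis using False by (simp add: norm_divide field_simps)
  qed (use op_norm_nonneg[OF cS] in simp)
qed

lemma op_norm_add_le:
  assumes S: "S \<in> bounded_ops X" and R: "R \<in> bounded_ops X"
  shows "op_norm X (S \<oplus>\<^bsub>bounded_op_algebra X\<^esub> R) \<le> op_norm X S + op_norm X R"
proof (rule op_normI)
  fix f assume f: "f \<in> ell2 X"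
  show "ell2_norm X ((S \<oplus>\<^bsub>bounded_op_algebra X\<^esub> R) f) \<le> (op_norm X S + op_norm X R) * ell2_norm X f"
    using ell2_add(2)[OF bounded_opsD(1)[OF S f] bounded_opsD(1)[OF R f]] op_norm_bound[OF S f]
      op_norm_bound[OF R f] by (simp add: bounded_op_algebra_apply[OF f] distrib_right)
qed (simp add: S R op_norm_nonneg)

lemma op_norm_cstar:
  assumes S: "S \<in> bounded_ops X"
  shows "op_norm X (op_adjoint X S \<otimes>\<^bsub>bounded_op_algebra X\<^esub> S) = (op_norm X S)\<^sup>2"
proof (rule antisym)
  let ?P = "op_adjoint X S \<otimes>\<^bsub>bounded_op_algebra X\<^esub> S"
  have A: "op_adjoint X S \<in> bounded_ops X" using bounded_ops_adjoint[OF S] .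
  have P: "?P \<in> bounded_ops X" using bounded_ops_mult[OF A S] .
  show "op_norm X ?P \<le> (op_norm X S)\<^sup>2"
    using op_norm_mult_le[OF A S] mult_right_mono[OF op_norm_adjoint_le[OF S] op_norm_nonneg[OF S]]
    by (simp add: power2_eq_square)
  have "op_norm X S \<le> sqrt (op_norm X ?P)"
  proof (rule op_normI)
    fix f assume f: "f \<in> ell2 X"
    note Sf = bounded_opsD(1)[OF S f]
    have "(ell2_norm X (S f))\<^sup>2 = cmod (ell2_inner X (S f) (S f))"
      unfolding inner_self[OF Sf] by (simp only: norm_of_real abs_power2)
    also have "\<dots> = cmod (ell2_inner X f (?P f))"
      by (simp add: inner_op_adjoint[OF S f Sf] bounded_op_algebra_apply[OF f])
    also have "\<dots> \<le> ell2_norm X f * ell2_norm X (?P f)"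
      by (rule inner_bound(2)[OF f bounded_opsD(1)[OF P f]])
    also have "\<dots> \<le> ell2_norm X f * (op_norm X ?P * ell2_norm X f)"
      by (intro mult_left_mono op_norm_bound[OF P f]) simp
    also have "\<dots> = (sqrt (op_norm X ?P) * ell2_norm X f)\<^sup>2"
      using op_norm_nonneg[OF P] by (simp add: power_mult_distrib power2_eq_square)
    finally show "ell2_norm X (S f) \<le> sqrt (op_norm X ?P) * ell2_norm X f"
      by (rule power2_le_imp_le) (simp add: op_norm_nonneg[OF P])
  qed (simp add: op_norm_nonneg[OF P])
  then have "(op_norm X S)\<^sup>2 \<le> (sqrt (op_norm X ?P))\<^sup>2"
    by (rule power_mono) (rule op_norm_nonneg[OF S])
  then show "(op_norm X S)\<^sup>2 \<le> op_norm X ?P" using op_norm_nonneg[OF P] by simp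
qed

text \<open>The limit is taken coordinatewise. On every finite set of coordinates the Cauchy estimate survives the
  limit, which by \<open>ell2I\<close> makes the convergence uniform on the unit ball.\<close>
lemma bounded_ops_complete:
  fixes X :: "'c set" and T :: "nat \<Rightarrow> ('c \<Rightarrow> complex) \<Rightarrow> ('c \<Rightarrow> complex)"
  defines "L \<equiv> bounded_op_algebra X"
  assumes T: "\<And>n. T n \<in> bounded_ops X"
    and cauchy: "\<And>e. e > 0 \<Longrightarrow> \<exists>N. \<forall>m\<ge>N. \<forall>n\<ge>N. op_norm X (T m \<ominus>\<^bsub>L\<^esub> T n) < e"
  shows "\<exists>U\<in>bounded_ops X. (\<lambda>n. op_norm X (T n \<ominus>\<^bsub>L\<^esub> U)) \<longlonglongrightarrow> 0"
proof -
  have dT: "T m \<ominus>\<^bsub>L\<^esub> T n \<in> bounded_ops X" for m n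
    unfolding adiff_def L_def by (intro bounded_ops_add bounded_ops_scale T)
  have diff: "ell2_norm X (\<lambda>x. T m f x - T n f x) \<le> op_norm X (T m \<ominus>\<^bsub>L\<^esub> T n) * ell2_norm X f"
    if "f \<in> ell2 X" for f m n
    using op_norm_bound[OF dT that] by (simp add: L_def bounded_op_algebra_apply[OF that])
  have dl: "(\<lambda>x. T m f x - T n f x) \<in> ell2 X" if "f \<in> ell2 X" for f m n
    by (intro ell2_diff(1) bounded_opsD(1)[OF T] that)
  define U where "U f x = lim (\<lambda>n. T n f x)" for f x
  have lim: "(\<lambda>n. T n f x) \<longlonglongrightarrow> U f x" if f: "f \<in> ell2 X" for f x
  proof -
    have "Cauchy (\<lambda>n. T n f x)"
    proof (rule CauchyI)
      fix e :: real assume "0 < e"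
      then have "0 < e / (ell2_norm X f + 1)" by (simp add: add_nonneg_pos)
      then obtain N where N: "\<And>m n. m \<ge> N \<Longrightarrow> n \<ge> N \<Longrightarrow> op_norm X (T m \<ominus>\<^bsub>L\<^esub> T n) < e / (ell2_norm X f + 1)"
        using cauchy by blast
      have "cmod (T m f x - T n f x) < e" if "m \<ge> N" "n \<ge> N" for m n
      proof -
        have "cmod (T m f x - T n f x) \<le> op_norm X (T m \<ominus>\<^bsub>L\<^esub> T n) * ell2_norm X f"
          using cmod_le_ell2_norm[OF dl[OF f, of m n], of x] diff[OF f, of m n] by simp
        also have "\<dots> \<le> op_norm X (T m \<ominus>\<^bsub>L\<^esub> T n) * (ell2_norm X f + 1)"
          using op_norm_nonneg[OF dT] by (intro mult_left_mono) auto
        also have "\<dots> < e / (ell2_norm X f + 1) * (ell2_norm X f + 1)"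
          by (rule mult_strict_right_mono[OF N[OF that]]) (simp add: add_nonneg_pos)
        also have "\<dots> = e"
          using ell2_norm_nonneg[of X f] by (simp add: add_nonneg_eq_0_iff)
        finally show ?thesis .
      qed
      then show "\<exists>M. \<forall>m\<ge>M. \<forall>n\<ge>M. norm (T m f x - T n f x) < e" by blast
    qed
    then show ?thesis unfolding U_def by (simp add: Cauchy_convergent_iff convergent_LIMSEQ_iff)
  qed
  have tail: "(\<lambda>x. T n f x - U f x) \<in> ell2 X" "ell2_norm X (\<lambda>x. T n f x - U f x) \<le> e * ell2_norm X f"
    if f: "f \<in> ell2 X" and N: "\<And>m. m \<ge> N \<Longrightarrow> op_norm X (T n \<ominus>\<^bsub>L\<^esub> T m) \<le> e" for f n N e
  proof -
    have le: "L2_set (\<lambda>x. cmod (T n f x - U f x)) F \<le> e * ell2_norm X f" if F: "finite F" "F \<subseteq> X" for F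
    proof (rule LIMSEQ_le_const2)
      show "(\<lambda>m. L2_set (\<lambda>x. cmod (T n f x - T m f x)) F) \<longlonglongrightarrow> L2_set (\<lambda>x. cmod (T n f x - U f x)) F"
        unfolding L2_set_def by (intro tendsto_intros lim f)
      have "L2_set (\<lambda>x. cmod (T n f x - T m f x)) F \<le> e * ell2_norm X f" if "m \<ge> N" for m
        using L2_set_le_ell2_norm[OF dl[OF f] F, of n m] diff[OF f, of n m]
          mult_right_mono[OF N[OF that] ell2_norm_nonneg[of X f]] by linarith
      then show "\<exists>N. \<forall>m\<ge>N. L2_set (\<lambda>x. cmod (T n f x - T m f x)) F \<le> e * ell2_norm X f" by blast
    qed
    have out: "T n f x - U f x = 0" if "x \<notin> X" for x
      using ell2_outside[OF bounded_opsD(1)[OF T f] that] by (simp add: U_def)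
    show "(\<lambda>x. T n f x - U f x) \<in> ell2 X" using out le by (rule ell2I(1))
    show "ell2_norm X (\<lambda>x. T n f x - U f x) \<le> e * ell2_norm X f" using out le by (rule ell2I(2))
  qed
  obtain N1 where N1: "\<And>m. m \<ge> N1 \<Longrightarrow> op_norm X (T N1 \<ominus>\<^bsub>L\<^esub> T m) \<le> 1"
    using cauchy[of 1] by (metis less_imp_le order_refl zero_less_one)
  have U_eq: "U f = (\<lambda>x. T N1 f x - (T N1 f x - U f x))" for f by simp
  have U_ell2: "U f \<in> ell2 X" if f: "f \<in> ell2 X" for f
    by (subst U_eq) (intro ell2_diff(1) bounded_opsD(1)[OF T] tail(1)[OF f N1] f)
  have U: "restrict U (ell2 X) \<in> bounded_ops X"
  proof (rule bounded_opsI)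
    show "ell2_norm X (U f) \<le> (op_norm X (T N1) + 1) * ell2_norm X f" if f: "f \<in> ell2 X" for f
    proof -
      have "ell2_norm X (U f) \<le> ell2_norm X (T N1 f) + ell2_norm X (\<lambda>x. T N1 f x - U f x)"
        by (subst U_eq) (intro ell2_diff(2) bounded_opsD(1)[OF T] tail(1)[OF f N1] f)
      moreover have "ell2_norm X (\<lambda>x. T N1 f x - U f x) \<le> 1 * ell2_norm X f"
        using f N1 by (rule tail(2))
      ultimately show ?thesis
        using op_norm_bound[OF T f, of N1] by (simp add: distrib_right)
    qed
    show "U (\<lambda>x. f x + g x) = (\<lambda>x. U f x + U g x)" if "f \<in> ell2 X" "g \<in> ell2 X" for f g
    proof
      fix x
      have "(\<lambda>n. T n (\<lambda>x. f x + g x) x) \<longlonglongrightarrow> U f x + U g x"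
        unfolding bounded_opsD(2)[OF T that] by (intro tendsto_add lim that)
      then show "U (\<lambda>x. f x + g x) x = U f x + U g x"
        using LIMSEQ_unique lim[OF ell2_add(1)[OF that]] by blast
    qed
    show "U (\<lambda>x. c * f x) = (\<lambda>x. c * U f x)" if "f \<in> ell2 X" for c f
    proof
      fix x
      have "(\<lambda>n. T n (\<lambda>x. c * f x) x) \<longlonglongrightarrow> c * U f x"
        unfolding bounded_opsD(3)[OF T that] by (intro tendsto_mult_left lim that)
      then show "U (\<lambda>x. c * f x) x = c * U f x"
        using LIMSEQ_unique lim[OF ell2_scale[OF that]] by blast
    qed
  qed (rule U_ell2)
  moreover have "(\<lambda>n. op_norm X (T n \<ominus>\<^bsub>L\<^esub> restrict U (ell2 X))) \<longlonglongrightarrow> 0"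
  proof (rule LIMSEQ_I)
    fix r :: real assume r: "0 < r"
    then obtain N where N: "\<And>m n. m \<ge> N \<Longrightarrow> n \<ge> N \<Longrightarrow> op_norm X (T n \<ominus>\<^bsub>L\<^esub> T m) < r / 2"
      using cauchy[of "r / 2"] by (metis half_gt_zero)
    have "norm (op_norm X (T n \<ominus>\<^bsub>L\<^esub> restrict U (ell2 X)) - 0) < r" if n: "n \<ge> N" for n
    proof -
      have Nn: "op_norm X (T n \<ominus>\<^bsub>L\<^esub> T m) \<le> r / 2" if "m \<ge> N" for m
        using N[OF that n] by simp
      have "op_norm X (T n \<ominus>\<^bsub>L\<^esub> restrict U (ell2 X)) \<le> r / 2"
      proof (rule op_normI)
        fix f assume f: "f \<in> ell2 X"
        show "ell2_norm X ((T n \<ominus>\<^bsub>L\<^esub> restrict U (ell2 X)) f) \<le> r / 2 * ell2_norm X f"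
          using tail(2)[OF f Nn] f by (simp add: L_def bounded_op_algebra_apply[OF f])
      qed (use r in simp)
      moreover have "T n \<ominus>\<^bsub>L\<^esub> restrict U (ell2 X) \<in> bounded_ops X"
        unfolding adiff_def L_def by (intro bounded_ops_add bounded_ops_scale T U)
      ultimately show ?thesis using op_norm_nonneg r by fastforce
    qed
    then show "\<exists>no. \<forall>n\<ge>no. norm (op_norm X (T n \<ominus>\<^bsub>L\<^esub> restrict U (ell2 X)) - 0) < r" by blast
  qed
  ultimately show ?thesis by blast
qed

theorem cstar_algebra_bounded_ops: "cstar_algebra (bounded_op_algebra X)"
proof -
  let ?L = "bounded_op_algebra X"
  note ap = bounded_op_algebra_apply
  note closed = bounded_ops_closed
  show ?thesis
    \<comment> \<open>Cases 20 to 22 say that the involution is additive, conjugate homogeneous and antimultiplicative;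
        cases 23 and 28 are definiteness and completeness of the norm.\<close>
  proof (unfold_locales, unfold bounded_op_algebra_simps, goal_cases)
    case (20 S R)
    show ?case
      by (rule op_adjointI)
        (use 20 in \<open>simp_all add: closed ap inner_add_left inner_add_right bounded_opsD(1) inner_op_adjoint\<close>)
  next
    case (21 S c)
    show ?case
      by (rule op_adjointI)
        (use 21 in \<open>simp_all add: closed ap inner_scale_left inner_scale_right bounded_opsD(1) inner_op_adjoint\<close>)
  next
    case (22 S R)
    show ?case
      by (rule op_adjointI)
        (use 22 in \<open>simp_all add: closed ap bounded_opsD(1) inner_op_adjoint\<close>)
  next
    case (23 S)
    show ?case
    proof (rule bounded_ops_ext[OF 23(1) bounded_ops_zero_op])
      fix f assume f: "f \<in> ell2 X"
      show "S f = \<zero>\<^bsub>?L\<^esub> f"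
        using op_norm_bound[OF 23(1) f] 23(2) ell2_norm_eq_0[OF bounded_opsD(1)[OF 23(1) f]]
        by (simp add: ap[OF f] order_antisym)
    qed
  next
    case (28 T)
    show ?case using bounded_ops_complete[OF 28] by simp
  qed (simp_all add: closed op_norm_add_le op_norm_mult_le op_norm_scale op_norm_cstar op_adjoint_adjoint,
      (rule bounded_ops_ext[of _ X], simp_all add: closed ap bounded_opsD ell2_add ell2_scale algebra_simps)+)
qed

section \<open>Operators induced by partial injections\<close>

text \<open>The partial isometry that sends the basis vector of \<open>y\<close> to that of \<open>\<tau> y\<close> for \<open>y \<in> Y\<close>, and the other
  basis vectors to zero.\<close>
definition partial_op :: "'c set \<Rightarrow> 'c set \<Rightarrow> ('c \<Rightarrow> 'c) \<Rightarrow> ('c \<Rightarrow> complex) \<Rightarrow> ('c \<Rightarrow> complex)" where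
  "partial_op X Y \<tau> = (\<lambda>f\<in>ell2 X. \<lambda>x. if x \<in> \<tau> ` Y then f (inv_into Y \<tau> x) else 0)"

definition diag_op :: "'c set \<Rightarrow> 'c set \<Rightarrow> ('c \<Rightarrow> complex) \<Rightarrow> ('c \<Rightarrow> complex)" where
  "diag_op X Z = restrict (cutoff Z) (ell2 X)"

lemma partial_op_apply:
  "f \<in> ell2 X \<Longrightarrow> partial_op X Y \<tau> f = (\<lambda>x. if x \<in> \<tau> ` Y then f (inv_into Y \<tau> x) else 0)"
  by (simp add: partial_op_def)

lemma partial_op_bounded:
  assumes YX: "Y \<subseteq> X" and im: "\<tau> ` Y \<subseteq> X" and inj: "inj_on \<tau> Y"
  shows "partial_op X Y \<tau> \<in> bounded_ops X"
  unfolding partial_op_def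
proof (rule bounded_opsI)
  fix f assume f: "f \<in> ell2 X"
  let ?g = "\<lambda>x. if x \<in> \<tau> ` Y then f (inv_into Y \<tau> x) else 0"
  have le: "L2_set (\<lambda>x. cmod (?g x)) F \<le> 1 * ell2_norm X f" if F: "finite F" "F \<subseteq> X" for F
  proof -
    let ?F = "F \<inter> \<tau> ` Y" and ?G = "inv_into Y \<tau> ` (F \<inter> \<tau> ` Y)"
    have "(\<Sum>x\<in>F. (cmod (?g x))\<^sup>2) = (\<Sum>x\<in>?F. (cmod (f (inv_into Y \<tau> x)))\<^sup>2)"
      using F by (intro sum.mono_neutral_cong_right) auto
    also have "\<dots> = (\<Sum>y\<in>?G. (cmod (f y))\<^sup>2)"
      by (subst sum.reindex) (auto intro: inj_on_subset[OF inj_on_inv_into])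
    finally have "L2_set (\<lambda>x. cmod (?g x)) F = L2_set (\<lambda>y. cmod (f y)) ?G"
      by (simp add: L2_set_def)
    also have "\<dots> \<le> ell2_norm X f"
    proof (rule L2_set_le_ell2_norm[OF f])
      show "?G \<subseteq> X" using YX inv_into_into[of _ \<tau> Y] by blast
    qed (use F in simp)
    finally show ?thesis by simp
  qed
  have out: "?g x = 0" if "x \<notin> X" for x using im that by auto
  show "?g \<in> ell2 X" using out le by (rule ell2I(1))
  show "ell2_norm X ?g \<le> 1 * ell2_norm X f" using out le by (rule ell2I(2))
qed (auto simp: fun_eq_iff)

lemma partial_op_delta:
  assumes "\<gamma> \<in> X" and inj: "inj_on \<tau> Y"
  shows "partial_op X Y \<tau> (delta \<gamma>) = (if \<gamma> \<in> Y then delta (\<tau> \<gamma>) else (\<lambda>x. 0))"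
proof (rule ext)
  fix x
  show "partial_op X Y \<tau> (delta \<gamma>) x = (if \<gamma> \<in> Y then delta (\<tau> \<gamma>) else (\<lambda>x. 0)) x"
    unfolding partial_op_apply[OF delta_ell2(1)[OF assms(1)]]
    using inv_into_into[of x \<tau> Y] f_inv_into_f[of x \<tau> Y] inv_into_f_f[OF inj, of \<gamma>]
    by (auto simp: delta_def)
qed

lemma partial_op_adjoint:
  assumes YX: "Y \<subseteq> X" and im: "\<tau> ` Y \<subseteq> X" and inj: "inj_on \<tau> Y" and g: "g \<in> ell2 X"
  shows "op_adjoint X (partial_op X Y \<tau>) g = (\<lambda>y. if y \<in> Y then g (\<tau> y) else 0)"
proof (rule ext)
  fix y
  have "ell2_inner X g (\<lambda>x. 0) = 0" by (simp add: ell2_inner_def)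
  moreover have "\<tau> y \<in> X" if "y \<in> Y" using im that by auto
  ultimately show "op_adjoint X (partial_op X Y \<tau>) g y = (if y \<in> Y then g (\<tau> y) else 0)"
    using YX g by (auto simp: op_adjoint_eq_adjoint_op[OF partial_op_bounded[OF YX im inj]] adjoint_op_def
        partial_op_delta[OF _ inj] inner_delta)
qed

lemma diag_op_apply: "f \<in> ell2 X \<Longrightarrow> diag_op X Z f = (\<lambda>x. if x \<in> Z then f x else 0)"
  by (simp add: diag_op_def cutoff_def)

lemma partial_op_initial_projection:
  assumes "Y \<subseteq> X" "\<tau> ` Y \<subseteq> X" "inj_on \<tau> Y"
  shows "op_adjoint X (partial_op X Y \<tau>) \<otimes>\<^bsub>bounded_op_algebra X\<^esub> partial_op X Y \<tau> = diag_op X Y"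
    (is "?P = _")
proof (rule ext)
  fix f show "?P f = diag_op X Y f"
  proof (cases "f \<in> ell2 X")
    case True
    note W = bounded_opsD(1)[OF partial_op_bounded[OF assms] True]
    show ?thesis
      unfolding bounded_op_algebra_apply[OF True] partial_op_adjoint[OF assms W] diag_op_apply[OF True]
      using assms(3) by (auto simp: partial_op_apply[OF True] fun_eq_iff inv_into_f_f)
  qed (simp add: bounded_op_algebra_def compose_def diag_op_def)
qed

lemma partial_op_range_projection:
  assumes "Y \<subseteq> X" "\<tau> ` Y \<subseteq> X" "inj_on \<tau> Y"
  shows "partial_op X Y \<tau> \<otimes>\<^bsub>bounded_op_algebra X\<^esub> op_adjoint X (partial_op X Y \<tau>) = diag_op X (\<tau> ` Y)"
    (is "?P = _")
proof (rule ext)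
  fix f show "?P f = diag_op X (\<tau> ` Y) f"
  proof (cases "f \<in> ell2 X")
    case True
    note W = bounded_opsD(1)[OF bounded_ops_adjoint[OF partial_op_bounded[OF assms]] True]
    show ?thesis
      unfolding bounded_op_algebra_apply[OF True] diag_op_apply[OF True] partial_op_apply[OF W]
      by (auto simp: partial_op_adjoint[OF assms True] fun_eq_iff inv_into_into f_inv_into_f)
  qed (simp add: bounded_op_algebra_def compose_def diag_op_def)
qed

lemma diag_op_partial: "Z \<subseteq> X \<Longrightarrow> partial_op X Z (\<lambda>x. x) = diag_op X Z"
  by (rule ext) (auto simp: partial_op_def diag_op_def cutoff_def fun_eq_iff inv_into_f_f[where f = "\<lambda>x. x"])

lemma diag_op_bounded: "Z \<subseteq> X \<Longrightarrow> diag_op X Z \<in> bounded_ops X"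
  using partial_op_bounded[of Z X "\<lambda>x. x"] by (simp add: diag_op_partial)

lemma diag_op_adjoint: assumes "Z \<subseteq> X" shows "op_adjoint X (diag_op X Z) = diag_op X Z"
proof (rule bounded_ops_ext[OF bounded_ops_adjoint[OF diag_op_bounded[OF assms]] diag_op_bounded[OF assms]])
  fix f assume f: "f \<in> ell2 X"
  show "op_adjoint X (diag_op X Z) f = diag_op X Z f"
    using partial_op_adjoint[of Z X "\<lambda>x. x" f] assms f
    by (simp add: diag_op_partial diag_op_apply)
qed

lemma diag_op_in_ell2:
  assumes f: "f \<in> ell2 X" and Z: "Z \<subseteq> X" shows "(\<lambda>x. if x \<in> Z then f x else 0) \<in> ell2 X"
  using bounded_opsD(1)[OF diag_op_bounded[OF Z] f] by (simp add: diag_op_apply[OF f])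

lemma diag_op_mult:
  assumes "Z \<subseteq> X" "W \<subseteq> X"
  shows "diag_op X Z \<otimes>\<^bsub>bounded_op_algebra X\<^esub> diag_op X W = diag_op X (Z \<inter> W)"
proof (rule bounded_ops_ext)
  show "diag_op X Z \<otimes>\<^bsub>bounded_op_algebra X\<^esub> diag_op X W \<in> bounded_ops X" "diag_op X (Z \<inter> W) \<in> bounded_ops X"
    using assms by (auto intro: bounded_ops_mult diag_op_bounded)
  fix f assume f: "f \<in> ell2 X"
  show "(diag_op X Z \<otimes>\<^bsub>bounded_op_algebra X\<^esub> diag_op X W) f = diag_op X (Z \<inter> W) f"
    using diag_op_in_ell2[OF f assms(2)]
    by (simp add: bounded_op_algebra_apply[OF f] diag_op_apply f fun_eq_iff)
qed

lemma diag_op_empty: "diag_op X {} = \<zero>\<^bsub>bounded_op_algebra X\<^esub>"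
  by (rule ext) (simp add: diag_op_def bounded_op_algebra_def cutoff_def)

text \<open>\<open>p \<or> q = p + (q - q p)\<close> for commuting projections. The summands are arranged so that both \<open>p\<close> and
  \<open>q p\<close> lie in the left ideal of \<open>p\<close>.\<close>
lemma diag_op_Un:
  assumes "Z \<subseteq> X" "W \<subseteq> X"
  shows "diag_op X (Z \<union> W) = diag_op X Z \<oplus>\<^bsub>bounded_op_algebra X\<^esub> (diag_op X W \<oplus>\<^bsub>bounded_op_algebra X\<^esub>
    (-1) \<odot>\<^bsub>bounded_op_algebra X\<^esub> (diag_op X W \<otimes>\<^bsub>bounded_op_algebra X\<^esub> diag_op X Z))" (is "_ = ?R")
proof (rule bounded_ops_ext)
  show "diag_op X (Z \<union> W) \<in> bounded_ops X" using assms by (intro diag_op_bounded) auto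
  show "?R \<in> bounded_ops X"
    using assms by (intro bounded_ops_add bounded_ops_scale bounded_ops_mult diag_op_bounded)
  fix f assume f: "f \<in> ell2 X"
  show "diag_op X (Z \<union> W) f = ?R f"
    unfolding diag_op_mult[OF assms(2,1)]
    by (auto simp: bounded_op_algebra_apply[OF f] diag_op_apply f fun_eq_iff)
qed

lemma left_ideal_subset:
  assumes "cstar_algebra B" "P \<subseteq> carr B" shows "left_ideal B P \<subseteq> carr B"
proof
  interpret cstar_algebra B by fact
  fix x assume "x \<in> left_ideal B P"
  then show "x \<in> carr B" by induction (use assms(2) in auto)
qed

section \<open>The regular representation\<close>
locale left_cancellative_category = small_category \<C> for \<C> :: "'c small_cat" +
  assumes cancel: "left_cancellative \<C>"
begin

definition composable :: "'c \<Rightarrow> 'c set" where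
  "composable \<alpha> = {\<beta> \<in> mor \<C>. rng \<C> \<beta> = src \<C> \<alpha>}"

lemma right_ideal_image: "right_ideal \<C> \<alpha> = cmp \<C> \<alpha> ` composable \<alpha>"
  by (auto simp: right_ideal_def composable_def)

lemma composable_subset: "composable \<alpha> \<subseteq> mor \<C>"
  by (auto simp: composable_def)

lemma right_ideal_subset: "\<alpha> \<in> mor \<C> \<Longrightarrow> right_ideal \<C> \<alpha> \<subseteq> mor \<C>"
  by (auto simp: right_ideal_def cmp_closed)

lemma inj_on_cmp: "\<alpha> \<in> mor \<C> \<Longrightarrow> inj_on (cmp \<C> \<alpha>) (composable \<alpha>)"
  using cancel unfolding left_cancellative_def inj_on_def composable_def by (auto dest: sym)

lemma src_in_mor: "\<alpha> \<in> mor \<C> \<Longrightarrow> src \<C> \<alpha> \<in> mor \<C>"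
  using src_vert vert_subset by blast

lemma right_ideal_src: assumes "\<alpha> \<in> mor \<C>" shows "right_ideal \<C> (src \<C> \<alpha>) = composable \<alpha>"
proof -
  have "cmp \<C> (src \<C> \<alpha>) \<beta> = \<beta>" if "\<beta> \<in> composable \<alpha>" for \<beta>
    using that cmp_rng[of \<beta>] by (auto simp: composable_def)
  then show ?thesis
    using src_id[OF src_vert[OF assms]]
    by (auto simp: right_ideal_image composable_def image_iff)
qed

lemma partial_op_args:
  assumes "\<alpha> \<in> mor \<C>"
  shows "composable \<alpha> \<subseteq> mor \<C>" "cmp \<C> \<alpha> ` composable \<alpha> \<subseteq> mor \<C>" "inj_on (cmp \<C> \<alpha>) (composable \<alpha>)"
  using assms composable_subset right_ideal_subset inj_on_cmp right_ideal_image by auto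

text \<open>The description of the regular operator determines it, because bounded operators agree as soon as they agree
  on basis vectors.\<close>
lemma regular_op_eq:
  assumes \<alpha>: "\<alpha> \<in> mor \<C>" shows "regular_op \<C> \<alpha> = partial_op (mor \<C>) (composable \<alpha>) (cmp \<C> \<alpha>)"
  unfolding regular_op_def right_ideal_src[OF \<alpha>]
proof (rule the_equality)
  let ?W = "partial_op (mor \<C>) (composable \<alpha>) (cmp \<C> \<alpha>)"
  have W: "?W \<in> bounded_ops (mor \<C>)" by (rule partial_op_bounded[OF partial_op_args[OF \<alpha>]])
  show spec: "?W \<in> bounded_ops (mor \<C>) \<and> (\<forall>\<gamma>\<in>mor \<C>. ?W (delta \<gamma>) =
      (if \<gamma> \<in> composable \<alpha> then delta (cmp \<C> \<alpha> \<gamma>) else (\<lambda>x. 0)))"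
    using W partial_op_delta[OF _ inj_on_cmp[OF \<alpha>]] by blast
  fix S assume "S \<in> bounded_ops (mor \<C>) \<and> (\<forall>\<gamma>\<in>mor \<C>. S (delta \<gamma>) =
      (if \<gamma> \<in> composable \<alpha> then delta (cmp \<C> \<alpha> \<gamma>) else (\<lambda>x. 0)))"
  then show "S = ?W" using spec by (intro bounded_ops_eq_on_delta[of S "mor \<C>"]) auto
qed

lemma regular_op_bounded: "\<alpha> \<in> mor \<C> \<Longrightarrow> regular_op \<C> \<alpha> \<in> bounded_ops (mor \<C>)"
  by (simp add: regular_op_eq partial_op_bounded partial_op_args)

lemma regular_op_delta:
  "\<lbrakk>\<alpha> \<in> mor \<C>; \<gamma> \<in> mor \<C>\<rbrakk>
    \<Longrightarrow> regular_op \<C> \<alpha> (delta \<gamma>) = (if rng \<C> \<gamma> = src \<C> \<alpha> then delta (cmp \<C> \<alpha> \<gamma>) else (\<lambda>x. 0))"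
  by (simp add: regular_op_eq partial_op_delta inj_on_cmp) (simp add: composable_def)

abbreviation "L \<equiv> bounded_op_algebra (mor \<C>)"

lemma regular_op_initial:
  assumes \<alpha>: "\<alpha> \<in> mor \<C>"
  shows "(regular_op \<C> \<alpha>)\<^sup>\<star>\<^bsub>L\<^esub> \<otimes>\<^bsub>L\<^esub> regular_op \<C> \<alpha> = regular_op \<C> (src \<C> \<alpha>)"
proof -
  note v = src_in_mor[OF \<alpha>]
  have "diag_op (mor \<C>) (composable \<alpha>) = regular_op \<C> (src \<C> \<alpha>)"
  proof (rule bounded_ops_eq_on_delta)
    show "diag_op (mor \<C>) (composable \<alpha>) \<in> bounded_ops (mor \<C>)"
      by (rule diag_op_bounded[OF composable_subset])
    show "regular_op \<C> (src \<C> \<alpha>) \<in> bounded_ops (mor \<C>)" by (rule regular_op_bounded[OF v])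
    fix \<gamma> assume \<gamma>: "\<gamma> \<in> mor \<C>"
    show "diag_op (mor \<C>) (composable \<alpha>) (delta \<gamma>) = regular_op \<C> (src \<C> \<alpha>) (delta \<gamma>)"
      unfolding regular_op_delta[OF v \<gamma>] diag_op_apply[OF delta_ell2(1)[OF \<gamma>]]
      using \<gamma> src_id[OF src_vert[OF \<alpha>]] cmp_rng[OF \<gamma>]
      by (auto simp: composable_def delta_def fun_eq_iff)
  qed
  then show ?thesis
    using partial_op_initial_projection[OF partial_op_args[OF \<alpha>]]
    by (simp add: regular_op_eq[OF \<alpha>] bounded_op_algebra_simps)
qed

lemma regular_op_mult:
  assumes \<alpha>: "\<alpha> \<in> mor \<C>" and \<beta>: "\<beta> \<in> mor \<C>" and comp: "src \<C> \<alpha> = rng \<C> \<beta>"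
  shows "regular_op \<C> \<alpha> \<otimes>\<^bsub>L\<^esub> regular_op \<C> \<beta> = regular_op \<C> (cmp \<C> \<alpha> \<beta>)"
proof (rule bounded_ops_eq_on_delta)
  note \<alpha>\<beta> = cmp_closed[OF \<alpha> \<beta> comp]
  show "regular_op \<C> \<alpha> \<otimes>\<^bsub>L\<^esub> regular_op \<C> \<beta> \<in> bounded_ops (mor \<C>)"
    by (intro bounded_ops_mult regular_op_bounded \<alpha> \<beta>)
  show "regular_op \<C> (cmp \<C> \<alpha> \<beta>) \<in> bounded_ops (mor \<C>)" by (rule regular_op_bounded[OF \<alpha>\<beta>])
  fix \<gamma> assume \<gamma>: "\<gamma> \<in> mor \<C>"
  show "(regular_op \<C> \<alpha> \<otimes>\<^bsub>L\<^esub> regular_op \<C> \<beta>) (delta \<gamma>) = regular_op \<C> (cmp \<C> \<alpha> \<beta>) (delta \<gamma>)"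
  proof (cases "rng \<C> \<gamma> = src \<C> \<beta>")
    case True
    then have "cmp \<C> \<beta> \<gamma> \<in> mor \<C>" "rng \<C> (cmp \<C> \<beta> \<gamma>) = src \<C> \<alpha>"
      using \<beta> \<gamma> comp by (auto simp: cmp_closed rng_cmp)
    then show ?thesis
      using True \<alpha> \<beta> \<gamma> comp \<alpha>\<beta>
      by (simp add: bounded_op_algebra_apply delta_ell2 regular_op_delta src_cmp cmp_assoc)
  next
    case False
    then show ?thesis
      using \<alpha> \<beta> \<gamma> comp \<alpha>\<beta> bounded_ops_zero[OF regular_op_bounded[OF \<alpha>]]
      by (simp add: bounded_op_algebra_apply delta_ell2 regular_op_delta src_cmp)
  qed
qed

lemma regular_op_range:
  assumes \<alpha>: "\<alpha> \<in> mor \<C>"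
  shows "regular_op \<C> \<alpha> \<otimes>\<^bsub>L\<^esub> (regular_op \<C> \<alpha>)\<^sup>\<star>\<^bsub>L\<^esub> = diag_op (mor \<C>) (right_ideal \<C> \<alpha>)"
  using partial_op_range_projection[OF partial_op_args[OF \<alpha>]]
  by (simp add: regular_op_eq[OF \<alpha>] bounded_op_algebra_simps right_ideal_image)

abbreviation "T \<equiv> regular_toeplitz \<C>"

lemma regular_toeplitz_ops:
  "x \<oplus>\<^bsub>T\<^esub> y = x \<oplus>\<^bsub>L\<^esub> y" "c \<odot>\<^bsub>T\<^esub> x = c \<odot>\<^bsub>L\<^esub> x" "x \<otimes>\<^bsub>T\<^esub> y = x \<otimes>\<^bsub>L\<^esub> y" "x\<^sup>\<star>\<^bsub>T\<^esub> = x\<^sup>\<star>\<^bsub>L\<^esub>"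
  "\<zero>\<^bsub>T\<^esub> = \<zero>\<^bsub>L\<^esub>"
  by (simp_all add: regular_toeplitz_def cstar_generated_def)

lemma cstar_algebra_regular_toeplitz: "cstar_algebra T"
  unfolding regular_toeplitz_def by (intro cstar_algebra_generated cstar_algebra_bounded_ops)

lemma regular_op_in_toeplitz: "\<alpha> \<in> mor \<C> \<Longrightarrow> regular_op \<C> \<alpha> \<in> carr T"
  using generated_subset[of "regular_op \<C> ` mor \<C>" L] regular_op_bounded
  by (auto simp: regular_toeplitz_def bounded_op_algebra_simps)

lemma range_proj_regular:
  "\<alpha> \<in> mor \<C> \<Longrightarrow> range_proj T (regular_op \<C>) \<alpha> = diag_op (mor \<C>) (right_ideal \<C> \<alpha>)"
  by (simp add: range_proj_def regular_toeplitz_ops regular_op_range)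

lemma range_proj_closed: "\<alpha> \<in> mor \<C> \<Longrightarrow> range_proj T (regular_op \<C>) \<alpha> \<in> carr T"
proof -
  interpret T: cstar_algebra T by (rule cstar_algebra_regular_toeplitz)
  show "\<alpha> \<in> mor \<C> \<Longrightarrow> range_proj T (regular_op \<C>) \<alpha> \<in> carr T"
    by (simp add: range_proj_def regular_op_in_toeplitz)
qed

lemma diag_union_in_left_ideal:
  assumes F: "finite F" "F \<subseteq> mor \<C>"
  shows "diag_op (mor \<C>) (\<Union>\<gamma>\<in>F. right_ideal \<C> \<gamma>) \<in> left_ideal T (range_proj T (regular_op \<C>) ` F)"
proof -
  let ?P = "range_proj T (regular_op \<C>) ` F"
  have P: "?P \<subseteq> carr T" using F(2) range_proj_closed by blast
  note carr = left_ideal_subset[OF cstar_algebra_regular_toeplitz P]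
  have "diag_op (mor \<C>) (\<Union>\<gamma>\<in>G. right_ideal \<C> \<gamma>) \<in> left_ideal T ?P" if "finite G" "G \<subseteq> F" for G
    using that
  proof (induction G)
    case empty
    show ?case using left_ideal_zero[of T ?P] by (simp add: diag_op_empty regular_toeplitz_ops)
  next
    case (insert \<gamma> G)
    let ?U = "\<Union>\<gamma>\<in>G. right_ideal \<C> \<gamma>"
    have \<gamma>: "\<gamma> \<in> mor \<C>" using insert F by auto
    have U: "?U \<subseteq> mor \<C>" using insert F right_ideal_subset by blast
    have IH: "diag_op (mor \<C>) ?U \<in> left_ideal T ?P" using insert by auto
    have p: "diag_op (mor \<C>) (right_ideal \<C> \<gamma>) \<in> left_ideal T ?P"
      unfolding range_proj_regular[OF \<gamma>, symmetric] using insert by (intro left_ideal_base) auto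
    show ?case
      unfolding UN_insert diag_op_Un[OF right_ideal_subset[OF \<gamma>] U, folded regular_toeplitz_ops]
      using IH p carr by (intro left_ideal_add left_ideal_scale left_ideal_mult) auto
  qed
  then show ?thesis using F by blast
qed

text \<open>The relation for range projections is \<open>bidual_join\<close> applied to the diagonal projection of the union
  of the ideals \<open>\<gamma>\<C>\<close>.\<close>
theorem regular_representation: "cat_representation \<C> T (regular_op \<C>)"
  unfolding cat_representation_def
proof (intro conjI ballI allI impI)
  show cstar: "cstar_algebra T" by (rule cstar_algebra_regular_toeplitz)
  show "regular_op \<C> \<in> mor \<C> \<rightarrow> carr T" using regular_op_in_toeplitz by auto
  fix \<alpha> assume \<alpha>: "\<alpha> \<in> mor \<C>"
  show "(regular_op \<C> \<alpha>)\<^sup>\<star>\<^bsub>T\<^esub> \<otimes>\<^bsub>T\<^esub> regular_op \<C> \<alpha> = regular_op \<C> (src \<C> \<alpha>)"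
    using regular_op_initial[OF \<alpha>] by (simp add: regular_toeplitz_ops)
  fix \<beta> assume \<beta>: "\<beta> \<in> mor \<C>"
  show "regular_op \<C> \<alpha> \<otimes>\<^bsub>T\<^esub> regular_op \<C> \<beta> = regular_op \<C> (cmp \<C> \<alpha> \<beta>)" if "src \<C> \<alpha> = rng \<C> \<beta>"
    using regular_op_mult[OF \<alpha> \<beta> that] by (simp add: regular_toeplitz_ops)
  fix F assume vee: "is_vee \<C> \<alpha> \<beta> F"
  let ?q = "range_proj T (regular_op \<C>) \<alpha> \<otimes>\<^bsub>T\<^esub> range_proj T (regular_op \<C>) \<beta>"
  let ?Z = "\<Union>\<gamma>\<in>F. right_ideal \<C> \<gamma>"
  interpret T: cstar_algebra T by (rule cstar)
  have F: "finite F" "F \<subseteq> mor \<C>" and Z: "right_ideal \<C> \<alpha> \<inter> right_ideal \<C> \<beta> = ?Z"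
    using vee by (auto simp: is_vee_def)
  have ZX: "?Z \<subseteq> mor \<C>" using F right_ideal_subset by blast
  have q: "?q = diag_op (mor \<C>) ?Z"
    using diag_op_mult[OF right_ideal_subset[OF \<alpha>] right_ideal_subset[OF \<beta>]] Z
    by (simp add: range_proj_regular \<alpha> \<beta> regular_toeplitz_ops)
  have qc: "?q \<in> carr T" using range_proj_closed \<alpha> \<beta> by simp
  show "is_proj_join (bidual T) (to_bidual T ` range_proj T (regular_op \<C>) ` F) (to_bidual T ?q)"
  proof (rule T.bidual_join)
    show "projection T ?q"
      using qc diag_op_mult[OF ZX ZX] diag_op_adjoint[OF ZX] unfolding projection_def q
      by (simp add: regular_toeplitz_ops bounded_op_algebra_simps)
    show "range_proj T (regular_op \<C>) ` F \<subseteq> carr T" using F range_proj_closed by blast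
    show "?q \<in> left_ideal T (range_proj T (regular_op \<C>) ` F)"
      unfolding q by (rule diag_union_in_left_ideal[OF F])
    fix p assume "p \<in> range_proj T (regular_op \<C>) ` F"
    then obtain \<gamma> where \<gamma>: "\<gamma> \<in> F" "p = diag_op (mor \<C>) (right_ideal \<C> \<gamma>)"
      using F range_proj_regular by auto
    have "right_ideal \<C> \<gamma> \<inter> ?Z = right_ideal \<C> \<gamma>" using \<gamma>(1) by blast
    then show "p \<otimes>\<^bsub>T\<^esub> ?q = p"
      unfolding q unfolding \<gamma>(2) regular_toeplitz_ops
      using diag_op_mult[OF right_ideal_subset ZX, of \<gamma>] \<gamma>(1) F by auto
  qed
qed

end

theorem proposition7p2:
  fixes \<C> :: "'c small_cat" and A :: "'a cstar_alg" and t :: "'c \<Rightarrow> 'a"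
  assumes "small_category \<C>" and "left_cancellative \<C>" and "finitely_aligned \<C>"
    and "toeplitz_algebra \<C> A t"
  shows "cat_representation \<C> (regular_toeplitz \<C>) (regular_op \<C>) \<and>
    canonical_hom \<C> A t (regular_toeplitz \<C>) (regular_op \<C>) \<in> star_hom A (regular_toeplitz \<C>) \<and>
    (\<forall>\<alpha>\<in>mor \<C>.
      canonical_hom \<C> A t (regular_toeplitz \<C>) (regular_op \<C>) (t \<alpha>) = regular_op \<C> \<alpha>) \<and>
    canonical_hom \<C> A t (regular_toeplitz \<C>) (regular_op \<C>) ` carr A = carr (regular_toeplitz \<C>)"
proof -
  interpret small_category \<C> by fact
  interpret left_cancellative_category \<C> by unfold_locales fact
  let ?\<phi> = "canonical_hom \<C> A t T (regular_op \<C>)"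
  note rep = regular_representation
  have A: "cat_representation \<C> A t"
    and univ: "\<exists>!\<phi>. \<phi> \<in> star_hom A T \<and> (\<forall>\<alpha>\<in>mor \<C>. \<phi> (t \<alpha>) = regular_op \<C> \<alpha>)"
    using assms(4) rep unfolding toeplitz_algebra_def universal_rep_def by blast+
  have \<phi>: "?\<phi> \<in> star_hom A T" and \<phi>t: "\<forall>\<alpha>\<in>mor \<C>. ?\<phi> (t \<alpha>) = regular_op \<C> \<alpha>"
    using theI'[OF univ] unfolding canonical_hom_def by blast+
  have sub: "carr T \<subseteq> carr L" by (auto simp: regular_toeplitz_def cstar_generated_def)
  have \<phi>L: "?\<phi> \<in> star_hom A L"
    using \<phi> sub by (auto simp: star_hom_def regular_toeplitz_ops PiE_iff)
  \<comment> \<open>\<open>\<phi>\<close> is regarded as a map into all bounded operators, since the regular Toeplitz algebra is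
      defined by minimality among the C*-subalgebras of those.\<close>
  interpret hom: cstar_hom A L ?\<phi>
    using A \<phi>L by (simp add: cstar_hom_def cstar_hom_axioms_def cat_representation_def cstar_algebra_bounded_ops)
  have t: "t \<alpha> \<in> carr A" if "\<alpha> \<in> mor \<C>" for \<alpha>
    using A that by (auto simp: cat_representation_def)
  have "regular_op \<C> ` mor \<C> \<subseteq> ?\<phi> ` carr A"
  proof
    fix S assume "S \<in> regular_op \<C> ` mor \<C>"
    then obtain \<alpha> where "\<alpha> \<in> mor \<C>" "S = regular_op \<C> \<alpha>" by blast
    then show "S \<in> ?\<phi> ` carr A" using t \<phi>t by (intro image_eqI[of _ _ "t \<alpha>"]) auto
  qed
  then have "carr T \<subseteq> ?\<phi> ` carr A"
    unfolding regular_toeplitz_def by (rule generated_minimal[OF hom.image_cstar_subalgebra[unfolded regular_toeplitz_def]])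
  moreover have "?\<phi> ` carr A \<subseteq> carr T"
    using \<phi> by (auto simp: star_hom_def PiE_iff)
  ultimately show ?thesis using rep \<phi> \<phi>t by blast
qed

end
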